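(* For any $m\ge 3$, any $m$-gon category $\mathcal{C}_m$ and any even number $n\ge 4$, there is a reflective directed $\{m,n\}$ tiling on $\mathcal{C}_m$ of the space $S_{m,n}$.
   Context: **The space $S_{m,n}$.** $S_{m,n}$ is the sphere if $\{m,n\}$ is one of the symbols $\{3,3\},\{3,4\},\{4,3\},\{3,5\},\{5,3\}$; the Euclidean plane if it is one of $\{3,6\},\{4,4\},\{6,3\}$; and the hyperbolic plane otherwise (symbols are ordered pairs: $m$-gons, $n$ at each vertex). **$m$-gon categories.** For $m\ge 3$, an $m$-gon category $\mathcal{C}_m$ has three objects $0,1,2$ and exactly the following (distinct) non-identity morphisms: $s,t\colon 0\to 1$; $d^1,\dots,d^m\colon 1\to 2$; $v^1,\dots,v^m\colon 0\to 2$; with composition satisfying $\{d^i\circ s,\,d^i\circ t\}=\{v^i,v^{i+1}\}$ for $i=1,\dots,m$ (indices mod $m$, in $\{1,\dots,m\}$). **Presheaves.** A presheaf $T$ on $\mathcal{C}_m$ has sets $T_0$ (vertices), $T_1$ (edges), $T_2$ (tiles) and structure maps $s,t\colon T_1\to T_0$, $d_1,\dots,d_m\colon T_2\to T_1$ (and $v_1,\dots,v_m\colon T_2\to T_0$) induced by $s,t,d^i,v^i$. Let $y(i)=\mathrm{Hom}(-,i)$. The geometric realization $|T|$ is taken with respect to the functor $\mathcal{C}_m\to\mathsf{Top}$ sending $0$ to a point, $1$ to an interval, $2$ to a standard (filled) $m$-gon, $s,t$ to the endpoint inclusions and $d^1,\dots,d^m$ to the successive edge inclusions. **Directed tilings.**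 A directed $\{m,n\}$ tiling on $\mathcal{C}_m$ of a space $X$ is a presheaf $T$ on $\mathcal{C}_m$ such that: (1) for each $x\in T_i$ the corresponding map $y(i)\to T$ is levelwise injective; (2) any two distinct tiles have at most one edge in common; (3) each vertex $v\in T_0$ has exactly $n$ edges $e$ with $s(e)=v$ or $t(e)=v$; (4) $|T|$ is homeomorphic to $X$. It is **reflective** if for every edge $e$ lying between two adjacent (distinct) tiles $x_1,x_2$ there is $i\in\{1,\dots,m\}$ with $e=d_i(x_1)=d_i(x_2)$. *)

theory Defs
  imports "HOL-Analysis.Analysis"
begin

section \<open>Categories and presheaves\<close>

record ('o, 'm) category =
  Obj :: "'o set"
  Arr :: "'m set"
  Dom :: "'m \<Rightarrow> 'o"
  Cod :: "'m \<Rightarrow> 'o"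
  Ident :: "'o \<Rightarrow> 'm"
  Comp :: "'m \<Rightarrow> 'm \<Rightarrow> 'm"  \<comment> \<open>\<open>Comp C g f\<close> is \<open>g \<circ> f\<close>\<close>

definition hom :: "('o, 'm) category \<Rightarrow> 'o \<Rightarrow> 'o \<Rightarrow> 'm set" where
  "hom C a b = {f \<in> Arr C. Dom C f = a \<and> Cod C f = b}"

definition is_category :: "('o, 'm) category \<Rightarrow> bool" where
  "is_category C \<longleftrightarrow>
    (\<forall>f\<in>Arr C. Dom C f \<in> Obj C \<and> Cod C f \<in> Obj C) \<and>
    (\<forall>a\<in>Obj C. Ident C a \<in> hom C a a) \<and>
    (\<forall>f\<in>Arr C. \<forall>g\<in>Arr C. Cod C f = Dom C g \<longrightarrow> Comp C g f \<in> hom C (Dom C f) (Cod C g)) \<and>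
    (\<forall>f\<in>Arr C. Comp C f (Ident C (Dom C f)) = f \<and> Comp C (Ident C (Cod C f)) f = f) \<and>
    (\<forall>f\<in>Arr C. \<forall>g\<in>Arr C. \<forall>h\<in>Arr C. Cod C f = Dom C g \<and> Cod C g = Dom C h \<longrightarrow>
        Comp C h (Comp C g f) = Comp C (Comp C h g) f)"

text \<open>The levels \<open>Lev T a\<close> all live in one type \<open>'a\<close>, but they are not required to be disjoint.\<close>

record ('o, 'm, 'a) presheaf =
  Lev :: "'o \<Rightarrow> 'a set"
  Act :: "'m \<Rightarrow> 'a \<Rightarrow> 'a"

definition is_presheaf :: "('o, 'm) category \<Rightarrow> ('o, 'm, 'a) presheaf \<Rightarrow> bool" where
  "is_presheaf C T \<longleftrightarrow>
    (\<forall>f\<in>Arr C. Act T f \<in> Lev T (Cod C f) \<rightarrow> Lev T (Dom C f)) \<and>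
    (\<forall>a\<in>Obj C. \<forall>x\<in>Lev T a. Act T (Ident C a) x = x) \<and>
    (\<forall>f\<in>Arr C. \<forall>g\<in>Arr C. Cod C f = Dom C g \<longrightarrow>
        (\<forall>x\<in>Lev T (Cod C g). Act T (Comp C g f) x = Act T f (Act T g x)))"

text \<open>
  By the Yoneda lemma an element \<open>x\<close> of \<open>Lev T a\<close> corresponds to the map \<open>Hom(-,a) \<rightarrow> T\<close> sending
  \<open>f : b \<rightarrow> a\<close> to \<open>Act T f x\<close>; this is that map, at any level \<open>b\<close>.
\<close>

definition yoneda_map :: "('o, 'm, 'a) presheaf \<Rightarrow> 'a \<Rightarrow> 'm \<Rightarrow> 'a" where
  "yoneda_map T x = (\<lambda>f. Act T f x)"


section \<open>Geometric realization\<close>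

definition quotient_topology :: "'p topology \<Rightarrow> ('p \<times> 'p) set \<Rightarrow> 'p set topology" where
  "quotient_topology X E =
    topology (\<lambda>U. U \<subseteq> topspace X // E \<and> openin X {p \<in> topspace X. E `` {p} \<in> U})"

lemma openin_quotient_topology:
  "openin (quotient_topology X E) U \<longleftrightarrow>
    U \<subseteq> topspace X // E \<and> openin X {p \<in> topspace X. E `` {p} \<in> U}"
proof -
  have "istopology (\<lambda>U. U \<subseteq> topspace X // E \<and> openin X {p \<in> topspace X. E `` {p} \<in> U})"
  proof -
    have 1: "{p \<in> topspace X. E `` {p} \<in> S \<inter> T} =
        {p \<in> topspace X. E `` {p} \<in> S} \<inter> {p \<in> topspace X. E `` {p} \<in> T}" for S T
      by auto
    have 2: "{p \<in> topspace X. E `` {p} \<in> \<Union>K} = (\<Union>S\<in>K. {p \<in> topspace X. E `` {p} \<in> S})" for K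
      by auto
    show ?thesis
      unfolding istopology_def 1 2 by blast
  qed
  then show ?thesis
    by (simp add: quotient_topology_def)
qed

lemma quotient_map_quotient_topology:
  "quotient_map X (quotient_topology X E) (\<lambda>p. E `` {p})"
proof -
  have "{p \<in> topspace X. E `` {p} \<in> topspace X // E} = topspace X"
    by (auto intro: quotientI)
  then have "openin (quotient_topology X E) (topspace X // E)"
    by (simp add: openin_quotient_topology)
  then have top: "topspace (quotient_topology X E) = topspace X // E"
    by (metis openin_quotient_topology openin_subset openin_topspace subset_antisym)
  show ?thesis
    unfolding quotient_map_def top by (auto simp: openin_quotient_topology quotient_def)
qed

text \<open>
  The realization of a presheaf \<open>T\<close> with respect to a functor to topological spaces, given by
  \<open>D\<close> on objects and \<open>F\<close> on arrows: the coend of the spaces \<open>T(a) \<times> D(a)\<close> with \<open>T(a)\<close> discrete.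
  A point \<open>p\<close> of the copy of \<open>D(a)\<close> indexed by \<open>x \<in> T(a)\<close> is written \<open>((a, x), p)\<close>.
\<close>

definition gluing :: "('o, 'm) category \<Rightarrow> ('o, 'm, 'a) presheaf \<Rightarrow> ('o \<Rightarrow> 'p topology) \<Rightarrow>
    ('m \<Rightarrow> 'p \<Rightarrow> 'p) \<Rightarrow> ((('o \<times> 'a) \<times> 'p) \<times> (('o \<times> 'a) \<times> 'p)) set" where
  "gluing C T D F =
    {(((Dom C f, Act T f x), p), ((Cod C f, x), F f p)) | f x p.
       f \<in> Arr C \<and> x \<in> Lev T (Cod C f) \<and> p \<in> topspace (D (Dom C f))}"

definition realization :: "('o, 'm) category \<Rightarrow> ('o, 'm, 'a) presheaf \<Rightarrow> ('o \<Rightarrow> 'p topology) \<Rightarrow>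
    ('m \<Rightarrow> 'p \<Rightarrow> 'p) \<Rightarrow> (('o \<times> 'a) \<times> 'p) set topology" where
  "realization C T D F =
    quotient_topology
      (sum_topology (\<lambda>(a, x). D a) (Sigma (Obj C) (Lev T)))
      ((gluing C T D F \<union> (gluing C T D F)\<inverse>)\<^sup>*)"


section \<open>Polygon categories\<close>

definition mgon_category ::
  "nat \<Rightarrow> (nat, 'm) category \<Rightarrow> 'm \<Rightarrow> 'm \<Rightarrow> (nat \<Rightarrow> 'm) \<Rightarrow> (nat \<Rightarrow> 'm) \<Rightarrow> bool" where
  "mgon_category m C s t d v \<longleftrightarrow>
    m \<ge> 3 \<and> is_category C \<and> Obj C = {0, 1, 2} \<and>
    Arr C = Ident C ` {0, 1, 2} \<union> {s, t} \<union> d ` {1..m} \<union> v ` {1..m} \<and>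
    s \<in> hom C 0 1 \<and> t \<in> hom C 0 1 \<and> s \<noteq> t \<and>
    (\<forall>i\<in>{1..m}. d i \<in> hom C 1 2) \<and> inj_on d {1..m} \<and>
    (\<forall>i\<in>{1..m}. v i \<in> hom C 0 2) \<and> inj_on v {1..m} \<and>
    (\<forall>i\<in>{1..m}. {Comp C (d i) s, Comp C (d i) t} = {v i, v (i mod m + 1)})"

definition corner :: "nat \<Rightarrow> nat \<Rightarrow> complex" where
  "corner m i = cis (2 * pi * real i / real m)"

definition cell :: "nat \<Rightarrow> nat \<Rightarrow> complex topology" where
  "cell m a = top_of_set
    (if a = 0 then {0} else if a = 1 then closed_segment 0 1 else convex hull (corner m ` {1..m}))"

text \<open>
  \<open>v\<^sup>j\<close> goes to the inclusion of the \<open>j\<close>-th corner, and \<open>d\<^sup>i\<close> to the affine map whose endpoints are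
  prescribed by \<open>d\<^sup>i \<circ> s\<close> and \<open>d\<^sup>i \<circ> t\<close>, so it parametrizes the edge from corner \<open>i\<close> to
  corner \<open>i + 1\<close> in one direction or the other. The last branch concerns only identities.
\<close>

definition cell_map :: "nat \<Rightarrow> (nat, 'm) category \<Rightarrow> 'm \<Rightarrow> 'm \<Rightarrow> (nat \<Rightarrow> 'm) \<Rightarrow> (nat \<Rightarrow> 'm) \<Rightarrow>
    'm \<Rightarrow> complex \<Rightarrow> complex" where
  "cell_map m C s t d v f =
    (let vertex = (\<lambda>g. corner m (inv_into {1..m} v g)) in
     if f = s then (\<lambda>_. 0)
     else if f = t then (\<lambda>_. 1)
     else if f \<in> v ` {1..m} then (\<lambda>_. vertex f)
     else if f \<in> d ` {1..m} then (\<lambda>p. linepath (vertex (Comp C f s)) (vertex (Comp C f t)) (Re p))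
     else id)"


section \<open>Directed tilings\<close>

definition tile_edges :: "nat \<Rightarrow> (nat \<Rightarrow> 'm) \<Rightarrow> (nat, 'm, 'a) presheaf \<Rightarrow> 'a \<Rightarrow> 'a set" where
  "tile_edges m d T x = {Act T (d i) x | i. i \<in> {1..m}}"

definition directed_tiling ::
  "nat \<Rightarrow> nat \<Rightarrow> (nat, 'm) category \<Rightarrow> 'm \<Rightarrow> 'm \<Rightarrow> (nat \<Rightarrow> 'm) \<Rightarrow> (nat \<Rightarrow> 'm) \<Rightarrow>
    'x topology \<Rightarrow> (nat, 'm, 'a) presheaf \<Rightarrow> bool" where
  "directed_tiling m n C s t d v X T \<longleftrightarrow>
    is_presheaf C T \<and>
    (\<forall>a\<in>Obj C. \<forall>x\<in>Lev T a. \<forall>b\<in>Obj C. inj_on (yoneda_map T x) (hom C b a)) \<and>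
    (\<forall>x\<in>Lev T 2. \<forall>y\<in>Lev T 2. x \<noteq> y \<longrightarrow> card (tile_edges m d T x \<inter> tile_edges m d T y) \<le> 1) \<and>
    (\<forall>w\<in>Lev T 0. finite {e \<in> Lev T 1. Act T s e = w \<or> Act T t e = w} \<and>
        card {e \<in> Lev T 1. Act T s e = w \<or> Act T t e = w} = n) \<and>
    realization C T (cell m) (cell_map m C s t d v) homeomorphic_space X"

definition reflective :: "nat \<Rightarrow> (nat \<Rightarrow> 'm) \<Rightarrow> (nat, 'm, 'a) presheaf \<Rightarrow> bool" where
  "reflective m d T \<longleftrightarrow>
    (\<forall>x\<in>Lev T 2. \<forall>y\<in>Lev T 2. x \<noteq> y \<longrightarrow>
      (\<forall>e \<in> tile_edges m d T x \<inter> tile_edges m d T y.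
        \<exists>i\<in>{1..m}. e = Act T (d i) x \<and> e = Act T (d i) y))"


section \<open>The spaces\<close>

text \<open>
  So that all three geometries share a type they are modelled inside \<open>real^3\<close>: the unit sphere, the
  plane \<open>x $ 3 = 0\<close>, and the Poincare disc in that plane with its hyperbolic metric. The
  distance is set to \<open>0\<close> off the disc because \<open>Metric_space\<close> wants a symmetric nonnegative
  function on the whole type.
\<close>

definition poincare_disc :: "(real ^ 3) set" where
  "poincare_disc = {x. x $ 3 = 0 \<and> norm x < 1}"

definition hyperbolic_dist :: "real ^ 3 \<Rightarrow> real ^ 3 \<Rightarrow> real" where
  "hyperbolic_dist x y =
    (if x \<in> poincare_disc \<and> y \<in> poincare_disc
     then arcosh (1 + 2 * (norm (x - y))\<^sup>2 / ((1 - (norm x)\<^sup>2) * (1 - (norm y)\<^sup>2)))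
     else 0)"

definition hyperbolic_plane :: "(real ^ 3) topology" where
  "hyperbolic_plane = Metric_space.mtopology poincare_disc hyperbolic_dist"

definition tiling_space :: "nat \<Rightarrow> nat \<Rightarrow> (real ^ 3) topology" where
  "tiling_space m n =
    (if (m, n) \<in> {(3, 3), (3, 4), (4, 3), (3, 5), (5, 3)} then top_of_set (sphere 0 1)
     else if (m, n) \<in> {(3, 6), (4, 4), (6, 3)} then top_of_set {x. x $ 3 = 0}
     else hyperbolic_plane)"

lemma arcosh_triangle_lorentz:
  fixes x y z :: "'a::real_inner" and x0 y0 z0 :: real
  assumes x: "x0 \<ge> 1" "x0\<^sup>2 = 1 + x \<bullet> x" and y: "y0 \<ge> 1" "y0\<^sup>2 = 1 + y \<bullet> y"
    and z: "z0 \<ge> 1" "z0\<^sup>2 = 1 + z \<bullet> z"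
    and A: "A = x0 * y0 - x \<bullet> y" "A \<ge> 1" and B: "B = y0 * z0 - y \<bullet> z" "B \<ge> 1"
    and G: "G = x0 * z0 - x \<bullet> z" "G \<ge> 1"
  shows "arcosh G \<le> arcosh A + arcosh B"
proof -
  \<comment> \<open>spatial parts after the Lorentz boost taking \<open>(y0, y)\<close> to \<open>(1, 0)\<close>\<close>
  define a where "a = (x0 - A * y0) / (1 + y0)"
  define b where "b = (z0 - B * y0) / (1 + y0)"
  define p where "p = x - A *\<^sub>R y - a *\<^sub>R y"
  define q where "q = z - B *\<^sub>R y - b *\<^sub>R y"
  have a': "a * (1 + y0) = x0 - A * y0" and b': "b * (1 + y0) = z0 - B * y0"
    using y(1) by (simp_all add: a_def b_def)
  have xx: "x \<bullet> x = x0\<^sup>2 - 1" and yy: "y \<bullet> y = y0\<^sup>2 - 1" and zz: "z \<bullet> z = z0\<^sup>2 - 1"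
    and xy: "x \<bullet> y = x0 * y0 - A" and yz: "y \<bullet> z = y0 * z0 - B" and xz: "x \<bullet> z = x0 * z0 - G"
    using assms by auto
  have x0: "x0 = A * y0 + a * (1 + y0)" and z0: "z0 = B * y0 + b * (1 + y0)"
    using a' b' by simp_all
  have pp: "p \<bullet> p = A\<^sup>2 - 1"
    unfolding p_def
    by (simp add: inner_diff_left inner_diff_right inner_commute[of y x] xx xy yy)
       (simp add: x0 power2_eq_square algebra_simps)
  have qq: "q \<bullet> q = B\<^sup>2 - 1"
    unfolding q_def
    by (simp add: inner_diff_left inner_diff_right inner_commute[of z y] zz yz yy)
       (simp add: z0 power2_eq_square algebra_simps)
  have pq: "p \<bullet> q = A * B - G"
    unfolding p_def q_def
    by (simp add: inner_diff_left inner_diff_right xy yz xz yy)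
       (simp add: x0 z0 power2_eq_square algebra_simps)
  have "\<bar>p \<bullet> q\<bar> \<le> norm p * norm q"
    by (rule Cauchy_Schwarz_ineq2)
  also have "norm p * norm q = sqrt (A\<^sup>2 - 1) * sqrt (B\<^sup>2 - 1)"
    by (simp add: norm_eq_sqrt_inner pp qq)
  finally have "G \<le> A * B + sqrt (A\<^sup>2 - 1) * sqrt (B\<^sup>2 - 1)"
    using pq by linarith
  also have "\<dots> = cosh (arcosh A + arcosh B)"
    using A(2) B(2) by (simp add: cosh_add sinh_arcosh_real)
  finally have "cosh (arcosh G) \<le> cosh (arcosh A + arcosh B)"
    using G(2) by simp
  then show ?thesis
    using A(2) B(2) G(2) by (subst (asm) cosh_real_nonneg_le_iff) auto
qed

lemma Metric_space_hyperbolic: "Metric_space poincare_disc hyperbolic_dist"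
proof
  define c where "c x y = 1 + 2 * (norm (x - y))\<^sup>2 / ((1 - (norm x)\<^sup>2) * (1 - (norm y)\<^sup>2))"
    for x y :: "real ^ 3"
  have lt: "(norm x)\<^sup>2 < 1" if "x \<in> poincare_disc" for x
    using that by (simp add: poincare_disc_def abs_square_less_1)
  have c1: "c x y \<ge> 1" if "x \<in> poincare_disc" "y \<in> poincare_disc" for x y
    using lt[OF that(1)] lt[OF that(2)] by (simp add: c_def)
  have dist: "hyperbolic_dist x y = arcosh (c x y)"
    if "x \<in> poincare_disc" "y \<in> poincare_disc" for x y
    using that by (simp add: hyperbolic_dist_def c_def)
  show "0 \<le> hyperbolic_dist x y" for x y
    using c1[of x y] by (auto simp: hyperbolic_dist_def c_def)
  show "hyperbolic_dist x y = hyperbolic_dist y x" for x y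
    by (simp add: hyperbolic_dist_def norm_minus_commute mult.commute)
  show "hyperbolic_dist x y = 0 \<longleftrightarrow> x = y" if "x \<in> poincare_disc" "y \<in> poincare_disc" for x y
    using lt[OF that(1)] lt[OF that(2)] c1[OF that] by (simp add: dist[OF that]) (auto simp: c_def)
  define h where "h x = (1 + (norm x)\<^sup>2) / (1 - (norm x)\<^sup>2)" for x :: "real ^ 3"
  define l where "l x = (2 / (1 - (norm x)\<^sup>2)) *\<^sub>R x" for x :: "real ^ 3"
  have h: "h x \<ge> 1" "(h x)\<^sup>2 = 1 + l x \<bullet> l x" if "x \<in> poincare_disc" for x
  proof -
    show "h x \<ge> 1"
      using lt[OF that] by (simp add: h_def)
    have "((1 + r) / (1 - r))\<^sup>2 = 1 + 2 / (1 - r) * (2 / (1 - r) * r)" if "r < 1" for r :: real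
    proof -
      have "((1 + r) / (1 - r))\<^sup>2 = ((1 - r)\<^sup>2 + 4 * r) / (1 - r)\<^sup>2"
        by (simp add: power_divide) (simp add: power2_eq_square algebra_simps)
      also have "\<dots> = 1 + 4 * r / (1 - r)\<^sup>2"
        using that by (subst add_divide_distrib) simp
      finally show ?thesis
        by (simp add: power2_eq_square)
    qed
    from this[OF lt[OF that]] show "(h x)\<^sup>2 = 1 + l x \<bullet> l x"
      by (simp add: h_def l_def power2_norm_eq_inner)
  qed
  have c: "c x y = h x * h y - l x \<bullet> l y" if "x \<in> poincare_disc" "y \<in> poincare_disc" for x y
  proof -
    have n: "(norm (x - y))\<^sup>2 = (norm x)\<^sup>2 + (norm y)\<^sup>2 - 2 * (x \<bullet> y)"
      by (simp add: power2_norm_eq_inner inner_diff_left inner_diff_right inner_commute)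
    let ?P = "(1 - (norm x)\<^sup>2) * (1 - (norm y)\<^sup>2)"
    have "c x y = (?P + 2 * (norm (x - y))\<^sup>2) / ?P"
      using lt[OF that(1)] lt[OF that(2)] unfolding c_def by (subst add_divide_distrib) simp
    also have "?P + 2 * (norm (x - y))\<^sup>2 = (1 + (norm x)\<^sup>2) * (1 + (norm y)\<^sup>2) - 4 * (x \<bullet> y)"
      unfolding n by (simp add: algebra_simps)
    finally show ?thesis
      by (simp add: h_def l_def diff_divide_distrib)
  qed
  show "hyperbolic_dist x z \<le> hyperbolic_dist x y + hyperbolic_dist y z"
    if "x \<in> poincare_disc" "y \<in> poincare_disc" "z \<in> poincare_disc" for x y z
    unfolding dist[OF that(1,2)] dist[OF that(1,3)] dist[OF that(2,3)]
    by (rule arcosh_triangle_lorentz[OF h[OF that(1)] h[OF that(2)] h[OF that(3)]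
          c[OF that(1,2)] c1[OF that(1,2)] c[OF that(2,3)] c1[OF that(2,3)]
          c[OF that(1,3)] c1[OF that(1,3)]])
qed

end

theory Submission
  imports Defs
begin

text \<open>
  The symbol \<open>{3,4}\<close> is realized by the octahedron. In all other cases the space is homeomorphic to
  the plane, which is cut into horizontal strips. Every tile of the strip between the lines \<open>l\<close> and
  \<open>l + 1\<close> touches both lines and lies between two consecutive rungs, the \<open>t\<close>-th rung joining the points
  \<open>(lo l t, l)\<close> and \<open>(hi l t, l + 1)\<close>. Tiles are \<open>m\<close>-gons iff \<open>lo l t + hi l t = (m - 2) t\<close>, up to
  normalization, and vertices have degree \<open>n\<close> iff \<open>n - 2\<close> rungs end at each of them; the strips can
  therefore be chosen one after the other, starting from line \<open>0\<close>.

  As \<open>n\<close> is even, the vertices can be coloured by the integers modulo \<open>m\<close> in such a way that the colours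
  run cyclically around each tile, clockwise and counterclockwise on adjacent tiles. Labelling the
  edge between the colours \<open>i\<close> and \<open>i + 1\<close> by \<open>i\<close> makes adjacent tiles mirror images of each other.

  The realization is computed by parametrizing every tile by the \<open>m\<close>-gon, seen as the cone over its
  boundary: the parametrizations form a quotient map from the sum of all cells onto the space, and
  its fibres are the classes of the gluing relation.
\<close>

section \<open>Coordinates on the regular polygon\<close>

text \<open>Only the homeomorphism type of the realization matters, so one planar construction
  serves the Euclidean and the hyperbolic symbols. The obstacle is to continue the strips
  indefinitely. Let \<open>r\<close> be 1 if \<open>m >= 4\<close> and 2 if \<open>m = 3\<close>. If
  at least \<open>r\<close> rungs leave every vertex of a line upwards, then \<open>r\<close>
  consecutive tiles above it have together at most one bottom edge, hence at least one top edge, and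
  so at most \<open>r\<close> rungs arrive at a vertex of the next line. That vertex has at least
  \<open>n - 2 - r\<close> rungs left, and this is at least \<open>r\<close> for every admissible
  symbol except {3,4}, so the condition propagates. The colouring meets no obstruction: once round a
  tile the colour changes by \<open>m\<close>, and the even degree lets the two orientations
  alternate round a vertex. Distinct colours at the corners of a tile also make the maps from
  representables injective. The direction of an edge is dictated by the category, but depends on the
  label alone.\<close>

definition nxt :: "nat \<Rightarrow> nat \<Rightarrow> nat" where
  "nxt m k = k mod m + 1"

text \<open>
  A point of the \<open>m\<close>-gon is given by weights at two consecutive corners; the remaining weight is
  placed at the centre.
\<close>

definition fan :: "nat \<Rightarrow> (nat \<Rightarrow> real) set" where
  "fan m = {w. (\<forall>k. 0 \<le> w k) \<and> sum w {1..m} \<le> 1 \<and>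
     (\<exists>i\<in>{1..m}. \<forall>k. k \<notin> {i, nxt m i} \<longrightarrow> w k = 0)}"

definition spread :: "nat \<Rightarrow> (nat \<Rightarrow> real) \<Rightarrow> complex" where
  "spread m w = (\<Sum>k\<in>{1..m}. w k *\<^sub>R corner m k)"

definition polygon :: "nat \<Rightarrow> complex set" where
  "polygon m = convex hull (corner m ` {1..m})"

text \<open>The last claim is the one that fails for a 2-gon: two edges of a polygon never have the
  same two corners.\<close>

lemma nxt_props:
  assumes "m \<ge> 3" "i \<in> {1..m}"
  shows "nxt m i \<in> {1..m}" "nxt m i \<noteq> i" "nxt m (nxt m i) \<noteq> i"
proof -
  consider "i < m" "i + 1 < m" | "i + 1 = m" | "i = m"
    using assms by fastforce
  then show "nxt m i \<in> {1..m}" "nxt m i \<noteq> i" "nxt m (nxt m i) \<noteq> i"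
    using assms by (cases; force simp: nxt_def)+
qed

lemma nxt_less: "i < m \<Longrightarrow> nxt m i = Suc i"
  by (simp add: nxt_def)

lemma nxt_same: "nxt m m = 1"
  by (simp add: nxt_def)

lemma nxt_inj:
  assumes "i \<in> {1..m}" "j \<in> {1..m}" "nxt m i = nxt m j"
  shows "i = j"
  using assms by (cases "i < m"; cases "j < m") (auto simp: nxt_less nxt_same not_less)

lemma nxt_surj:
  assumes "j \<in> {1..m}"
  obtains i where "i \<in> {1..m}" "nxt m i = j"
proof (cases "j = 1")
  case True
  then show ?thesis using assms that[of m] by (simp add: nxt_same)
next
  case False
  then have "nxt m (j - 1) = j" using assms by (subst nxt_less) auto
  moreover have "j - 1 \<in> {1..m}" using assms False by auto
  ultimately show ?thesis using that by blast
qed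

lemma sum_nxt:
  fixes f :: "nat \<Rightarrow> 'a::real_vector"
  assumes "m \<ge> 3" "i \<in> {1..m}" "\<forall>k. k \<notin> {i, nxt m i} \<longrightarrow> w k = 0"
  shows "(\<Sum>k\<in>{1..m}. w k *\<^sub>R f k) = w i *\<^sub>R f i + w (nxt m i) *\<^sub>R f (nxt m i)"
proof -
  have "(\<Sum>k\<in>{1..m}. w k *\<^sub>R f k) = (\<Sum>k\<in>{i, nxt m i}. w k *\<^sub>R f k)"
    using assms nxt_props(1)[OF assms(1,2)] by (intro sum.mono_neutral_right) auto
  also have "\<dots> = w i *\<^sub>R f i + w (nxt m i) *\<^sub>R f (nxt m i)"
    using nxt_props(2)[OF assms(1,2)] by simp
  finally show ?thesis .
qed

lemma sum_nxt_weight: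
  fixes w :: "nat \<Rightarrow> real"
  assumes "m \<ge> 3" "i \<in> {1..m}" "\<forall>k. k \<notin> {i, nxt m i} \<longrightarrow> w k = 0"
  shows "sum w {1..m} = w i + w (nxt m i)"
  using sum_nxt[OF assms, of "\<lambda>_. 1::real"] by simp

lemma corner_mod: "m > 0 \<Longrightarrow> corner m (i mod m) = corner m i"
proof -
  assume "m > 0"
  have "2 * pi * real i / real m = 2 * pi * real (i mod m) / real m + 2 * pi * real (i div m)"
  proof -
    have "real i = real (i mod m) + real m * real (i div m)"
      by (metis mod_div_mult_eq mult.commute of_nat_add of_nat_mult)
    then show ?thesis using \<open>m > 0\<close> by (simp add: field_simps)
  qed
  moreover have "cis (a + 2 * pi * real j) = cis a" for a j
    using cis_mult[of a "2 * pi * real j"] cis_multiple_2pi[of "real j"] by simp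
  ultimately show ?thesis
    by (simp add: corner_def)
qed

lemma corner_nxt: "m > 0 \<Longrightarrow> corner m (nxt m i) = corner m i * cis (2 * pi / m)"
proof -
  assume m: "m > 0"
  have "corner m (nxt m i) = corner m (i mod m) * cis (2 * pi / m)"
    using m by (simp add: corner_def nxt_def cis_mult field_simps)
  then show ?thesis using m by (simp add: corner_mod)
qed

lemma fan_index:
  assumes "w \<in> fan m"
  obtains i where "i \<in> {1..m}" "\<forall>k. k \<notin> {i, nxt m i} \<longrightarrow> w k = 0" "\<And>k. w k \<ge> 0" "sum w {1..m} \<le> 1"
  using assms by (auto simp: fan_def)

text \<open>Points on the ray through a corner belong to two sectors. Demanding a positive weight at
  the first corner selects one of them: if \<open>w i\<close> vanishes, the next sector is taken.
  The resulting half-open sectors are the ones separated in \<open>cones_disjoint\<close>.\<close>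

lemma fan_index_pos:
  assumes "m \<ge> 3" "w \<in> fan m" "w k > 0"
  obtains i where "i \<in> {1..m}" "\<forall>k. k \<notin> {i, nxt m i} \<longrightarrow> w k = 0" "w i > 0"
proof -
  from fan_index[OF assms(2)] obtain i where i: "i \<in> {1..m}" "\<forall>k. k \<notin> {i, nxt m i} \<longrightarrow> w k = 0"
    "\<And>k. w k \<ge> 0" by metis
  show ?thesis
  proof (cases "w i > 0")
    case False
    then have "w i = 0" using i(3)[of i] by simp
    then have z: "w j = 0" if "j \<noteq> nxt m i" for j using i(2) that by (cases "j = i") auto
    then have "w (nxt m i) > 0" "\<forall>k. k \<notin> {nxt m i, nxt m (nxt m i)} \<longrightarrow> w k = 0"
      using assms(3) by (metis order_less_irrefl, simp)
    then show ?thesis using that[of "nxt m i"] nxt_props(1)[OF assms(1) i(1)] by blast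
  qed (use that[of i] i in blast)
qed

section \<open>Sectors of the polygon and uniqueness of the weights\<close>

lemma angle_bounds:
  assumes "m \<ge> (3::nat)"
  shows "0 < 2 * pi / m" "2 * pi / m < pi" "sin (2 * pi / m) > 0"
proof -
  show 1: "0 < 2 * pi / m" and 2: "2 * pi / m < pi"
    using assms by (auto simp: field_simps)
  show "sin (2 * pi / m) > 0" using 1 2 by (rule sin_gt_zero)
qed

text \<open>After a further rotation by \<open>- 2 * pi / m\<close> the right-hand side has
  imaginary part \<open>- a' * sin (2 * pi / m)\<close>, which is negative. The left-hand side
  becomes a nonnegative combination of directions with angles \<open>d - 1\<close> and
  \<open>d\<close> times \<open>2 * pi / m\<close>, which lie in the closed upper half-plane because
  \<open>2 * d <= m\<close>.\<close>

lemma cones_disjoint_aux: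
  fixes d m :: nat
  assumes "m \<ge> 3" "0 < d" "2 * d \<le> m" "0 < a" "0 \<le> b" "0 < a'" "0 \<le> b'"
  shows "cis (2 * pi * d / m) * (of_real a + of_real b * cis (2 * pi / m))
    \<noteq> of_real a' + of_real b' * cis (2 * pi / m)"
proof
  let ?t = "2 * pi / m"
  assume eq: "cis (2 * pi * d / m) * (of_real a + of_real b * cis ?t) = of_real a' + of_real b' * cis ?t"
  have "cis (- ?t) * (cis (2 * pi * d / m) * (of_real a + of_real b * cis ?t)) =
     of_real a * cis (?t * (real d - 1)) + of_real b * cis (?t * d)"
  proof -
    have "cis (- ?t) * cis (2 * pi * d / m) = cis (?t * (real d - 1))"
      "cis (- ?t) * cis (2 * pi * d / m) * cis ?t = cis (?t * d)"
      by (simp_all add: cis_mult algebra_simps diff_divide_distrib)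
    then show ?thesis by (simp add: algebra_simps)
  qed
  moreover have "cis (- ?t) * (of_real a' + of_real b' * cis ?t) = of_real a' * cis (- ?t) + of_real b'"
  proof -
    have "cis (- ?t) * cis ?t = 1" by (simp add: cis_mult)
    then show ?thesis by (simp add: algebra_simps)
  qed
  ultimately have "a * sin (?t * (real d - 1)) + b * sin (?t * d) = - a' * sin ?t"
    using eq by (simp add: complex_eq_iff)
  moreover have "?t * d \<le> pi"
  proof -
    have "real (2 * d) \<le> real m" using assms(3) by (simp only: of_nat_le_iff)
    then show ?thesis using assms(1) by (simp add: field_simps)
  qed
  moreover have "0 \<le> ?t * (real d - 1)" "?t * (real d - 1) \<le> ?t * d"
    using assms(1,2) by (auto intro!: mult_left_mono divide_right_mono)
  ultimately have eq': "a * sin (?t * (real d - 1)) + b * sin (?t * d) = - a' * sin ?t"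
    and "0 \<le> sin (?t * (real d - 1))" "0 \<le> sin (?t * d)"
    by (auto intro!: sin_ge_zero)
  then have "0 \<le> - a' * sin ?t"
    unfolding eq'[symmetric] using assms(4,5) by (intro add_nonneg_nonneg mult_nonneg_nonneg) simp_all
  then show False
    using mult_pos_pos[OF assms(6) angle_bounds(3)[OF assms(1)]] by simp
qed

text \<open>Going from one sector to the other in the shorter direction takes at most half a turn,
  so one of the step numbers \<open>i - j\<close> and \<open>m - (i - j)\<close> satisfies the bound
  of \<open>cones_disjoint_aux\<close>.\<close>

lemma cones_disjoint:
  assumes "m \<ge> 3" "i \<in> {1..m}" "j \<in> {1..m}" "0 < a" "0 \<le> b" "0 < a'" "0 \<le> b'"
    and "corner m i * (of_real a + of_real b * cis (2 * pi / m)) =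
      corner m j * (of_real a' + of_real b' * cis (2 * pi / m))"
  shows "i = j"
proof -
  have False if "i \<in> {1..m}" "j \<in> {1..m}" "0 < a" "0 \<le> b" "0 < a'" "0 \<le> b'" "j < i"
    and eq: "corner m i * (of_real a + of_real b * cis (2 * pi / m)) =
      corner m j * (of_real a' + of_real b' * cis (2 * pi / m))" for i j a b a' b'
  proof (cases "2 * (i - j) \<le> m")
    case True
    have "2 * pi * i / m = 2 * pi * j / m + 2 * pi * (i - j) / m"
      using that(7) by (simp add: right_diff_distrib diff_divide_distrib)
    then have "corner m i = corner m j * cis (2 * pi * (i - j) / m)"
      by (simp add: corner_def cis_mult)
    then have "corner m j * (cis (2 * pi * (i - j) / m) * (of_real a + of_real b * cis (2 * pi / m))) =
       corner m j * (of_real a' + of_real b' * cis (2 * pi / m))"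
      using eq by (simp add: mult.assoc)
    then show False
      using cones_disjoint_aux[OF assms(1) _ True, of a b a' b'] that by (simp add: corner_def)
  next
    case False
    have "corner m j * cis (2 * pi) = corner m i * cis (2 * pi * (m - (i - j)) / m)"
      using that assms(1) by (simp add: corner_def cis_mult of_nat_diff field_simps)
    then have j: "corner m j = corner m i * cis (2 * pi * (m - (i - j)) / m)"
      by simp
    have "corner m i * (cis (2 * pi * (m - (i - j)) / m) * (of_real a' + of_real b' * cis (2 * pi / m))) =
       corner m i * (of_real a + of_real b * cis (2 * pi / m))"
      using eq unfolding j by (simp only: mult.assoc)
    moreover have "0 < m - (i - j)" "2 * (m - (i - j)) \<le> m"
      using False that by auto
    ultimately show False
      using cones_disjoint_aux[OF assms(1), of "m - (i - j)" a' b' a b] that by (simp add: corner_def)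
  qed
  then show ?thesis
    using assms by (metis linorder_neqE_nat)
qed

lemma spread_index:
  assumes "m \<ge> 3" "i \<in> {1..m}" "\<forall>k. k \<notin> {i, nxt m i} \<longrightarrow> w k = 0"
  shows "spread m w = corner m i * (of_real (w i) + of_real (w (nxt m i)) * cis (2 * pi / m))"
  using sum_nxt[OF assms, of "corner m"] assms(1)
  by (simp add: spread_def corner_nxt scaleR_conv_of_real algebra_simps)

text \<open>As \<open>sin (2 * pi / m)\<close> is nonzero, \<open>1\<close> and
  \<open>cis (2 * pi / m)\<close> form a real basis. The solution is written out because it gives
  both the uniqueness of the weights and, being real-linear in \<open>p\<close>, their
  continuity.\<close>

lemma cone_coeffs:
  assumes "m \<ge> 3" "p = corner m i * (of_real a + of_real b * cis (2 * pi / m))"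
  shows "b = Im (p * cnj (corner m i)) / sin (2 * pi / m)"
    and "a = Re (p * cnj (corner m i)) - b * cos (2 * pi / m)"
proof -
  have "p * cnj (corner m i) = of_real a + of_real b * cis (2 * pi / m)"
  proof -
    have "corner m i * cnj (corner m i) = 1"
      by (simp add: corner_def cis_cnj cis_mult)
    then show ?thesis unfolding assms(2) by (metis mult.assoc mult.commute mult_1)
  qed
  then show "b = Im (p * cnj (corner m i)) / sin (2 * pi / m)"
    and "a = Re (p * cnj (corner m i)) - b * cos (2 * pi / m)"
    using angle_bounds(3)[OF assms(1)] by simp_all
qed

lemma spread_inj:
  assumes "m \<ge> 3"
  shows "inj_on (spread m) (fan m)"
proof (rule inj_onI)
  fix w w' assume w: "w \<in> fan m" and w': "w' \<in> fan m" and eq: "spread m w = spread m w'"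
  have zero: "spread m w = 0 \<longleftrightarrow> (\<forall>k. w k = 0)" if "w \<in> fan m" for w
  proof -
    from fan_index[OF that] obtain i where i: "i \<in> {1..m}" "\<forall>k. k \<notin> {i, nxt m i} \<longrightarrow> w k = 0"
      by metis
    show ?thesis
      using spread_index[OF assms i] cone_coeffs[OF assms spread_index[OF assms i]] i(2)
      by (metis (no_types, opaque_lifting) add.right_neutral complex_cnj_zero diff_zero divide_eq_0_iff insertE
          mult_zero_left mult_zero_right of_real_0 singletonD zero_complex.simps)
  qed
  show "w = w'"
  proof (cases "spread m w = 0")
    case True
    then show ?thesis using zero[OF w] zero[OF w'] eq by auto
  next
    case False
    have "\<exists>k. w k > 0" if "w \<in> fan m" "spread m w \<noteq> 0" for w
      using zero[OF that(1)] that by (metis (no_types, lifting) fan_index order_less_le)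
    then obtain k k' where "w k > 0" "w' k' > 0" using w w' eq False by metis
    from fan_index_pos[OF assms w this(1)] obtain i where
      i: "i \<in> {1..m}" "\<forall>k. k \<notin> {i, nxt m i} \<longrightarrow> w k = 0" "w i > 0" by metis
    from fan_index_pos[OF assms w' \<open>w' k' > 0\<close>] obtain j where
      j: "j \<in> {1..m}" "\<forall>k. k \<notin> {j, nxt m j} \<longrightarrow> w' k = 0" "w' j > 0" by metis
    note si = spread_index[OF assms i(1,2)] and sj = spread_index[OF assms j(1,2)]
    have "w (nxt m i) \<ge> 0" "w' (nxt m j) \<ge> 0"
      using w w' by (auto simp: fan_def)
    then have "i = j"
      using cones_disjoint[OF assms i(1) j(1) i(3) _ j(3)] eq si sj by metis
    then show ?thesis
      using cone_coeffs[OF assms si] cone_coeffs[OF assms sj] eq i(2) j(2)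
      by (intro ext) (metis insertE singletonD)
  qed
qed

section \<open>Existence of weights for every point of the polygon\<close>

lemma sum_corner:
  assumes "m \<ge> 3"
  shows "(\<Sum>k\<in>{1..m}. corner m k) = 0"
proof -
  let ?S = "\<Sum>k\<in>{1..m}. corner m k"
  \<comment> \<open>Rotation by one step permutes the corners and therefore fixes their sum.\<close>
  have "?S * cis (2 * pi / m) = (\<Sum>k\<in>{1..m}. corner m (nxt m k))"
    using assms by (simp add: sum_distrib_right corner_nxt)
  also have "\<dots> = ?S"
  proof (rule sum.reindex_bij_betw, unfold bij_betw_def, intro conjI inj_onI)
    show "nxt m ` {1..m} = {1..m}"
      using nxt_props(1)[OF assms] by (blast elim: nxt_surj)
  qed (use nxt_inj in blast)
  finally have "?S * (cis (2 * pi / m) - 1) = 0" by (simp add: algebra_simps)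
  moreover have "cis (2 * pi / m) \<noteq> 1"
    using angle_bounds(3)[OF assms] by (simp add: complex_eq_iff)
  ultimately show ?thesis by simp
qed

lemma zero_in_polygon:
  assumes "m \<ge> 3"
  shows "0 \<in> polygon m"
proof -
  have "(\<Sum>k\<in>{1..m}. (1 / real m) *\<^sub>R corner m k) \<in> convex hull (corner m ` {1..m})"
    using assms by (intro convex_sum convex_convex_hull) (auto intro: hull_inc)
  moreover have "(\<Sum>k\<in>{1..m}. (1 / real m) *\<^sub>R corner m k) = 0"
    using sum_corner[OF assms] by (simp flip: scaleR_sum_right)
  ultimately show ?thesis by (simp add: polygon_def)
qed

lemma corner_in_polygon: "i \<in> {1..m} \<Longrightarrow> corner m i \<in> polygon m"
  by (simp add: polygon_def hull_inc)

lemma convex_polygon: "convex (polygon m)"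
  by (simp add: polygon_def)

lemma compact_polygon: "compact (polygon m)"
  by (simp add: polygon_def finite_imp_compact_convex_hull)

lemma spread_in_polygon:
  assumes "m \<ge> 3" "w \<in> fan m"
  shows "spread m w \<in> polygon m"
proof -
  from fan_index[OF assms(2)] obtain i where i: "i \<in> {1..m}" "\<forall>k. k \<notin> {i, nxt m i} \<longrightarrow> w k = 0"
    "\<And>k. w k \<ge> 0" "sum w {1..m} \<le> 1" by metis
  note i' = nxt_props(1)[OF assms(1) i(1)]
  have "convex hull {0, corner m i, corner m (nxt m i)} \<subseteq> polygon m"
    using i(1) i' zero_in_polygon[OF assms(1)]
    by (intro hull_minimal) (simp_all only: insert_subset empty_subsetI corner_in_polygon convex_polygon simp_thms)
  moreover have "spread m w \<in> convex hull {0, corner m i, corner m (nxt m i)}"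
    unfolding convex_hull_3
    using i(3)[of i] i(3)[of "nxt m i"] i(4) sum_nxt[OF assms(1) i(1,2), of "corner m"]
      sum_nxt_weight[OF assms(1) i(1,2)]
    by (intro CollectI exI[of _ "1 - (w i + w (nxt m i))"] exI[of _ "w i"] exI[of _ "w (nxt m i)"])
      (simp add: spread_def)
  ultimately show ?thesis by blast
qed

text \<open>Seen from the outward normal of an edge, the corners lie at odd multiples of
  \<open>pi / m\<close>, and none is farther out than the two ends of the edge. By symmetry and
  periodicity the multiple may be taken between 1 and \<open>m\<close>, where the cosine decreases;
  oddness excludes 0 and \<open>2 * m\<close>.\<close>

lemma cos_odd_le:
  assumes "m > 0" "odd x" "\<bar>x\<bar> \<le> 2 * int m"
  shows "cos (x * (pi / m)) \<le> cos (pi / m)"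
proof -
  have 1: "cos (y * (pi / m)) \<le> cos (pi / m)" if "1 \<le> y" "y \<le> int m" for y :: int
  proof (rule cos_monotone_0_pi_le)
    show "pi / m \<le> y * (pi / m)"
      using that assms(1) by (simp add: field_simps)
    have "real_of_int y \<le> m" using that(2) by linarith
    then show "y * (pi / m) \<le> pi"
      using assms(1) by (simp add: field_simps)
  qed simp
  have 2: "cos (x * (pi / m)) = cos (\<bar>x\<bar> * (pi / m))"
    by (cases "x \<ge> 0") (simp_all add: abs_if)
  have 3: "cos (\<bar>x\<bar> * (pi / m)) = cos ((2 * int m - \<bar>x\<bar>) * (pi / m))"
  proof -
    have "(2 * int m - \<bar>x\<bar>) * (pi / m) = 2 * pi - \<bar>x\<bar> * (pi / m)"
      using assms(1) by (simp add: field_simps)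
    then show ?thesis by (simp only: cos_2pi_minus)
  qed
  have "odd \<bar>x\<bar>" using assms(2) by simp
  then have "\<bar>x\<bar> \<noteq> 0" "\<bar>x\<bar> \<noteq> 2 * int m" by (metis dvd_0_right, metis dvd_triv_left)
  then show ?thesis
    using 1[of "\<bar>x\<bar>"] 1[of "2 * int m - \<bar>x\<bar>"] 2 3 assms(3) by (cases "\<bar>x\<bar> \<le> int m") auto
qed

text \<open>The sector is read off from the argument and the two weights from the sine rule. That
  they sum to at most 1 comes from the half-plane bounded by the edge, which contains all
  corners.\<close>

lemma polygon_subset_spread:
  assumes "m \<ge> 3"
  shows "polygon m \<subseteq> spread m ` fan m"
proof
  fix p assume p: "p \<in> polygon m"
  let ?t = "2 * pi / m"
  note t = angle_bounds[OF assms]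
  define e where "e = nat \<lfloor>Arg2pi p / ?t\<rfloor>"
  define u where "u = Arg2pi p - e * ?t"
  have e: "real e \<le> Arg2pi p / ?t" "Arg2pi p / ?t < real e + 1"
    using Arg2pi_ge_0[of p] t(1) by (auto simp: e_def)
  have u: "0 \<le> u" "u < ?t"
    using e t(1) by (simp_all only: u_def pos_le_divide_eq pos_divide_less_eq) (simp_all add: algebra_simps add_divide_distrib)
  have "Arg2pi p / ?t < m"
    using Arg2pi_lt_2pi[of p] assms by (simp add: field_simps)
  then have em: "e < m" using e(1) by linarith
  \<comment> \<open>Corners are numbered from 1, so the direction of angle 0 is that of corner
    \<open>m\<close>.\<close>
  define i where "i = (if e = 0 then m else e)"
  have i: "i \<in> {1..m}" using em assms by (auto simp: i_def)
  have ci: "corner m i = cis (e * ?t)"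
  proof (cases "e = 0")
    case True
    then show ?thesis using assms by (simp add: i_def corner_def)
  next
    case False
    have "2 * pi * e / m = e * ?t" by simp
    then show ?thesis using False by (simp only: i_def corner_def if_False)
  qed
  define a where "a = norm p * sin (?t - u) / sin ?t"
  define b where "b = norm p * sin u / sin ?t"
  have ab: "a \<ge> 0" "b \<ge> 0"
    using u t sin_ge_zero[of u] sin_ge_zero[of "?t - u"] by (auto simp: a_def b_def)
  have "sin ?t * (a + b * cos ?t) = norm p * (sin (?t - u) + sin u * cos ?t)"
    using t(3) by (simp add: a_def b_def field_simps)
  also have "\<dots> = sin ?t * (norm p * cos u)" by (simp add: sin_diff algebra_simps)
  finally have "a + b * cos ?t = norm p * cos u" using t(3) by simp
  moreover have "b * sin ?t = norm p * sin u" using t(3) by (simp add: b_def)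
  ultimately have "of_real a + of_real b * cis ?t = of_real (norm p) * cis u"
    by (simp add: complex_eq_iff)
  then have "corner m i * (of_real a + of_real b * cis ?t) = of_real (norm p) * cis (e * ?t + u)"
    by (simp add: ci flip: cis_mult)
  also have "\<dots> = p"
    using Arg2pi_eq[of p] by (simp add: u_def cis_conv_exp)
  finally have pab: "p = corner m i * (of_real a + of_real b * cis ?t)" by simp
  define w where "w k = (if k = i then a else if k = nxt m i then b else 0)" for k
  have w: "\<forall>k. k \<notin> {i, nxt m i} \<longrightarrow> w k = 0" "w i = a" "w (nxt m i) = b"
    using nxt_props(2)[OF assms i] by (auto simp: w_def)
  have "a + b \<le> 1"
  proof -
    \<comment> \<open>Multiplication by \<open>c\<close> turns the outward normal of the edge into
      the positive real axis; the edge then lies at real part \<open>cos (pi / m)\<close>.\<close>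
    define c where "c = cis (- (e * ?t + pi / m))"
    have "Re (q * c) \<le> cos (pi / m)" if "q \<in> polygon m" for q
    proof -
      have "convex {q. Re (q * c) \<le> cos (pi / m)}"
      proof -
        have "{q. Re (q * c) \<le> cos (pi / m)} = {q. cnj c \<bullet> q \<le> cos (pi / m)}"
          by (simp add: inner_complex_def mult.commute)
        then show ?thesis by (simp only: convex_halfspace_le)
      qed
      moreover have "corner m j \<in> {q. Re (q * c) \<le> cos (pi / m)}" if j: "j \<in> {1..m}" for j
      proof -
        have "2 * pi * j / m + - (e * ?t + pi / m) = (2 * (int j - int e) - 1) * (pi / m)"
          using assms by (simp add: field_simps)
        then have "Re (corner m j * c) = cos ((2 * (int j - int e) - 1) * (pi / m))"
          unfolding corner_def c_def cis_mult by simp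
        also have "\<dots> \<le> cos (pi / m)"
          using cos_odd_le[of m "2 * (int j - int e) - 1"] j em assms by auto
        finally show ?thesis by simp
      qed
      ultimately have "polygon m \<subseteq> {q. Re (q * c) \<le> cos (pi / m)}"
        unfolding polygon_def by (intro hull_minimal) auto
      then show ?thesis using that by blast
    qed
    from this[OF p] have "Re (p * c) \<le> cos (pi / m)" .
    moreover have "p * c = of_real a * cis (- (pi / m)) + of_real b * cis (pi / m)"
    proof -
      have "p * c = of_real a * (cis (e * ?t) * c) + of_real b * (cis (e * ?t) * cis ?t * c)"
        unfolding pab ci by (simp add: algebra_simps)
      also have "cis (e * ?t) * c = cis (- (pi / m))" by (simp add: c_def cis_mult)
      also have "cis (e * ?t) * cis ?t * c = cis (pi / m)"
      proof -
        have "e * ?t + ?t + - (e * ?t + pi / m) = pi / m" by simp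
        then show ?thesis by (simp only: c_def cis_mult)
      qed
      finally show ?thesis .
    qed
    moreover have "Re (of_real a * cis (- (pi / m)) + of_real b * cis (pi / m)) = (a + b) * cos (pi / m)"
      by (simp add: algebra_simps)
    ultimately have "(a + b) * cos (pi / m) \<le> 1 * cos (pi / m)" by (simp only: mult_1)
    moreover have "cos (pi / m) > 0"
      using assms by (intro cos_gt_zero) (auto simp: field_simps)
    ultimately show ?thesis by (simp add: mult_le_cancel_right)
  qed
  moreover have "sum w {1..m} = a + b"
    using sum_nxt_weight[OF assms i w(1)] w by simp
  ultimately have "w \<in> fan m"
    using ab w(1) i unfolding fan_def by (auto simp: w_def)
  moreover have "spread m w = p"
    using spread_index[OF assms i w(1)] w pab by simp
  ultimately show "p \<in> spread m ` fan m" by blast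
qed

lemma spread_image: "m \<ge> 3 \<Longrightarrow> spread m ` fan m = polygon m"
  using polygon_subset_spread spread_in_polygon by blast

section \<open>The inverse of \<open>spread\<close> and its continuity\<close>

definition weights :: "nat \<Rightarrow> complex \<Rightarrow> nat \<Rightarrow> real" where
  "weights m = inv_into (fan m) (spread m)"

lemma weights_in_fan: "m \<ge> 3 \<Longrightarrow> p \<in> polygon m \<Longrightarrow> weights m p \<in> fan m"
  by (simp add: weights_def inv_into_into spread_image)

lemma spread_weights: "m \<ge> 3 \<Longrightarrow> p \<in> polygon m \<Longrightarrow> spread m (weights m p) = p"
  by (simp add: weights_def f_inv_into_f spread_image)

lemma weights_spread: "m \<ge> 3 \<Longrightarrow> w \<in> fan m \<Longrightarrow> weights m (spread m w) = w"
  by (simp add: weights_def spread_inj)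

text \<open>The polygon is a finite union of closed triangles with apex 0, and on each of them the
  weights are given by the linear formulas of \<open>cone_coeffs\<close>.\<close>

lemma continuous_weights:
  assumes "m \<ge> 3"
  shows "continuous_on (polygon m) (\<lambda>p. weights m p k)"
proof -
  define S where "S i = convex hull {0, corner m i, corner m (nxt m i)}" for i
  have S: "\<exists>w\<in>fan m. spread m w = p \<and> (\<forall>k. k \<notin> {i, nxt m i} \<longrightarrow> w k = 0)"
    if "i \<in> {1..m}" "p \<in> S i" for i p
  proof -
    from that(2) obtain a b where ab: "a \<ge> 0" "b \<ge> 0" "a + b \<le> 1"
      "p = a *\<^sub>R corner m i + b *\<^sub>R corner m (nxt m i)"
      unfolding S_def convex_hull_3 by force
    define w where "w k = (if k = i then a else if k = nxt m i then b else 0)" for k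
    have w: "\<forall>k. k \<notin> {i, nxt m i} \<longrightarrow> w k = 0" "w i = a" "w (nxt m i) = b" "\<And>k. w k \<ge> 0"
      using nxt_props(2)[OF assms that(1)] ab by (auto simp: w_def)
    have "w \<in> fan m"
      using w that(1) ab sum_nxt_weight[OF assms that(1) w(1)] unfolding fan_def by auto
    moreover have "spread m w = p"
      using sum_nxt[OF assms that(1) w(1), of "corner m"] ab w by (simp add: spread_def)
    ultimately show ?thesis using w(1) by blast
  qed
  have "continuous_on (S i) (\<lambda>p. weights m p k)" if i: "i \<in> {1..m}" for i
  proof -
    let ?b = "\<lambda>p. Im (p * cnj (corner m i)) / sin (2 * pi / m)"
    let ?a = "\<lambda>p. Re (p * cnj (corner m i)) - ?b p * cos (2 * pi / m)"
    have "weights m p k = (if k = i then ?a p else if k = nxt m i then ?b p else 0)" if p: "p \<in> S i" for p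
    proof -
      obtain w where w: "w \<in> fan m" "spread m w = p" "\<forall>k. k \<notin> {i, nxt m i} \<longrightarrow> w k = 0"
        using S[OF i p] by blast
      have "weights m p = w" using weights_spread[OF assms w(1)] w(2) by simp
      then show ?thesis
        using w(3) cone_coeffs[OF assms spread_index[OF assms i w(3)]] nxt_props(2)[OF assms i]
        unfolding w(2) by auto
    qed
    moreover have "continuous_on (S i) (\<lambda>p. if k = i then ?a p else if k = nxt m i then ?b p else 0)"
      using angle_bounds(3)[OF assms]
      by (cases "k = i"; cases "k = nxt m i") (auto intro!: continuous_intros)
    ultimately show ?thesis by (simp cong: continuous_on_cong)
  qed
  then have "continuous_on (\<Union>i\<in>{1..m}. S i) (\<lambda>p. weights m p k)"
    by (intro continuous_on_closed_Union) (auto simp: S_def finite_imp_compact_convex_hull compact_imp_closed)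
  moreover have "polygon m \<subseteq> (\<Union>i\<in>{1..m}. S i)"
  proof
    fix p assume "p \<in> polygon m"
    then obtain w where w: "w \<in> fan m" "spread m w = p" by (metis spread_image[OF assms] imageE)
    from fan_index[OF w(1)] obtain i where i: "i \<in> {1..m}" "\<forall>k. k \<notin> {i, nxt m i} \<longrightarrow> w k = 0"
      "\<And>k. w k \<ge> 0" "sum w {1..m} \<le> 1" by metis
    have "p \<in> S i"
      unfolding S_def convex_hull_3 w(2)[symmetric]
      using i(3)[of i] i(3)[of "nxt m i"] i(4) sum_nxt[OF assms i(1,2), of "corner m"]
        sum_nxt_weight[OF assms i(1,2)]
      by (intro CollectI exI[of _ "1 - (w i + w (nxt m i))"] exI[of _ "w i"] exI[of _ "w (nxt m i)"])
        (simp add: spread_def)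
    then show "p \<in> (\<Union>i\<in>{1..m}. S i)" using i(1) by blast
  qed
  ultimately show ?thesis by (rule continuous_on_subset)
qed

text \<open>The pair is given unordered because the category decides in which direction an edge is
  traversed.\<close>

lemma fan_edge:
  assumes "m \<ge> 3" "i \<in> {1..m}" "{a, b} = {i, nxt m i}" "0 \<le> u" "u \<le> 1"
  defines "w \<equiv> \<lambda>k. if k = a then 1 - u else if k = b then u else 0"
  shows "w \<in> fan m" "sum w {1..m} = 1" "spread m w = linepath (corner m a) (corner m b) u"
    "a \<noteq> b"
proof -
  have c: "a = i \<and> b = nxt m i \<or> a = nxt m i \<and> b = i"
    using assms(3) by (simp only: doubleton_eq_iff)
  then show ab: "a \<noteq> b" using nxt_props(2)[OF assms(1,2)] by metis
  have w0: "\<forall>k. k \<notin> {i, nxt m i} \<longrightarrow> w k = 0"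
    unfolding assms(3)[symmetric] by (simp add: w_def)
  have nn: "w k \<ge> 0" for k using assms(4,5) by (simp add: w_def)
  have wab: "w a = 1 - u" "w b = u" using ab by (simp_all add: w_def)
  show s: "sum w {1..m} = 1"
    using c
  proof
    assume "a = i \<and> b = nxt m i"
    then show ?thesis using sum_nxt_weight[OF assms(1,2) w0] wab by simp
  next
    assume "a = nxt m i \<and> b = i"
    then show ?thesis using sum_nxt_weight[OF assms(1,2) w0] wab by simp
  qed
  show "w \<in> fan m" unfolding fan_def using s assms(2) w0 nn by auto
  show "spread m w = linepath (corner m a) (corner m b) u"
    using c
  proof
    assume "a = i \<and> b = nxt m i"
    then show ?thesis using sum_nxt[OF assms(1,2) w0, of "corner m"] wab
      by (simp add: spread_def linepath_def)
  next
    assume "a = nxt m i \<and> b = i"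
    then show ?thesis using sum_nxt[OF assms(1,2) w0, of "corner m"] wab
      by (simp add: spread_def linepath_def)
  qed
qed

lemma fan_corner:
  assumes "m \<ge> 3" "i \<in> {1..m}"
  defines "w \<equiv> \<lambda>k. if k = i then 1 else 0"
  shows "w \<in> fan m" "sum w {1..m} = 1" "spread m w = corner m i"
proof -
  have e: "w = (\<lambda>k. if k = i then 1 - 0 else if k = nxt m i then 0 else 0)"
    by (auto simp: w_def)
  show "w \<in> fan m" "sum w {1..m} = 1" "spread m w = corner m i"
    unfolding e using fan_edge(1-3)[OF assms(1,2) refl order_refl zero_le_one]
    by (simp_all add: linepath_def)
qed

section \<open>Realizations\<close>

lemma homeomorphic_space_quotients:
  assumes f: "quotient_map Z Y f" and g: "quotient_map Z X g"
    and eq: "\<And>z z'. z \<in> topspace Z \<Longrightarrow> z' \<in> topspace Z \<Longrightarrow> f z = f z' \<longleftrightarrow> g z = g z'"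
  shows "Y homeomorphic_space X"
proof -
  obtain a where a: "continuous_map Y X a" "\<And>z. z \<in> topspace Z \<Longrightarrow> a (f z) = g z"
    by (rule quotient_map_lift_exists[OF f quotient_imp_continuous_map[OF g]]) (use eq in blast)+
  obtain b where b: "continuous_map X Y b" "\<And>z. z \<in> topspace Z \<Longrightarrow> b (g z) = f z"
    by (rule quotient_map_lift_exists[OF g quotient_imp_continuous_map[OF f]]) (use eq in blast)+
  have "homeomorphic_maps Y X a b"
    unfolding homeomorphic_maps_def
    using a b quotient_imp_surjective_map[OF f] quotient_imp_surjective_map[OF g]
    by (metis imageE)
  then show ?thesis
    by (auto simp: homeomorphic_space_def)
qed

text \<open>\<open>gl\<close> and \<open>fib\<close> say that the fibres of \<open>q\<close> are
  exactly the classes of the equivalence relation generated by the gluing. So \<open>X\<close> and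
  the realization are quotients of the same sum with the same fibres.\<close>

lemma realization_homeomorphic_space:
  assumes q: "quotient_map (sum_topology (\<lambda>(a, x). D a) (Sigma (Obj C) (Lev T))) X q"
    and gl: "\<And>z z'. (z, z') \<in> gluing C T D F \<Longrightarrow> q z = q z'"
    and fib: "\<And>z z'. z \<in> Sigma (Sigma (Obj C) (Lev T)) (\<lambda>(a, x). topspace (D a)) \<Longrightarrow>
      z' \<in> Sigma (Sigma (Obj C) (Lev T)) (\<lambda>(a, x). topspace (D a)) \<Longrightarrow> q z = q z' \<Longrightarrow>
      (z, z') \<in> (gluing C T D F \<union> (gluing C T D F)\<inverse>)\<^sup>*"
  shows "realization C T D F homeomorphic_space X"
proof -
  define E where "E = (gluing C T D F \<union> (gluing C T D F)\<inverse>)\<^sup>*"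
  have ts: "topspace (sum_topology (\<lambda>(a, x). D a) (Sigma (Obj C) (Lev T))) =
    Sigma (Sigma (Obj C) (Lev T)) (\<lambda>(a, x). topspace (D a))"
    by (simp add: o_def case_prod_unfold)
  have sym: "(z, z') \<in> E \<Longrightarrow> (z', z) \<in> E" for z z'
    unfolding E_def by (metis converse_Un converse_converse rtrancl_converseD sup_commute)
  have tr: "(z, z') \<in> E \<Longrightarrow> (z', z'') \<in> E \<Longrightarrow> (z, z'') \<in> E" for z z' z''
    unfolding E_def by (rule rtrancl_trans)
  have E: "q z = q z'" if "(z, z') \<in> E" for z z'
    using that unfolding E_def by (induction rule: rtrancl_induct) (auto dest: gl)
  show ?thesis
    unfolding realization_def E_def[symmetric]
  proof (rule homeomorphic_space_quotients[OF quotient_map_quotient_topology q])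
    fix z z'
    assume z: "z \<in> topspace (sum_topology (\<lambda>(a, x). D a) (Sigma (Obj C) (Lev T)))"
      and z': "z' \<in> topspace (sum_topology (\<lambda>(a, x). D a) (Sigma (Obj C) (Lev T)))"
    have "E `` {z} = E `` {z'} \<longleftrightarrow> (z, z') \<in> E"
    proof
      assume "E `` {z} = E `` {z'}"
      then show "(z, z') \<in> E" by (auto simp: E_def)
    next
      assume "(z, z') \<in> E"
      then show "E `` {z} = E `` {z'}"
        using sym tr by blast
    qed
    also have "\<dots> \<longleftrightarrow> q z = q z'"
      using fib[of z z'] z z' E unfolding ts E_def by blast
    finally show "E `` {z} = E `` {z'} \<longleftrightarrow> q z = q z'" .
  qed
qed

text \<open>A set with closed preimage is the union over \<open>J\<close> of images of closed
  subsets of compact pieces. These images are compact, hence closed in a Hausdorff space, and a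
  locally finite union of closed sets is closed.\<close>

lemma quotient_map_locally_finite_cover:
  assumes cont: "continuous_map (sum_topology D I) X q"
    and J: "J \<subseteq> I" and compact: "\<And>i. i \<in> J \<Longrightarrow> compact_space (D i)"
    and haus: "Hausdorff_space X"
    and cover: "\<And>p. p \<in> topspace X \<Longrightarrow> \<exists>i\<in>J. \<exists>x\<in>topspace (D i). q (i, x) = p"
    and lf: "\<And>p. p \<in> topspace X \<Longrightarrow>
      \<exists>U. openin X U \<and> p \<in> U \<and> finite {i \<in> J. \<exists>x\<in>topspace (D i). q (i, x) \<in> U}"
  shows "quotient_map (sum_topology D I) X q"
  unfolding quotient_map_closedin
proof (intro conjI allI impI)
  have ci: "continuous_map (D i) X (\<lambda>x. q (i, x))" if "i \<in> I" for i
    using continuous_map_compose[OF continuous_map_component_injection[OF that] cont] by (simp add: o_def)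
  show surj: "q ` topspace (sum_topology D I) = topspace X"
  proof
    show "q ` topspace (sum_topology D I) \<subseteq> topspace X"
      using continuous_map_image_subset_topspace[OF cont] .
    show "topspace X \<subseteq> q ` topspace (sum_topology D I)"
      using cover J by (fastforce simp: image_iff)
  qed
  fix U assume U: "U \<subseteq> topspace X"
  show "closedin (sum_topology D I) {x \<in> topspace (sum_topology D I). q x \<in> U} = closedin X U"
  proof
    assume L: "closedin (sum_topology D I) {x \<in> topspace (sum_topology D I). q x \<in> U}"
    define K where "K i = (\<lambda>x. q (i, x)) ` {x \<in> topspace (D i). q (i, x) \<in> U}" for i
    have "U = \<Union> (K ` J)"
      using U cover by (fastforce simp: K_def)
    moreover have "closedin X S" if "S \<in> K ` J" for S
    proof -
      from that obtain i where i: "i \<in> J" "S = K i" by blast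
      have "closedin (D i) {x \<in> topspace (D i). q (i, x) \<in> U}"
        using L i J unfolding closedin_sum_topology by (auto simp: subset_iff)
      then have "compactin (D i) {x \<in> topspace (D i). q (i, x) \<in> U}"
        using compact[OF i(1)] closedin_compact_space by blast
      then have "compactin X S"
        unfolding i K_def using ci i J by (intro image_compactin) auto
      then show ?thesis using compactin_imp_closedin haus by blast
    qed
    moreover have "locally_finite_in X (K ` J)"
      unfolding locally_finite_in_def
    proof (intro conjI ballI)
      show "\<Union> (K ` J) \<subseteq> topspace X" using U by (auto simp: K_def)
      fix p assume p: "p \<in> topspace X"
      obtain V where V: "openin X V" "p \<in> V" "finite {i \<in> J. \<exists>x\<in>topspace (D i). q (i, x) \<in> V}"
        using lf[OF p] by blast
      have "{S \<in> K ` J. S \<inter> V \<noteq> {}} \<subseteq> K ` {i \<in> J. \<exists>x\<in>topspace (D i). q (i, x) \<in> V}"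
        by (auto simp: K_def)
      then show "\<exists>V. openin X V \<and> p \<in> V \<and> finite {S \<in> K ` J. S \<inter> V \<noteq> {}}"
        using V(1,2) finite_subset[OF _ finite_imageI[OF V(3)]] by blast
    qed
    ultimately show "closedin X U"
      using closedin_locally_finite_Union[of "K ` J" X] by simp
  next
    assume "closedin X U"
    then show "closedin (sum_topology D I) {x \<in> topspace (sum_topology D I). q x \<in> U}"
      using cont by (rule closedin_continuous_map_preimage[rotated])
  qed
qed

section \<open>Presheaves from coloured tiles\<close>

lemma mgon_category_nxt:
  assumes "mgon_category m C s t d v"
  shows "i \<in> {1..m} \<Longrightarrow> {Comp C (d i) s, Comp C (d i) t} = {v i, v (nxt m i)}"
  using assms by (simp add: mgon_category_def nxt_def)

text \<open>
  \<open>A x k\<close> is the corner of colour \<open>k\<close> of the tile \<open>x\<close>, and \<open>phi x\<close> parametrizes this tile by the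
  coordinates of the regular polygon.
\<close>

locale folded_tiling =
  fixes m n :: nat and A :: "'i::countable \<Rightarrow> nat \<Rightarrow> 'v::countable"
    and phi :: "'i \<Rightarrow> (nat \<Rightarrow> real) \<Rightarrow> 'x" and X :: "'x topology"
  assumes m3: "m \<ge> 3" and n_pos: "n > 0"
    and colour: "i \<in> {1..m} \<Longrightarrow> j \<in> {1..m} \<Longrightarrow> A x i = A y j \<Longrightarrow> i = j"
    and common: "x \<noteq> y \<Longrightarrow> card {k \<in> {1..m}. A x k = A y k} \<le> 2"
    and neighbours: "i \<in> {1..m} \<Longrightarrow>
      card {u. \<exists>y. \<exists>j\<in>{1..m}. {A y j, A y (nxt m j)} = {A x i, u}} = n"
    and cont: "continuous_map (top_of_set (polygon m)) X (\<lambda>p. phi x (weights m p))"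
    and interior: "w \<in> fan m \<Longrightarrow> w' \<in> fan m \<Longrightarrow> sum w {1..m} < 1 \<Longrightarrow> phi x w = phi y w' \<Longrightarrow>
      x = y \<and> w = w'"
    and boundary: "w \<in> fan m \<Longrightarrow> w' \<in> fan m \<Longrightarrow> sum w {1..m} = 1 \<Longrightarrow> sum w' {1..m} = 1 \<Longrightarrow>
      phi x w = phi y w' \<longleftrightarrow> w = w' \<and> (\<forall>k\<in>{1..m}. w k > 0 \<longrightarrow> A x k = A y k)"
    and cover: "p \<in> topspace X \<Longrightarrow> \<exists>x. \<exists>w\<in>fan m. phi x w = p"
    and locally_finite: "p \<in> topspace X \<Longrightarrow>
      \<exists>U. openin X U \<and> p \<in> U \<and> finite {x. \<exists>w\<in>fan m. phi x w \<in> U}"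
    and hausdorff: "Hausdorff_space X"
begin

text \<open>An edge remembers its label, hence it has the same label in all tiles containing it.\<close>

definition side :: "'i \<Rightarrow> nat \<Rightarrow> nat \<times> 'v \<times> 'v" where
  "side x i = (i, A x i, A x (nxt m i))"

lemma side_eq_iff: "side x i = side y j \<longleftrightarrow> i = j \<and> A x i = A y i \<and> A x (nxt m i) = A y (nxt m i)"
  by (auto simp: side_def)

lemma nxt_in: "i \<in> {1..m} \<Longrightarrow> nxt m i \<in> {1..m}"
  using nxt_props(1)[OF m3] .

lemma A_neq: "i \<in> {1..m} \<Longrightarrow> A x i \<noteq> A x (nxt m i)"
  using colour[OF _ nxt_in, of i i x x] nxt_props(2)[OF m3, of i] by auto

end

locale folded_presheaf = folded_tiling m n A phi X
  for m n :: nat and A :: "'i::countable \<Rightarrow> nat \<Rightarrow> 'v::countable"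
    and phi :: "'i \<Rightarrow> (nat \<Rightarrow> real) \<Rightarrow> 'x" and X :: "'x topology" +
  fixes C :: "(nat, 'm) category" and s t :: 'm and d v :: "nat \<Rightarrow> 'm"
  assumes mgon: "mgon_category m C s t d v"
begin

text \<open>An edge with label \<open>i\<close> stores its corners of colours \<open>i\<close> and
  \<open>nxt m i\<close>, and which of them is its source is read off from \<open>d i o s\<close> in
  the category. The same coloured tiles thus serve every choice of directions in the
  category.\<close>

definition presh :: "(nat, 'm, nat) presheaf" where
  "presh = \<lparr>
     Lev = (\<lambda>a. if a = 0 then {to_nat (A x i) | x i. i \<in> {1..m}}
       else if a = 1 then {to_nat (side x i) | x i. i \<in> {1..m}} else range (to_nat :: 'i \<Rightarrow> nat)),
     Act = (\<lambda>f a.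
       if f = s \<or> f = t then
         (case from_nat a of (i, b, c) \<Rightarrow> to_nat (if Comp C (d i) f = v i then b else c :: 'v))
       else if f \<in> d ` {1..m} then to_nat (side (from_nat a) (inv_into {1..m} d f))
       else if f \<in> v ` {1..m} then to_nat (A (from_nat a) (inv_into {1..m} v f))
       else a)\<rparr>"

lemma arrows:
  shows "s \<in> hom C 0 1" "t \<in> hom C 0 1" "s \<noteq> t" "i \<in> {1..m} \<Longrightarrow> d i \<in> hom C 1 2"
    "i \<in> {1..m} \<Longrightarrow> v i \<in> hom C 0 2" "inj_on d {1..m}" "inj_on v {1..m}"
    "a \<in> {0, 1, 2} \<Longrightarrow> Ident C a \<in> hom C a a" "Obj C = {0, 1, 2}"
  using mgon unfolding mgon_category_def is_category_def by simp_all

lemma arrow_cases: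
  assumes "f \<in> Arr C"
  obtains a where "a \<in> {0, 1, 2}" "f = Ident C a" | "f = s" | "f = t"
    | i where "i \<in> {1..m}" "f = d i" | i where "i \<in> {1..m}" "f = v i"
  using mgon assms unfolding mgon_category_def by auto

lemma dom_cod:
  "Dom C s = 0" "Cod C s = 1" "Dom C t = 0" "Cod C t = 1"
  "i \<in> {1..m} \<Longrightarrow> Dom C (d i) = 1" "i \<in> {1..m} \<Longrightarrow> Cod C (d i) = 2"
  "i \<in> {1..m} \<Longrightarrow> Dom C (v i) = 0" "i \<in> {1..m} \<Longrightarrow> Cod C (v i) = 2"
  "a \<in> {0, 1, 2} \<Longrightarrow> Dom C (Ident C a) = a" "a \<in> {0, 1, 2} \<Longrightarrow> Cod C (Ident C a) = a"
  using arrows unfolding hom_def by auto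

lemma in_Arr: "s \<in> Arr C" "t \<in> Arr C" "i \<in> {1..m} \<Longrightarrow> d i \<in> Arr C" "i \<in> {1..m} \<Longrightarrow> v i \<in> Arr C"
  "a \<in> {0, 1, 2} \<Longrightarrow> Ident C a \<in> Arr C"
  using arrows unfolding hom_def by auto

lemma arrows_distinct:
  "i \<in> {1..m} \<Longrightarrow> s \<noteq> d i" "i \<in> {1..m} \<Longrightarrow> t \<noteq> d i" "i \<in> {1..m} \<Longrightarrow> s \<noteq> v i" "i \<in> {1..m} \<Longrightarrow> t \<noteq> v i"
  "i \<in> {1..m} \<Longrightarrow> j \<in> {1..m} \<Longrightarrow> d i \<noteq> v j"
  "a \<in> {0, 1, 2} \<Longrightarrow> Ident C a \<noteq> s" "a \<in> {0, 1, 2} \<Longrightarrow> Ident C a \<noteq> t"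
  "i \<in> {1..m} \<Longrightarrow> a \<in> {0, 1, 2} \<Longrightarrow> Ident C a \<noteq> d i" "i \<in> {1..m} \<Longrightarrow> a \<in> {0, 1, 2} \<Longrightarrow> Ident C a \<noteq> v i"
  using dom_cod by (metis zero_neq_one zero_neq_numeral one_eq_numeral_iff numeral_eq_one_iff num.distinct(1))+

lemma d_image: "i \<in> {1..m} \<Longrightarrow> d i \<in> d ` {1..m}" "i \<in> {1..m} \<Longrightarrow> inv_into {1..m} d (d i) = i"
  "i \<in> {1..m} \<Longrightarrow> v i \<in> v ` {1..m}" "i \<in> {1..m} \<Longrightarrow> inv_into {1..m} v (v i) = i"
  using arrows by auto

lemma not_image: "i \<in> {1..m} \<Longrightarrow> v i \<notin> d ` {1..m}" "i \<in> {1..m} \<Longrightarrow> d i \<notin> v ` {1..m}"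
  "s \<notin> d ` {1..m}" "t \<notin> d ` {1..m}" "s \<notin> v ` {1..m}" "t \<notin> v ` {1..m}"
  "a \<in> {0, 1, 2} \<Longrightarrow> Ident C a \<notin> d ` {1..m}" "a \<in> {0, 1, 2} \<Longrightarrow> Ident C a \<notin> v ` {1..m}"
  using arrows_distinct by (metis imageE)+

lemma ends:
  assumes "i \<in> {1..m}"
  shows "Comp C (d i) s = v i \<and> Comp C (d i) t = v (nxt m i) \<or> Comp C (d i) s = v (nxt m i) \<and> Comp C (d i) t = v i"
    and "v i \<noteq> v (nxt m i)"
proof -
  show "Comp C (d i) s = v i \<and> Comp C (d i) t = v (nxt m i) \<or> Comp C (d i) s = v (nxt m i) \<and> Comp C (d i) t = v i"
    using mgon_category_nxt[OF mgon assms] by (simp only: doubleton_eq_iff)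
  show "v i \<noteq> v (nxt m i)"
    using inj_onD[OF arrows(7) _ assms nxt_in[OF assms]] nxt_props(2)[OF m3 assms] by metis
qed

lemma Lev_simps:
  "Lev presh 0 = {to_nat (A x i) | x i. i \<in> {1..m}}"
  "Lev presh 1 = {to_nat (side x i) | x i. i \<in> {1..m}}"
  "Lev presh 2 = range (to_nat :: 'i \<Rightarrow> nat)"
  by (simp_all add: presh_def)

lemma Act_simps:
  "i \<in> {1..m} \<Longrightarrow> Act presh (d i) (to_nat x) = to_nat (side x i)"
  "i \<in> {1..m} \<Longrightarrow> Act presh (v i) (to_nat x) = to_nat (A x i)"
  "a \<in> {0, 1, 2} \<Longrightarrow> Act presh (Ident C a) b = b"
  "f = s \<or> f = t \<Longrightarrow> Act presh f (to_nat (side x i)) =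
     to_nat (if Comp C (d i) f = v i then A x i else A x (nxt m i))"
proof -
  show "i \<in> {1..m} \<Longrightarrow> Act presh (d i) (to_nat x) = to_nat (side x i)"
    using arrows_distinct(1,2)[of i, symmetric] d_image[of i] by (simp add: presh_def)
  show "i \<in> {1..m} \<Longrightarrow> Act presh (v i) (to_nat x) = to_nat (A x i)"
    using arrows_distinct(3,4)[of i, symmetric] d_image[of i] not_image(1)[of i] by (simp add: presh_def)
  show "a \<in> {0, 1, 2} \<Longrightarrow> Act presh (Ident C a) b = b"
    using arrows_distinct(6,7)[of a] not_image(7,8)[of a] by (simp add: presh_def)
  show "f = s \<or> f = t \<Longrightarrow> Act presh f (to_nat (side x i)) =
     to_nat (if Comp C (d i) f = v i then A x i else A x (nxt m i))"
    by (auto simp: presh_def side_def)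
qed

text \<open>The colour \<open>j\<close> of the end picked by \<open>f\<close> depends on the label
  only, not on the tile; this makes the action compatible with \<open>d i o f = v j\<close>.\<close>

lemma Act_comp:
  assumes "i \<in> {1..m}" "f = s \<or> f = t"
  obtains j where "j \<in> {1..m}" "Comp C (d i) f = v j" "\<And>x. Act presh f (to_nat (side x i)) = to_nat (A x j)"
    "j = i \<or> j = nxt m i"
proof (cases "Comp C (d i) f = v i")
  case True
  then show ?thesis using that[of i] assms(1) Act_simps(4)[OF assms(2), of _ i] by simp
next
  case False
  then have "Comp C (d i) f = v (nxt m i)" using ends(1)[OF assms(1)] assms(2) by blast
  then show ?thesis
    using that[of "nxt m i"] nxt_in[OF assms(1)] False Act_simps(4)[OF assms(2), of _ i] by simp
qed

text \<open>Apart from composites with identities only \<open>d i\<close> after \<open>s\<close> or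
  \<open>t\<close> remains, so functoriality has one case with content.\<close>

lemma comp_cases:
  assumes "f \<in> Arr C" "g \<in> Arr C" "Cod C f = Dom C g"
  obtains "f = Ident C (Dom C g)" "Comp C g f = g" "Dom C g \<in> {0, 1, 2}"
  | "g = Ident C (Cod C f)" "Comp C g f = f" "Cod C f \<in> {0, 1, 2}"
  | i where "i \<in> {1..m}" "g = d i" "f = s \<or> f = t"
proof -
  have cat: "is_category C"
    using mgon by (simp add: mgon_category_def)
  have u: "Comp C f (Ident C (Dom C f)) = f \<and> Comp C (Ident C (Cod C f)) f = f" if "f \<in> Arr C" for f
    using cat that unfolding is_category_def by blast
  have o: "Dom C f \<in> {0, 1, 2}" "Cod C f \<in> {0, 1, 2}" if "f \<in> Arr C" for f
    using cat that unfolding is_category_def arrows(9)[symmetric] by blast+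
  have one: "g = Ident C 1 \<or> (\<exists>i\<in>{1..m}. g = d i)" if "Dom C g = 1"
    using assms(2) by (cases rule: arrow_cases) (use dom_cod that in auto)
  have two: "g = Ident C 2" if "Dom C g = 2"
    using assms(2) by (cases rule: arrow_cases) (use dom_cod that in auto)
  note fu = u[OF assms(1)] and gu = u[OF assms(2)] and fo = o(2)[OF assms(1)] and go = o(1)[OF assms(2)]
  from assms(1) show ?thesis
  proof (cases rule: arrow_cases)
    case (1 a)
    then have "f = Ident C (Dom C g)" using dom_cod(10)[OF 1(1)] assms(3) by simp
    then show ?thesis using that(1) gu go by simp
  next
    case 2
    then have "Cod C f = 1" using dom_cod by simp
    then show ?thesis using one that(2,3) 2 fu fo assms(3) by auto
  next
    case 3
    then have "Cod C f = 1" using dom_cod by simp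
    then show ?thesis using one that(2,3) 3 fu fo assms(3) by auto
  next
    case (4 i)
    then have "Cod C f = 2" using dom_cod by simp
    then show ?thesis using two that(2) fu fo assms(3) by auto
  next
    case (5 i)
    then have "Cod C f = 2" using dom_cod by simp
    then show ?thesis using two that(2) fu fo assms(3) by auto
  qed
qed

lemma is_presheaf_presh: "is_presheaf C presh"
  unfolding is_presheaf_def
proof (intro conjI ballI impI)
  fix f assume "f \<in> Arr C"
  then show "Act presh f \<in> Lev presh (Cod C f) \<rightarrow> Lev presh (Dom C f)"
  proof (cases rule: arrow_cases)
    case (1 a)
    then show ?thesis using dom_cod(9,10)[of a] Act_simps(3)[of a] by auto
  next
    case 2
    show ?thesis
    proof
      fix e assume "e \<in> Lev presh (Cod C f)"
      then obtain x i where "i \<in> {1..m}" "e = to_nat (side x i)" using 2 dom_cod Lev_simps by auto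
      moreover from this(1) 2 obtain j where "j \<in> {1..m}" "\<And>x. Act presh f (to_nat (side x i)) = to_nat (A x j)"
        by (metis Act_comp)
      ultimately show "Act presh f e \<in> Lev presh (Dom C f)" using 2 dom_cod Lev_simps by auto
    qed
  next
    case 3
    show ?thesis
    proof
      fix e assume "e \<in> Lev presh (Cod C f)"
      then obtain x i where "i \<in> {1..m}" "e = to_nat (side x i)" using 3 dom_cod Lev_simps by auto
      moreover from this(1) 3 obtain j where "j \<in> {1..m}" "\<And>x. Act presh f (to_nat (side x i)) = to_nat (A x j)"
        by (metis Act_comp)
      ultimately show "Act presh f e \<in> Lev presh (Dom C f)" using 3 dom_cod Lev_simps by auto
    qed
  next
    case (4 i)
    then show ?thesis using Act_simps(1)[OF 4(1)] dom_cod(5,6)[OF 4(1)] Lev_simps by auto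
  next
    case (5 i)
    then show ?thesis using Act_simps(2)[OF 5(1)] dom_cod(7,8)[OF 5(1)] Lev_simps by auto
  qed
next
  fix a x assume "a \<in> Obj C"
  then show "Act presh (Ident C a) x = x" using Act_simps(3) arrows(9) by blast
next
  fix f g x assume f: "f \<in> Arr C" and g: "g \<in> Arr C" and fg: "Cod C f = Dom C g" and x: "x \<in> Lev presh (Cod C g)"
  from f g fg show "Act presh (Comp C g f) x = Act presh f (Act presh g x)"
  proof (cases rule: comp_cases)
    case 1
    then show ?thesis using Act_simps(3) by metis
  next
    case 2
    then show ?thesis using Act_simps(3) by metis
  next
    case (3 i)
    from x 3 obtain y :: 'i where y: "x = to_nat y" using dom_cod(6) Lev_simps(3) by auto
    obtain j where "j \<in> {1..m}" "Comp C (d i) f = v j" "\<And>x. Act presh f (to_nat (side x i)) = to_nat (A x j)"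
      using Act_comp[OF 3(1,3)] by metis
    then show ?thesis using 3 y Act_simps by simp
  qed
qed

text \<open>An edge has ends of different colours, and the edges and corners of one tile are told
  apart by label and colour.\<close>

lemma inj_on_yoneda:
  assumes "x \<in> Lev presh a"
  shows "inj_on (yoneda_map presh x) (hom C b a)"
proof (rule inj_onI, unfold yoneda_map_def)
  fix f g assume f: "f \<in> hom C b a" and g: "g \<in> hom C b a" and eq: "Act presh f x = Act presh g x"
  then have fA: "f \<in> Arr C" "Dom C f = b" "Cod C f = a" and gA: "g \<in> Arr C" "Dom C g = b" "Cod C g = a"
    by (auto simp: hom_def)
  have st: False if "a = 1" "Act presh s x = Act presh t x"
  proof -
    from assms that(1) obtain y i where y: "i \<in> {1..m}" "x = to_nat (side y i)" using Lev_simps by auto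
    then show False
      using that(2) Act_simps(4)[of s y i] Act_simps(4)[of t y i] ends[OF y(1)] A_neq[OF y(1), of y]
      by (auto split: if_splits)
  qed
  from fA(1) show "f = g"
  proof (cases rule: arrow_cases)
    case (1 c)
    from gA(1) show ?thesis
      by (cases rule: arrow_cases) (use 1 fA gA dom_cod in auto)
  next
    case 2
    then have a: "a = 1" "b = 0" using fA dom_cod by auto
    from gA(1) show ?thesis
      by (cases rule: arrow_cases) (use 2 fA gA dom_cod st a eq in auto)
  next
    case 3
    then have a: "a = 1" "b = 0" using fA dom_cod by auto
    from gA(1) show ?thesis
      by (cases rule: arrow_cases) (use 3 fA gA dom_cod st a eq in auto)
  next
    case (4 i)
    then have a: "a = 2" "b = 1" using fA dom_cod by auto
    then obtain y :: 'i where y: "x = to_nat y" using assms Lev_simps(3) by auto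
    from gA(1) show ?thesis
    proof (cases rule: arrow_cases)
      case (4 j)
      then show ?thesis using eq y \<open>f = d i\<close> \<open>i \<in> {1..m}\<close> Act_simps(1) by (simp add: side_eq_iff)
    qed (use a gA dom_cod in auto)
  next
    case (5 i)
    then have a: "a = 2" "b = 0" using fA dom_cod by auto
    then obtain y :: 'i where y: "x = to_nat y" using assms Lev_simps(3) by auto
    from gA(1) show ?thesis
    proof (cases rule: arrow_cases)
      case (5 j)
      then show ?thesis using eq y \<open>f = v i\<close> \<open>i \<in> {1..m}\<close> Act_simps(2) colour[of i j y y] by simp
    qed (use a gA dom_cod in auto)
  qed
qed

lemma tile_edges_presh: "tile_edges m d presh (to_nat x) = {to_nat (side x i) | i. i \<in> {1..m}}"
  unfolding tile_edges_def using Act_simps(1) by metis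

text \<open>Two different edges of a polygon have at least three corners in all, whereas distinct
  tiles share at most two corners by \<open>common\<close>.\<close>

lemma common_edges:
  fixes x y :: 'i
  assumes "x \<noteq> y"
  shows "card (tile_edges m d presh (to_nat x) \<inter> tile_edges m d presh (to_nat y)) \<le> 1"
proof -
  have "finite (tile_edges m d presh (to_nat x) \<inter> tile_edges m d presh (to_nat y))"
    unfolding tile_edges_presh by simp
  moreover have "e = e'" if e: "e \<in> tile_edges m d presh (to_nat x)" "e \<in> tile_edges m d presh (to_nat y)"
    and e': "e' \<in> tile_edges m d presh (to_nat x)" "e' \<in> tile_edges m d presh (to_nat y)" for e e'
  proof -
    have *: "\<exists>i\<in>{1..m}. e = to_nat (side x i) \<and> A x i = A y i \<and> A x (nxt m i) = A y (nxt m i)"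
      if "e \<in> tile_edges m d presh (to_nat x)" "e \<in> tile_edges m d presh (to_nat y)" for e
      using that unfolding tile_edges_presh by (auto simp: side_eq_iff)
    from *[OF e] obtain i where i: "i \<in> {1..m}" "e = to_nat (side x i)" "A x i = A y i"
      "A x (nxt m i) = A y (nxt m i)" by blast
    from *[OF e'] obtain j where j: "j \<in> {1..m}" "e' = to_nat (side x j)" "A x j = A y j"
      "A x (nxt m j) = A y (nxt m j)" by blast
    let ?S = "{k \<in> {1..m}. A x k = A y k}"
    have sub: "{i, nxt m i} \<subseteq> ?S" using i nxt_in by simp
    moreover have "card ?S \<le> card {i, nxt m i}"
      using common[OF assms] nxt_props(2)[OF m3 i(1)] by simp
    ultimately have S: "{i, nxt m i} = ?S" by (intro card_seteq) auto
    have "j \<in> {i, nxt m i}" "nxt m j \<in> {i, nxt m i}" unfolding S using j nxt_in by simp_all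
    then have "j = i" using nxt_props(2,3)[OF m3 i(1)] nxt_props(2)[OF m3 j(1)] by auto
    then show ?thesis using i j by simp
  qed
  ultimately show ?thesis
    by (simp add: card_le_Suc0_iff_eq)
qed

text \<open>Sending an edge at the vertex to its other end is a bijection onto the set counted by
  \<open>neighbours\<close>. It is injective because the colours of the two ends determine the
  label.\<close>

lemma vertex_degree:
  assumes "w \<in> Lev presh 0"
  shows "finite {e \<in> Lev presh 1. Act presh s e = w \<or> Act presh t e = w}"
    "card {e \<in> Lev presh 1. Act presh s e = w \<or> Act presh t e = w} = n"
proof -
  from assms obtain x i where i: "i \<in> {1..m}" "w = to_nat (A x i)" using Lev_simps by auto
  define E where "E = {side y j | y j. j \<in> {1..m} \<and> (A y j = A x i \<or> A y (nxt m j) = A x i)}"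
  define N where "N = {u. \<exists>y. \<exists>j\<in>{1..m}. {A y j, A y (nxt m j)} = {A x i, u}}"
  define g where "g = (\<lambda>(j :: nat, b, c). if b = A x i then c else b)"
  have *: "Act presh s (to_nat (side y j)) = w \<or> Act presh t (to_nat (side y j)) = w \<longleftrightarrow>
      A y j = A x i \<or> A y (nxt m j) = A x i" if "j \<in> {1..m}" for y j
    using ends[OF that] Act_simps(4)[of s y j] Act_simps(4)[of t y j] i(2) by auto
  then have eq: "{e \<in> Lev presh 1. Act presh s e = w \<or> Act presh t e = w} = to_nat ` E"
  proof (intro set_eqI iffI)
    fix e assume "e \<in> {e \<in> Lev presh 1. Act presh s e = w \<or> Act presh t e = w}"
    then have e: "e \<in> Lev presh 1" "Act presh s e = w \<or> Act presh t e = w" by simp_all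
    from e(1) obtain y j where j: "j \<in> {1..m}" "e = to_nat (side y j)" unfolding Lev_simps by blast
    have "side y j \<in> E" unfolding E_def using j(1) *[OF j(1), of y] e(2) j(2) by blast
    then show "e \<in> to_nat ` E" using j(2) by simp
  next
    fix e assume "e \<in> to_nat ` E"
    then obtain y j where j: "j \<in> {1..m}" "e = to_nat (side y j)" "A y j = A x i \<or> A y (nxt m j) = A x i"
      unfolding E_def by blast
    have "e \<in> Lev presh 1" unfolding Lev_simps using j(1,2) by blast
    then show "e \<in> {e \<in> Lev presh 1. Act presh s e = w \<or> Act presh t e = w}"
      using j *[OF j(1), of y] by simp
  qed
  have inj: "inj_on g E"
  proof (rule inj_onI)
    fix e e' assume "e \<in> E" "e' \<in> E" and g: "g e = g e'"
    then obtain y j y' j' where j: "j \<in> {1..m}" "A y j = A x i \<or> A y (nxt m j) = A x i" "e = side y j"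
      and j': "j' \<in> {1..m}" "A y' j' = A x i \<or> A y' (nxt m j') = A x i" "e' = side y' j'"
      unfolding E_def by blast
    \<comment> \<open>An edge with \<open>i\<close> as its first colour and one with
      \<open>i\<close> as its second cannot have the same other end: the colour of that end would be
      both successor and predecessor of \<open>i\<close>.\<close>
    have no: False if j: "j \<in> {1..m}" "A y j = A x i" and j': "j' \<in> {1..m}" "A y' (nxt m j') = A x i"
      and "A y (nxt m j) = A y' j'" for y j y' j'
    proof -
      have "j = i" using colour[OF j(1) i(1) j(2)] .
      moreover have "nxt m j' = i" using colour[OF nxt_in[OF j'(1)] i(1) j'(2)] .
      moreover have "nxt m j = j'" using colour[OF nxt_in[OF j(1)] j'(1) that(5)] .
      ultimately show False using nxt_props(3)[OF m3 i(1)] by simp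
    qed
    show "e = e'"
    proof (cases "A y j = A x i")
      case True
      then have ji: "j = i" using colour[OF j(1) i(1)] by simp
      show ?thesis
      proof (cases "A y' j' = A x i")
        case True': True
        then have "j' = i" using colour[OF j'(1) i(1)] by simp
        then show ?thesis using g True True' ji j j' by (simp add: g_def side_def)
      next
        case False
        then show ?thesis using no[OF j(1) True j'(1), of y'] j j' g True by (simp add: g_def side_def)
      qed
    next
      case False
      then have nj: "A y (nxt m j) = A x i" using j(2) by simp
      show ?thesis
      proof (cases "A y' j' = A x i")
        case True
        then show ?thesis using no[OF j'(1) True j(1) nj] j j' g False by (simp add: g_def side_def)
      next
        case False': False
        then have nj': "A y' (nxt m j') = A x i" using j'(2) by simp
        have "nxt m j = i" "nxt m j' = i"
          using colour[OF nxt_in[OF j(1)] i(1) nj] colour[OF nxt_in[OF j'(1)] i(1) nj'] by simp_all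
        then have "j = j'" using nxt_inj[OF j(1) j'(1)] by simp
        then show ?thesis using g False False' nj nj' j j' by (simp add: g_def side_def)
      qed
    qed
  qed
  have img: "g ` E = N"
  proof
    show "g ` E \<subseteq> N"
    proof
      fix u assume "u \<in> g ` E"
      then obtain y j where j: "j \<in> {1..m}" "A y j = A x i \<or> A y (nxt m j) = A x i" "u = g (side y j)"
        unfolding E_def by blast
      then have "{A y j, A y (nxt m j)} = {A x i, u}"
        by (cases "A y j = A x i") (simp_all add: g_def side_def insert_commute)
      then show "u \<in> N" unfolding N_def using j(1) by blast
    qed
    show "N \<subseteq> g ` E"
    proof
      fix u assume "u \<in> N"
      then obtain y j where j: "j \<in> {1..m}" "{A y j, A y (nxt m j)} = {A x i, u}" unfolding N_def by blast
      then have c: "A y j = A x i \<and> A y (nxt m j) = u \<or> A y j = u \<and> A y (nxt m j) = A x i"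
        by (simp only: doubleton_eq_iff)
      then have "g (side y j) = u" using A_neq[OF j(1), of y] by (auto simp: g_def side_def)
      moreover have "side y j \<in> E" unfolding E_def using j(1) c by blast
      ultimately show "u \<in> g ` E" by blast
    qed
  qed
  have N: "card N = n" unfolding N_def by (rule neighbours[OF i(1)])
  then have "finite N" using n_pos card_ge_0_finite by blast
  then have "finite E" using inj img finite_imageD by blast
  then show "finite {e \<in> Lev presh 1. Act presh s e = w \<or> Act presh t e = w}" unfolding eq by simp
  have "card (to_nat ` E) = card E" by (intro card_image inj_on_subset[OF inj_to_nat]) simp
  also have "card E = n" using card_image[OF inj] img N by simp
  finally show "card {e \<in> Lev presh 1. Act presh s e = w \<or> Act presh t e = w} = n" unfolding eq .
qed

lemma reflective_presh: "reflective m d presh"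
  unfolding reflective_def
proof (intro ballI impI)
  fix a b e assume "a \<in> Lev presh 2" "b \<in> Lev presh 2" and e: "e \<in> tile_edges m d presh a \<inter> tile_edges m d presh b"
  then obtain x y :: 'i where xy: "a = to_nat x" "b = to_nat y" using Lev_simps(3) by auto
  from e obtain i j where "i \<in> {1..m}" "e = to_nat (side x i)" "j \<in> {1..m}" "e = to_nat (side y j)"
    unfolding xy tile_edges_presh by blast
  then show "\<exists>i\<in>{1..m}. e = Act presh (d i) a \<and> e = Act presh (d i) b"
    unfolding xy using Act_simps(1) by (intro bexI[of _ i]) (auto simp: side_eq_iff)
qed

section \<open>The map from the cells to the space and its fibres\<close>

abbreviation F :: "'m \<Rightarrow> complex \<Rightarrow> complex" where
  "F \<equiv> cell_map m C s t d v"

definition chart :: "'i \<Rightarrow> complex \<Rightarrow> 'x" where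
  "chart y p = phi y (weights m p)"

lemma chart_spread: "w \<in> fan m \<Longrightarrow> chart y (spread m w) = phi y w"
  by (simp add: chart_def weights_spread m3)

lemma F_simps:
  "F s = (\<lambda>_. 0)" "F t = (\<lambda>_. 1)" "i \<in> {1..m} \<Longrightarrow> F (v i) = (\<lambda>_. corner m i)"
  "a \<in> {0, 1, 2} \<Longrightarrow> F (Ident C a) = id"
proof -
  show "F s = (\<lambda>_. 0)" by (simp add: cell_map_def Let_def)
  show "F t = (\<lambda>_. 1)" using arrows(3) by (simp add: cell_map_def Let_def)
  show "i \<in> {1..m} \<Longrightarrow> F (v i) = (\<lambda>_. corner m i)"
    using arrows_distinct(3,4)[of i, symmetric] d_image(3,4)[of i] by (simp add: cell_map_def Let_def)
  show "a \<in> {0, 1, 2} \<Longrightarrow> F (Ident C a) = id"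
    using arrows_distinct(6,7)[of a] not_image(7,8)[of a] by (simp add: cell_map_def Let_def)
qed

lemma edge_ends:
  assumes "i \<in> {1..m}"
  obtains a b where "{a, b} = {i, nxt m i}" "a \<in> {1..m}" "b \<in> {1..m}"
    "F (d i) = (\<lambda>p. linepath (corner m a) (corner m b) (Re p))"
    "\<And>x. Act presh s (to_nat (side x i)) = to_nat (A x a)"
    "\<And>x. Act presh t (to_nat (side x i)) = to_nat (A x b)"
proof -
  have ne: "d i \<noteq> s" "d i \<noteq> t" using arrows_distinct(1,2)[OF assms] by auto
  obtain a where a: "a \<in> {1..m}" "Comp C (d i) s = v a" "\<And>x. Act presh s (to_nat (side x i)) = to_nat (A x a)"
    "a = i \<or> a = nxt m i" by (rule Act_comp[OF assms, of s]) (simp, blast)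
  obtain b where b: "b \<in> {1..m}" "Comp C (d i) t = v b" "\<And>x. Act presh t (to_nat (side x i)) = to_nat (A x b)"
    "b = i \<or> b = nxt m i" by (rule Act_comp[OF assms, of t]) (simp, blast)
  have "v a \<noteq> v b" using ends[OF assms] a(2) b(2) by auto
  then have "{a, b} = {i, nxt m i}" using a(4) b(4) by auto
  moreover have "F (d i) = (\<lambda>p. linepath (corner m a) (corner m b) (Re p))"
    using ne d_image(1)[OF assms] not_image(2)[OF assms] a(1,2) b(1,2) d_image(4)
    by (simp add: cell_map_def Let_def)
  ultimately show ?thesis using that a b by blast
qed

text \<open>A vertex or edge is placed by the chart of an arbitrarily chosen tile containing it;
  \<open>boundary\<close> makes the choice immaterial, see \<open>rmap_vertex\<close> and
  \<open>rmap_edge\<close>.\<close>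

definition rmap :: "(nat \<times> nat) \<times> complex \<Rightarrow> 'x" where
  "rmap = (\<lambda>((a, x), p).
     if a = 2 then chart (from_nat x) p
     else if a = 1 then
       (case (SOME (y, i). i \<in> {1..m} \<and> x = to_nat (side y i)) of (y, i) \<Rightarrow> chart y (F (d i) p))
     else
       (case (SOME (y, i). i \<in> {1..m} \<and> x = to_nat (A y i)) of (y, i) \<Rightarrow> chart y (corner m i)))"

lemma rmap_tile: "rmap ((2, to_nat y), p) = chart y p"
  by (simp add: rmap_def)

lemma rmap_vertex:
  assumes i: "i \<in> {1..m}"
  shows "rmap ((0, to_nat (A y i)), p) = chart y (corner m i)"
proof -
  define z where "z = (SOME (y', i'). i' \<in> {1..m} \<and> to_nat (A y i) = to_nat (A y' i'))"
  have "case z of (y', i') \<Rightarrow> i' \<in> {1..m} \<and> to_nat (A y i) = to_nat (A y' i')"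
    unfolding z_def by (rule someI[of _ "(y, i)"]) (use i in simp)
  then obtain y' i' where z: "z = (y', i')" "i' \<in> {1..m}" "A y i = A y' i'" by (cases z) auto
  have i': "i' = i" using colour[OF i z(2,3)] by simp
  have "chart y' (corner m i) = chart y (corner m i)"
    using chart_spread[OF fan_corner(1)[OF m3 i]] fan_corner[OF m3 i] z(3) i'
      boundary[OF fan_corner(1)[OF m3 i] fan_corner(1)[OF m3 i], of y' y] by simp
  moreover have "rmap ((0, to_nat (A y i)), p) = (case z of (y, i) \<Rightarrow> chart y (corner m i))"
    by (simp add: rmap_def z_def)
  ultimately show ?thesis using z i' by simp
qed

lemma rmap_edge:
  assumes i: "i \<in> {1..m}" and p: "0 \<le> Re p" "Re p \<le> 1"
  shows "rmap ((1, to_nat (side y i)), p) = chart y (F (d i) p)"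
proof -
  define z where "z = (SOME (y', i'). i' \<in> {1..m} \<and> to_nat (side y i) = to_nat (side y' i'))"
  have "case z of (y', i') \<Rightarrow> i' \<in> {1..m} \<and> to_nat (side y i) = to_nat (side y' i')"
    unfolding z_def by (rule someI[of _ "(y, i)"]) (use i in simp)
  then obtain y' where z: "z = (y', i)" "A y i = A y' i" "A y (nxt m i) = A y' (nxt m i)"
    by (cases z) (auto simp: side_eq_iff)
  obtain a b where ab: "{a, b} = {i, nxt m i}" "F (d i) = (\<lambda>p. linepath (corner m a) (corner m b) (Re p))"
    using edge_ends[OF i] by metis
  define w where "w k = (if k = a then 1 - Re p else if k = b then Re p else 0)" for k
  note fe = fan_edge[OF m3 i ab(1) p, folded w_def]
  have "A y' k = A y k" if "w k > 0" for k
  proof -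
    have "k \<in> {a, b}" using that by (auto simp: w_def split: if_splits)
    then show ?thesis unfolding ab(1) using z by auto
  qed
  then have "chart y' (F (d i) p) = chart y (F (d i) p)"
    using boundary[OF fe(1,1,2,2), of y' y] chart_spread[OF fe(1)] fe(3) ab(2) by simp
  moreover have "rmap ((1, to_nat (side y i)), p) = (case z of (y, i) \<Rightarrow> chart y (F (d i) p))"
    by (simp add: rmap_def z_def)
  ultimately show ?thesis using z by simp
qed

abbreviation glue :: "(((nat \<times> nat) \<times> complex) \<times> ((nat \<times> nat) \<times> complex)) set" where
  "glue \<equiv> gluing C presh (cell m) F"

lemma cell_simps:
  "cell m 0 = top_of_set {0}" "cell m 1 = top_of_set (closed_segment 0 1)" "cell m 2 = top_of_set (polygon m)"
  "cell m (Suc 0) = top_of_set (closed_segment 0 1)"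
  by (simp_all add: cell_def polygon_def)

lemma segment_Re: "p \<in> closed_segment 0 (1::complex) \<Longrightarrow> 0 \<le> Re p \<and> Re p \<le> 1"
  by (auto simp: in_segment)

lemma glueI: "f \<in> Arr C \<Longrightarrow> x \<in> Lev presh (Cod C f) \<Longrightarrow> p \<in> topspace (cell m (Dom C f)) \<Longrightarrow>
    (((Dom C f, Act presh f x), p), ((Cod C f, x), F f p)) \<in> glue"
  unfolding gluing_def by blast

lemma glue_side:
  assumes "i \<in> {1..m}" "p \<in> closed_segment 0 1"
  shows "(((1, to_nat (side y i)), p), ((2, to_nat y), F (d i) p)) \<in> glue"
  using glueI[OF in_Arr(3)[OF assms(1)], of "to_nat y" p] assms dom_cod(5,6)[OF assms(1)]
  by (simp add: Lev_simps(3) Act_simps(1) cell_simps)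

lemma glue_vertex:
  assumes "i \<in> {1..m}"
  shows "(((0, to_nat (A y i)), 0), ((2, to_nat y), corner m i)) \<in> glue"
  using glueI[OF in_Arr(4)[OF assms(1)], of "to_nat y" 0] assms dom_cod(7,8)[OF assms(1)]
  by (simp add: Lev_simps(3) Act_simps(2) cell_simps F_simps(3))

lemma rmap_glue:
  assumes "(z, z') \<in> glue"
  shows "rmap z = rmap z'"
proof -
  from assms obtain f x p where f: "f \<in> Arr C" "x \<in> Lev presh (Cod C f)" "p \<in> topspace (cell m (Dom C f))"
    and z: "z = ((Dom C f, Act presh f x), p)" "z' = ((Cod C f, x), F f p)"
    unfolding gluing_def by blast
  have st: "rmap ((0, Act presh f x), p) = rmap ((1, x), F f p)" if "f = s \<or> f = t" "x \<in> Lev presh 1"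
  proof -
    from that(2) obtain y i where i: "i \<in> {1..m}" "x = to_nat (side y i)" using Lev_simps(2) by auto
    obtain a b where ab: "{a, b} = {i, nxt m i}" "a \<in> {1..m}" "b \<in> {1..m}"
      "F (d i) = (\<lambda>p. linepath (corner m a) (corner m b) (Re p))"
      "\<And>x. Act presh s (to_nat (side x i)) = to_nat (A x a)"
      "\<And>x. Act presh t (to_nat (side x i)) = to_nat (A x b)" by (fact edge_ends[OF i(1)])
    from that(1) show ?thesis
    proof
      assume "f = s"
      then show ?thesis
        using rmap_vertex[OF ab(2), of y p] rmap_edge[OF i(1), of 0 y] ab(4,5) i(2) F_simps(1)
        by (simp add: linepath_def)
    next
      assume "f = t"
      then show ?thesis
        using rmap_vertex[OF ab(3), of y p] rmap_edge[OF i(1), of 1 y] ab(4,6) i(2) F_simps(2)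
        by (simp add: linepath_def)
    qed
  qed
  from f(1) show ?thesis
  proof (cases rule: arrow_cases)
    case (1 a)
    then show ?thesis unfolding z using dom_cod(9,10)[OF 1(1)] Act_simps(3)[OF 1(1)] F_simps(4)[OF 1(1)] by simp
  next
    case 2
    then show ?thesis unfolding z using st f(2) dom_cod by simp
  next
    case 3
    then show ?thesis unfolding z using st f(2) dom_cod by simp
  next
    case (4 i)
    then obtain y :: 'i where "x = to_nat y" using f(2) dom_cod(6) Lev_simps(3) by auto
    then show ?thesis unfolding z
      using 4 dom_cod(5,6)[OF 4(1)] Act_simps(1)[OF 4(1)] rmap_tile[of y] rmap_edge[OF 4(1), of p y]
        segment_Re[of p] f(3) by (simp add: cell_simps)
  next
    case (5 i)
    then obtain y :: 'i where "x = to_nat y" using f(2) dom_cod(8) Lev_simps(3) by auto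
    then show ?thesis unfolding z
      using 5 dom_cod(7,8)[OF 5(1)] Act_simps(2)[OF 5(1)] rmap_tile[of y] rmap_vertex[OF 5(1), of y p]
      by (simp add: F_simps(3))
  qed
qed

definition gequiv where "gequiv = (glue \<union> glue\<inverse>)\<^sup>*"

lemma gequiv_rules: "(z, z') \<in> glue \<Longrightarrow> (z, z') \<in> gequiv" "(z, z') \<in> glue \<Longrightarrow> (z', z) \<in> gequiv"
  "(z, z') \<in> gequiv \<Longrightarrow> (z', z'') \<in> gequiv \<Longrightarrow> (z, z'') \<in> gequiv" "(z, z) \<in> gequiv"
  unfolding gequiv_def by (simp_all only: rtrancl_trans r_into_rtrancl Un_iff converse_iff rtrancl.rtrancl_refl simp_thms)

lemma gequiv_sym: "(z, z') \<in> gequiv \<Longrightarrow> (z', z) \<in> gequiv"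
  unfolding gequiv_def by (metis converse_Un converse_converse rtrancl_converseD sup_commute)

lemma F_d_polygon:
  assumes "i \<in> {1..m}" "p \<in> closed_segment 0 1"
  shows "F (d i) p \<in> polygon m"
proof -
  obtain a b where ab: "{a, b} = {i, nxt m i}" "F (d i) = (\<lambda>p. linepath (corner m a) (corner m b) (Re p))"
    using edge_ends[OF assms(1)] by metis
  note fe = fan_edge[OF m3 assms(1) ab(1), of "Re p"]
  show ?thesis
    using spread_in_polygon[OF m3 fe(1)] fe(3) segment_Re[OF assms(2)] ab(2) by simp
qed

text \<open>Every vertex and every edge lies in some tile, so fibres have to be compared only
  between points of tiles.\<close>

lemma to_tile:
  assumes "z \<in> Sigma (Sigma (Obj C) (Lev presh)) (\<lambda>(a, x). topspace (cell m a))"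
  obtains y :: 'i and p where "p \<in> polygon m" "(z, ((2, to_nat y), p)) \<in> gequiv"
proof -
  obtain a x p where z: "z = ((a, x), p)" by (metis surj_pair)
  then have *: "a \<in> {0, 1, 2}" "x \<in> Lev presh a" "p \<in> topspace (cell m a)"
    using assms arrows(9) by auto
  consider "a = 0" | "a = 1" | "a = 2" using *(1) by auto
  then show ?thesis
  proof cases
    case 1
    then obtain y i where "i \<in> {1..m}" "x = to_nat (A y i)" using *(2) Lev_simps(1) by auto
    moreover have "p = 0" using *(3) 1 by (simp add: cell_simps)
    ultimately show ?thesis
      using that[of "corner m i" y] corner_in_polygon[of i m] gequiv_rules(1)[OF glue_vertex[of i y]] 1 z by simp
  next
    case 2
    then obtain y i where i: "i \<in> {1..m}" "x = to_nat (side y i)" using *(2) Lev_simps(2) by auto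
    moreover have "p \<in> closed_segment 0 1" using *(3) 2 by (simp add: cell_simps)
    ultimately show ?thesis
      using that[of "F (d i) p" y] F_d_polygon[OF i(1)] gequiv_rules(1)[OF glue_side[OF i(1)]] 2 z by simp
  next
    case 3
    then obtain y :: 'i where "x = to_nat y" using *(2) Lev_simps(3) by auto
    then show ?thesis using that[of p y] 3 z *(3) gequiv_rules(4) by (simp add: cell_simps)
  qed
qed

text \<open>An inner point has a single preimage among the tiles. A boundary point has the same
  weights in both tiles, and the tiles share the corners carrying them; the two copies are therefore
  identified through the common vertex or, if two weights are positive, through the common
  edge.\<close>

lemma tile_fibres:
  assumes p: "p \<in> polygon m" and p': "p' \<in> polygon m" and eq: "chart x p = chart y p'"
  shows "(((2, to_nat x), p), ((2, to_nat y), p')) \<in> gequiv"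
proof -
  define w w' where "w = weights m p" and "w' = weights m p'"
  have w: "w \<in> fan m" "spread m w = p" and w': "w' \<in> fan m" "spread m w' = p'"
    using p p' weights_in_fan[OF m3] spread_weights[OF m3] by (simp_all add: w_def w'_def)
  have phi: "phi x w = phi y w'" using eq by (simp add: chart_def w_def w'_def)
  show ?thesis
  proof (cases "sum w {1..m} < 1 \<or> sum w' {1..m} < 1")
    case True
    then have "x = y \<and> w = w'"
      using interior[OF w(1) w'(1) _ phi] interior[OF w'(1) w(1) _ phi[symmetric]] by metis
    then show ?thesis using w w' gequiv_rules(4) by simp
  next
    case False
    obtain i where i: "i \<in> {1..m}" "\<forall>k. k \<notin> {i, nxt m i} \<longrightarrow> w k = 0" "\<And>k. w k \<ge> 0" "sum w {1..m} \<le> 1"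
      using fan_index[OF w(1)] by metis
    have 1: "sum w {1..m} = 1" "sum w' {1..m} = 1"
      using False w(1) w'(1) by (simp_all add: fan_def)
    have "w = w'" and agree: "\<And>k. k \<in> {1..m} \<Longrightarrow> w k > 0 \<Longrightarrow> A x k = A y k"
      using boundary[OF w(1) w'(1) 1] phi by auto
    then have pp: "p' = p" using w w' by simp
    note j = nxt_in[OF i(1)]
    have s: "w i + w (nxt m i) = 1" using sum_nxt_weight[OF m3 i(1,2)] 1 by simp
    have ps: "p = w i *\<^sub>R corner m i + w (nxt m i) *\<^sub>R corner m (nxt m i)"
      using w(2) sum_nxt[OF m3 i(1,2), of "corner m"] by (simp add: spread_def)
    have vertex: ?thesis if "k \<in> {1..m}" "p = corner m k" "w k > 0" for k
      using glue_vertex[OF that(1), of x] glue_vertex[OF that(1), of y] agree[OF that(1,3)] that(2) pp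
      by (metis gequiv_rules(1-3))
    consider "w i = 0" | "w (nxt m i) = 0" | "w i > 0" "w (nxt m i) > 0"
      using i(3)[of i] i(3)[of "nxt m i"] by argo
    then show ?thesis
    proof cases
      case 1
      then show ?thesis using vertex[OF j] ps s by simp
    next
      case 2
      then show ?thesis using vertex[OF i(1)] ps s by simp
    next
      case 3
      obtain a b where ab: "{a, b} = {i, nxt m i}" "F (d i) = (\<lambda>p. linepath (corner m a) (corner m b) (Re p))"
        using edge_ends[OF i(1)] by metis
      then have c: "a = i \<and> b = nxt m i \<or> a = nxt m i \<and> b = i" by (simp only: doubleton_eq_iff)
      \<comment> \<open>The parameter of the point on its edge is the weight of the target
        \<open>b\<close>, since \<open>F (d i)\<close> runs from \<open>a\<close> to
        \<open>b\<close>.\<close>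
      define u where "u = complex_of_real (w b)"
      have wb: "w b \<ge> 0" "w b \<le> 1" using c s 3 by auto
      have u: "u \<in> closed_segment 0 1"
        unfolding in_segment u_def using wb by (auto intro!: exI[of _ "w b"] simp: scaleR_conv_of_real)
      have "w a = 1 - w b" using c s by auto
      then have "F (d i) u = p" using c unfolding ab(2) u_def ps by (auto simp: linepath_def)
      moreover have "side x i = side y i"
        using agree[OF i(1)] agree[OF j] 3 by (simp add: side_eq_iff)
      ultimately show ?thesis
        using glue_side[OF i(1) u, of x] glue_side[OF i(1) u, of y] pp by (metis gequiv_rules(1-3))
    qed
  qed
qed

lemma rmap_gequiv: "(z, z') \<in> gequiv \<Longrightarrow> rmap z = rmap z'"
  unfolding gequiv_def by (induction rule: rtrancl_induct) (auto dest: rmap_glue)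

lemma rmap_fibres:
  assumes "z \<in> Sigma (Sigma (Obj C) (Lev presh)) (\<lambda>(a, x). topspace (cell m a))"
    and "z' \<in> Sigma (Sigma (Obj C) (Lev presh)) (\<lambda>(a, x). topspace (cell m a))" and "rmap z = rmap z'"
  shows "(z, z') \<in> gequiv"
proof -
  obtain y :: 'i and p where y: "p \<in> polygon m" "(z, ((2, to_nat y), p)) \<in> gequiv" using to_tile[OF assms(1)] by metis
  obtain y' :: 'i and p' where y': "p' \<in> polygon m" "(z', ((2, to_nat y'), p')) \<in> gequiv" using to_tile[OF assms(2)] by metis
  have "chart y p = chart y' p'"
    using rmap_gequiv[OF y(2)] rmap_gequiv[OF y'(2)] assms(3) rmap_tile by metis
  from tile_fibres[OF y(1) y'(1) this] show ?thesis
    using y(2) y'(2) by (metis gequiv_sym gequiv_rules(3))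
qed

lemma continuous_chart: "continuous_map (top_of_set (polygon m)) X (chart y)"
  using cont[of y] by (simp add: chart_def[abs_def])

lemma continuous_rmap:
  "continuous_map (sum_topology (\<lambda>(a, x). cell m a) (Sigma (Obj C) (Lev presh))) X rmap"
proof -
  have "continuous_map (cell m a) X (\<lambda>p. rmap ((a, x), p))" if a: "a \<in> {0, 1, 2}" and x: "x \<in> Lev presh a" for a x
  proof -
    consider "a = 0" | "a = 1" | "a = 2" using a by auto
    then show ?thesis
    proof cases
      case 1
      then obtain y i where i: "i \<in> {1..m}" "x = to_nat (A y i)" using x Lev_simps(1) by auto
      have "chart y (corner m i) \<in> topspace X"
        using continuous_map_image_subset_topspace[OF continuous_chart, of y] corner_in_polygon[OF i(1)] by auto
      then show ?thesis using 1 i rmap_vertex[OF i(1)] by (simp add: continuous_map_const)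
    next
      case 2
      then obtain y i where i: "i \<in> {1..m}" "x = to_nat (side y i)" using x Lev_simps(2) by auto
      obtain a b where "F (d i) = (\<lambda>p. linepath (corner m a) (corner m b) (Re p))" using edge_ends[OF i(1)] by metis
      then have "continuous_on (closed_segment 0 1) (F (d i))"
        by (auto simp: linepath_def intro!: continuous_intros)
      then have "continuous_map (cell m 1) (top_of_set (polygon m)) (F (d i))"
        using F_d_polygon[OF i(1)] by (simp add: cell_simps image_subset_iff_funcset[symmetric] image_subset_iff)
      from continuous_map_compose[OF this continuous_chart[of y]]
      have "continuous_map (cell m 1) X (\<lambda>p. chart y (F (d i) p))" by (simp add: o_def)
      then have "continuous_map (cell m 1) X (\<lambda>p. rmap ((1, x), p))"
        by (rule continuous_map_eq) (use i rmap_edge segment_Re in \<open>auto simp: cell_simps\<close>)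
      then show ?thesis using 2 by simp
    next
      case 3
      then obtain y :: 'i where "x = to_nat y" using x Lev_simps(3) by auto
      then show ?thesis using 3 continuous_chart[of y] by (simp add: cell_simps rmap_tile)
    qed
  qed
  then show ?thesis
    unfolding continuous_map_def openin_sum_topology arrows(9) topspace_sum_topology o_def
    by (fastforce simp: case_prod_unfold)
qed

lemma realization_presh: "realization C presh (cell m) F homeomorphic_space X"
proof (rule realization_homeomorphic_space[where q = rmap])
  show "quotient_map (sum_topology (\<lambda>(a, x). cell m a) (Sigma (Obj C) (Lev presh))) X rmap"
  \<comment> \<open>The tiles alone cover the space, so \<open>J\<close> leaves out the copies of
    the point and of the interval.\<close>
  proof (rule quotient_map_locally_finite_cover[where J = "{2} \<times> Lev presh 2", OF continuous_rmap])
    show "{2} \<times> Lev presh 2 \<subseteq> Sigma (Obj C) (Lev presh)" using arrows(9) by auto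
    show "compact_space (case i of (a, x) \<Rightarrow> cell m a)" if "i \<in> {2} \<times> Lev presh 2" for i
      using that compact_polygon by (auto simp: cell_simps compact_space_subtopology)
    show "Hausdorff_space X" by (rule hausdorff)
    show "\<exists>i\<in>{2} \<times> Lev presh 2. \<exists>x\<in>topspace (case i of (a, x) \<Rightarrow> cell m a). rmap (i, x) = p"
      if "p \<in> topspace X" for p
    proof -
      obtain x w where w: "w \<in> fan m" "phi x w = p" using cover[OF \<open>p \<in> topspace X\<close>] by blast
      then have "rmap ((2, to_nat x), spread m w) = p" by (simp add: rmap_tile chart_spread)
      then show ?thesis using spread_in_polygon[OF m3 w(1)] Lev_simps(3)
        by (intro bexI[of _ "(2, to_nat x)"] bexI[of _ "spread m w"]) (auto simp: cell_simps)
    qed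
    show "\<exists>U. openin X U \<and> p \<in> U \<and>
        finite {i \<in> {2} \<times> Lev presh 2. \<exists>x\<in>topspace (case i of (a, x) \<Rightarrow> cell m a). rmap (i, x) \<in> U}"
      if "p \<in> topspace X" for p
    proof -
      obtain U where U: "openin X U" "p \<in> U" "finite {x. \<exists>w\<in>fan m. phi x w \<in> U}"
        using locally_finite[OF \<open>p \<in> topspace X\<close>] by blast
      have "{i \<in> {2} \<times> Lev presh 2. \<exists>x\<in>topspace (case i of (a, x) \<Rightarrow> cell m a). rmap (i, x) \<in> U}
        \<subseteq> (\<lambda>x. (2, to_nat x)) ` {x. \<exists>w\<in>fan m. phi x w \<in> U}"
      proof
        fix i assume "i \<in> {i \<in> {2} \<times> Lev presh 2. \<exists>x\<in>topspace (case i of (a, x) \<Rightarrow> cell m a). rmap (i, x) \<in> U}"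
        then obtain y :: 'i and p where i: "i = (2, to_nat y)" "p \<in> polygon m" "rmap (i, p) \<in> U"
          using Lev_simps(3) by (auto simp: cell_simps)
        then have "phi y (weights m p) \<in> U" by (simp add: rmap_tile chart_def)
        then show "i \<in> (\<lambda>x. (2, to_nat x)) ` {x. \<exists>w\<in>fan m. phi x w \<in> U}"
          using i weights_in_fan[OF m3 i(2)] by blast
      qed
      then show ?thesis using U(1,2) finite_subset[OF _ finite_imageI[OF U(3)]] by blast
    qed
  qed
qed (use rmap_glue rmap_fibres[unfolded gequiv_def] in blast)+

lemma directed_tiling_presh: "directed_tiling m n C s t d v X presh"
  unfolding directed_tiling_def
proof (intro conjI ballI impI)
  fix x y assume "x \<in> Lev presh 2" "y \<in> Lev presh 2" "x \<noteq> y"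
  then show "card (tile_edges m d presh x \<inter> tile_edges m d presh y) \<le> 1"
    using common_edges Lev_simps(3) by auto
qed (use is_presheaf_presh inj_on_yoneda vertex_degree realization_presh in blast)+

end

section \<open>Combinatorics of strips\<close>

lemma int_primitive:
  fixes f :: "int \<Rightarrow> int"
  shows "\<exists>F. F 0 = 0 \<and> (\<forall>x. F (x + 1) = F x + f x)"
proof -
  define F where "F x = sum f {0..<x} - sum f {x..<0}" for x :: int
  have "F (x + 1) = F x + f x" for x
  proof (cases "x \<ge> 0")
    case True
    then have "{0..<x + 1} = insert x {0..<x}" by auto
    then show ?thesis using True by (simp add: F_def)
  next
    case False
    then have "{x..<0} = insert x {x + 1..<0}" by auto
    then show ?thesis using False by (simp add: F_def)
  qed
  then show ?thesis by (intro exI[of _ F]) (simp add: F_def)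
qed

lemma int_mono_steps:
  fixes f :: "int \<Rightarrow> int"
  assumes "\<And>x. f x \<le> f (x + 1)" "x \<le> y"
  shows "f x \<le> f y"
  using assms(2) by (induction y rule: int_ge_induct) (use assms(1) order_trans in blast)+

lemma int_growth:
  fixes f :: "int \<Rightarrow> int"
  assumes "\<And>x. f x + 1 \<le> f (x + c)" "c > 0"
  shows "f x + int k \<le> f (x + c * int k)"
proof (induction k)
  case (Suc k)
  then show ?case using assms(1)[of "x + c * int k"] by (simp add: algebra_simps)
qed simp

lemma int_unbounded:
  fixes f :: "int \<Rightarrow> int"
  assumes "\<And>x. f x + 1 \<le> f (x + c)" "c > 0"
  shows "\<exists>x. y \<le> f x" "\<exists>x. f x \<le> y"
proof -
  have "f 0 + int (nat (y - f 0)) \<le> f (0 + c * int (nat (y - f 0)))"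
    by (rule int_growth[of f c, OF assms])
  moreover have "y \<le> f 0 + int (nat (y - f 0))" by linarith
  ultimately show "\<exists>x. y \<le> f x" using order_trans by blast
  let ?x = "- c * int (nat (f 0 - y))"
  have "f ?x + int (nat (f 0 - y)) \<le> f (?x + c * int (nat (f 0 - y)))"
    by (rule int_growth[of f c, OF assms])
  then have "f ?x + int (nat (f 0 - y)) \<le> f 0" by simp
  then have "f ?x \<le> y" by linarith
  then show "\<exists>x. f x \<le> y" by blast
qed

lemma int_greatest:
  fixes P :: "int \<Rightarrow> bool"
  assumes "P a" "\<And>x. P x \<Longrightarrow> x \<le> b"
  obtains x where "P x" "\<And>y. P y \<Longrightarrow> y \<le> x"
proof -
  have fin: "finite {x \<in> {a..b}. P x}" by (rule finite_Collect_conjI) simp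
  have "a \<in> {x \<in> {a..b}. P x}" using assms by auto
  then have M: "Max {x \<in> {a..b}. P x} \<in> {x \<in> {a..b}. P x}" by (intro Max_in[OF fin]) blast
  have "y \<le> Max {x \<in> {a..b}. P x}" if "P y" for y
  proof (cases "y \<ge> a")
    case True
    then show ?thesis using that assms(2)[OF that] by (intro Max_ge[OF fin]) auto
  next
    case False
    then show ?thesis using M by auto
  qed
  then show ?thesis using that M by blast
qed

text \<open>The \<open>x\<close> with \<open>f x <= y\<close> form a nonempty downward closed set
  that is bounded above; \<open>g y\<close> is its maximum.\<close>

lemma int_upper_adjoint:
  fixes f :: "int \<Rightarrow> int"
  assumes mono: "\<And>x y. x \<le> y \<Longrightarrow> f x \<le> f y" and unb: "\<And>y. \<exists>x. y \<le> f x" "\<And>y. \<exists>x. f x \<le> y"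
  shows "\<exists>g. \<forall>x y. f x \<le> y \<longleftrightarrow> x \<le> g y"
proof -
  have "\<exists>z. \<forall>x. f x \<le> y \<longleftrightarrow> x \<le> z" for y
  proof -
    obtain a where a: "f a \<le> y" using unb(2) by blast
    obtain b where b: "y + 1 \<le> f b" using unb(1) by blast
    have "x \<le> b" if "f x \<le> y" for x
      using mono[of b x] that b by linarith
    from int_greatest[of "\<lambda>x. f x \<le> y", OF a this] obtain z where
      z: "f z \<le> y" "\<And>x. f x \<le> y \<Longrightarrow> x \<le> z" by blast
    have "f x \<le> y \<longleftrightarrow> x \<le> z" for x using z(1) z(2)[of x] mono[of x z] by (cases "x \<le> z") auto
    then show ?thesis by blast
  qed
  then show ?thesis by metis
qed

text \<open>Conjugating \<open>f\<close> with the reflection \<open>x -> - x\<close> turns this into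
  the upper adjoint.\<close>

lemma int_lower_adjoint:
  fixes f :: "int \<Rightarrow> int"
  assumes mono: "\<And>x y. x \<le> y \<Longrightarrow> f x \<le> f y" and unb: "\<And>y. \<exists>x. y \<le> f x" "\<And>y. \<exists>x. f x \<le> y"
  shows "\<exists>g. \<forall>x y. g y \<le> x \<longleftrightarrow> y \<le> f x"
proof -
  have "\<exists>g. \<forall>x y. - f (- x) \<le> y \<longleftrightarrow> x \<le> g y"
  proof (rule int_upper_adjoint)
    show "- f (- x) \<le> - f (- y)" if "x \<le> y" for x y using mono[of "- y" "- x"] that by simp
    show "\<exists>x. y \<le> - f (- x)" for y
    proof -
      obtain x where "f x \<le> - y" using unb(2) by blast
      then show ?thesis by (intro exI[of _ "- x"]) simp
    qed
    show "\<exists>x. - f (- x) \<le> y" for y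
    proof -
      obtain x where "- y \<le> f x" using unb(1) by blast
      then show ?thesis by (intro exI[of _ "- x"]) simp
    qed
  qed
  then obtain g where g: "\<And>x y. - f (- x) \<le> y \<longleftrightarrow> x \<le> g y" by blast
  have "- g (- y) \<le> x \<longleftrightarrow> y \<le> f x" for x y
    using g[of "- x" "- y"] by auto
  then show ?thesis by (intro exI[of _ "\<lambda>y. - g (- y)"]) simp
qed

section \<open>Strip systems and their existence\<close>

text \<open>
  \<open>gl l x\<close> is the last rung above line \<open>l\<close> that starts at or left of the vertex \<open>x\<close>, and \<open>gh l x\<close> the last
  rung of the same strip that ends at or left of the vertex \<open>x\<close> of line \<open>l + 1\<close>. The condition
  \<open>narrow\<close> says that tiles of neighbouring strips have at most one edge in common.
\<close>

locale strip_system =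
  fixes m n :: nat and lo hi gl gh :: "int \<Rightarrow> int \<Rightarrow> int"
  assumes m3: "m \<ge> 3" and n_even: "even n" and n_pos: "n > 0"
    and lo_hi: "lo l t + hi l t = (int m - 2) * t"
    and lo_step: "lo l t \<le> lo l (t + 1)" and hi_step: "hi l t \<le> hi l (t + 1)"
    and lo_le: "lo l t \<le> x \<longleftrightarrow> t \<le> gl l x" and hi_le: "hi l t \<le> x \<longleftrightarrow> t \<le> gh l x"
    and rungs: "gl l x + gh (l - 1) x = (int n - 2) * x"
    and narrow: "(\<forall>t. lo l (t + 1) \<le> lo l t + 1) \<or> (\<forall>t. hi (l - 1) (t + 1) \<le> hi (l - 1) t + 1)"

text \<open>
  The growth condition on \<open>I\<close> bounds the bottom widths of the tiles of a strip, hence the number of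
  rungs arriving at a vertex of the next line, so the rungs leaving that line grow in the same way.
\<close>

lemma strip_row:
  fixes I :: "int \<Rightarrow> int"
  assumes mn: "m \<ge> 4 \<and> n \<ge> 4 \<and> r = 1 \<or> m = 3 \<and> n \<ge> 6 \<and> r = (2::int)"
    and I: "\<And>x. I x + r \<le> I (x + 1)"
  obtains lo hi gh :: "int \<Rightarrow> int" where
    "\<And>t. lo t + hi t = (int m - 2) * t" "\<And>t. lo t \<le> lo (t + 1)" "\<And>t. lo (t + 1) \<le> lo t + 1"
    "\<And>t. hi t \<le> hi (t + 1)" "\<And>x t. lo t \<le> x \<longleftrightarrow> t \<le> I x" "\<And>x t. hi t \<le> x \<longleftrightarrow> t \<le> gh x"
    "\<And>x. (int n - 2) * x - gh x + r \<le> (int n - 2) * (x + 1) - gh (x + 1)"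
proof -
  have r: "r \<ge> 1" using mn by auto
  have I1: "I x + 1 \<le> I (x + 1)" for x using I[of x] r by linarith
  \<comment> \<open>Rung \<open>t\<close> starts at the first vertex up to which \<open>I\<close>
    counts at least \<open>t\<close>, so the starting points form the lower adjoint of
    \<open>I\<close>.\<close>
  have "\<exists>g. \<forall>x y. g y \<le> x \<longleftrightarrow> y \<le> I x"
  proof (rule int_lower_adjoint)
    show "I x \<le> I y" if "x \<le> y" for x y using int_mono_steps[of I, OF _ that] I1 by (smt (verit, best))
  qed (use int_unbounded[of I 1] I1 in auto)
  then obtain lo where lo: "\<And>x y. lo y \<le> x \<longleftrightarrow> y \<le> I x" by blast
  define hi where "hi t = (int m - 2) * t - lo t" for t
  have lo1: "lo t \<le> lo (t + 1)" for t using lo[of t "lo (t + 1)"] lo[of "t + 1" "lo (t + 1)"] by auto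
  have lo2: "lo (t + r) \<le> lo t + 1" for t
    using lo[of t "lo t"] lo[of "t + r" "lo t + 1"] I[of "lo t"] by auto
  have lo3: "lo (t + 1) \<le> lo t + 1" for t
    using lo2[of t] int_mono_steps[of lo, OF lo1, of "t + 1" "t + r"] r by linarith
  have hi1: "hi t + 1 \<le> hi (t + r)" for t
  proof (cases "m = 3")
    case True
    then show ?thesis using lo2[of t] mn by (auto simp: hi_def algebra_simps)
  next
    case False
    then have "(int m - 2) * (t + r) \<ge> (int m - 2) * t + 2" using mn by (auto simp: algebra_simps)
    then show ?thesis using lo2[of t] by (auto simp: hi_def)
  qed
  have hi2: "hi t \<le> hi (t + 1)" for t
  proof -
    have "(int m - 2) * (t + 1) \<ge> (int m - 2) * t + 1" using mn by (auto simp: algebra_simps)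
    then show ?thesis using lo3[of t] by (auto simp: hi_def)
  qed
  have "\<exists>g. \<forall>x y. hi x \<le> y \<longleftrightarrow> x \<le> g y"
  proof (rule int_upper_adjoint)
    show "hi x \<le> hi y" if "x \<le> y" for x y using int_mono_steps[of hi, OF hi2 that] .
  qed (use int_unbounded[of hi r] hi1 r in auto)
  then obtain gh where gh: "\<And>x y. hi x \<le> y \<longleftrightarrow> x \<le> gh y" by blast
  have gh1: "gh (x + 1) \<le> gh x + r" for x
  proof -
    have "hi (gh (x + 1) - r) \<le> x"
      using hi1[of "gh (x + 1) - r"] gh[of "gh (x + 1)" "x + 1"] by auto
    then show ?thesis using gh by force
  qed
  \<comment> \<open>This amounts to \<open>n - 2 >= 2 * r\<close>, which both alternatives of
    \<open>mn\<close> provide.\<close>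
  have "(int n - 2) * x - gh x + r \<le> (int n - 2) * (x + 1) - gh (x + 1)" for x
    using gh1[of x] mn by (auto simp: algebra_simps)
  moreover have "lo t + hi t = (int m - 2) * t" for t by (simp add: hi_def)
  ultimately show ?thesis using that[of lo hi gh] lo1 lo3 hi2 lo gh by blast
qed

lemma strip_system_exists:
  assumes "m \<ge> 3" "even n" "n \<ge> 4" "(m, n) \<noteq> (3, 4)"
  shows "\<exists>lo hi gl gh. strip_system m n lo hi gl gh"
proof -
  define r :: int where "r = (if m = 3 then 2 else 1)"
  obtain h where h: "n = 2 * h" using assms(2) by blast
  have mn: "m \<ge> 4 \<and> n \<ge> 4 \<and> r = 1 \<or> m = 3 \<and> n \<ge> 6 \<and> r = 2"
    using assms h by (auto simp: r_def)
  define row where "row = (\<lambda>(I :: int \<Rightarrow> int, lo :: int \<Rightarrow> int, hi :: int \<Rightarrow> int, gh :: int \<Rightarrow> int).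
    (\<forall>t. lo t + hi t = (int m - 2) * t) \<and> (\<forall>t. lo t \<le> lo (t + 1)) \<and> (\<forall>t. lo (t + 1) \<le> lo t + 1) \<and>
    (\<forall>t. hi t \<le> hi (t + 1)) \<and> (\<forall>x t. lo t \<le> x \<longleftrightarrow> t \<le> I x) \<and> (\<forall>x t. hi t \<le> x \<longleftrightarrow> t \<le> gh x) \<and>
    (\<forall>x. (int n - 2) * x - gh x + r \<le> (int n - 2) * (x + 1) - gh (x + 1)))"
  have ex: "\<exists>lo hi gh. row (I, lo, hi, gh)" if "\<And>x. I x + r \<le> I (x + 1)" for I
    unfolding row_def prod.case by (rule strip_row[of m n r I, OF mn that]) blast
  define succ where "succ = (\<lambda>(I :: int \<Rightarrow> int, lo :: int \<Rightarrow> int, hi :: int \<Rightarrow> int, gh :: int \<Rightarrow> int)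
     (I' :: int \<Rightarrow> int, lo' :: int \<Rightarrow> int, hi' :: int \<Rightarrow> int, gh' :: int \<Rightarrow> int). \<forall>x. I' x = (int n - 2) * x - gh x)"
  have "\<exists>f. \<forall>j::nat. (row (f j) \<and> (j = 0 \<longrightarrow> fst (f j) = (\<lambda>x. (int h - 1) * x))) \<and> succ (f j) (f (Suc j))"
  proof (rule dependent_nat_choice)
    have "(int h - 1) * x + r \<le> (int h - 1) * (x + 1)" for x
      using mn h by (auto simp: algebra_simps)
    then show "\<exists>R. row R \<and> (0 = 0 \<longrightarrow> fst R = (\<lambda>x. (int h - 1) * x))"
      using ex[of "\<lambda>x. (int h - 1) * x"] by (metis fst_conv)
  next
    fix R and j :: nat assume R: "row R \<and> (j = 0 \<longrightarrow> fst R = (\<lambda>x. (int h - 1) * x))"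
    obtain I lo hi gh where e: "R = (I, lo, hi, gh)" by (metis surj_pair)
    obtain lo' hi' gh' where "row (\<lambda>x. (int n - 2) * x - gh x, lo', hi', gh')"
      using ex[of "\<lambda>x. (int n - 2) * x - gh x"] R unfolding e row_def by auto
    then show "\<exists>S. (row S \<and> (Suc j = 0 \<longrightarrow> fst S = (\<lambda>x. (int h - 1) * x))) \<and> succ R S"
      by (intro exI[of _ "(\<lambda>x. (int n - 2) * x - gh x, lo', hi', gh')"]) (simp add: e succ_def)
  qed
  then obtain f where f: "\<And>j. row (f j)" "fst (f 0) = (\<lambda>x. (int h - 1) * x)" "\<And>j. succ (f j) (f (Suc j))"
    by blast
  define gI lo hi gh where "gI j = fst (f j)" and "lo j = fst (snd (f j))" and "hi j = fst (snd (snd (f j)))"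
    and "gh j = snd (snd (snd (f j)))" for j
  have f': "f j = (gI j, lo j, hi j, gh j)" for j by (simp add: gI_def lo_def hi_def gh_def)
  note R = f(1)[unfolded f' row_def prod.case]
  have R1: "lo j t + hi j t = (int m - 2) * t" "lo j t \<le> lo j (t + 1)" "lo j (t + 1) \<le> lo j t + 1"
    "hi j t \<le> hi j (t + 1)" "lo j t \<le> x \<longleftrightarrow> t \<le> gI j x" "hi j t \<le> x \<longleftrightarrow> t \<le> gh j x" for j t x
    using R[of j] by blast+
  have S: "gI (Suc j) x = (int n - 2) * x - gh j x" for j x
    using f(3)[of j] unfolding f' succ_def by simp
  have S0: "gI 0 x = (int h - 1) * x" for x using f(2) by (simp add: gI_def)
  \<comment> \<open>the strips below line \<open>0\<close> are mirror images of those above\<close>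
  let ?j = "\<lambda>l. nat (- 1 - l)"
  have "strip_system m n (\<lambda>l. if l \<ge> 0 then lo (nat l) else hi (?j l)) (\<lambda>l. if l \<ge> 0 then hi (nat l) else lo (?j l))
    (\<lambda>l. if l \<ge> 0 then gI (nat l) else gh (?j l)) (\<lambda>l. if l \<ge> 0 then gh (nat l) else gI (?j l))"
  proof (rule strip_system.intro)
    fix l x t :: int
    consider "l = 0" | "l > 0" | "l < 0" by linarith
    then show "(if l \<ge> 0 then gI (nat l) else gh (?j l)) x +
       (if l - 1 \<ge> 0 then gh (nat (l - 1)) else gI (?j (l - 1))) x = (int n - 2) * x"
    proof cases
      case 1
      then show ?thesis by (simp add: S0 h algebra_simps)
    next
      case 2
      then have "nat l = Suc (nat (l - 1))" by simp
      then show ?thesis using 2 S[of "nat (l - 1)" x] by simp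
    next
      case 3
      then have "?j (l - 1) = Suc (?j l)" by simp
      then show ?thesis using 3 S[of "?j l" x] by simp
    qed
    show "(if l \<ge> 0 then lo (nat l) else hi (?j l)) t + (if l \<ge> 0 then hi (nat l) else lo (?j l)) t = (int m - 2) * t"
      using R1(1)[of "nat l" t] R1(1)[of "?j l" t] by simp
    show "(if l \<ge> 0 then lo (nat l) else hi (?j l)) t \<le> (if l \<ge> 0 then lo (nat l) else hi (?j l)) (t + 1)"
      "(if l \<ge> 0 then hi (nat l) else lo (?j l)) t \<le> (if l \<ge> 0 then hi (nat l) else lo (?j l)) (t + 1)"
      using R1(2,4)[of "nat l" t] R1(2,4)[of "?j l" t] by presburger+
    show "((if l \<ge> 0 then lo (nat l) else hi (?j l)) t \<le> x) = (t \<le> (if l \<ge> 0 then gI (nat l) else gh (?j l)) x)"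
      "((if l \<ge> 0 then hi (nat l) else lo (?j l)) t \<le> x) = (t \<le> (if l \<ge> 0 then gh (nat l) else gI (?j l)) x)"
      using R1(5,6) by presburger+
    show "(\<forall>t. (if l \<ge> 0 then lo (nat l) else hi (?j l)) (t + 1) \<le> (if l \<ge> 0 then lo (nat l) else hi (?j l)) t + 1) \<or>
      (\<forall>t. (if l - 1 \<ge> 0 then hi (nat (l - 1)) else lo (?j (l - 1))) (t + 1)
         \<le> (if l - 1 \<ge> 0 then hi (nat (l - 1)) else lo (?j (l - 1))) t + 1)"
      using R1(3) by (cases "l \<ge> 0") auto
  qed (use assms in auto)
  then show ?thesis by blast
qed

section \<open>Chessboard signs and the colouring of the vertices\<close>

context strip_system
begin

text \<open>At \<open>l + t\<close> this is the orientation of the colours round the tile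
  \<open>(l, t)\<close>: 1 for counterclockwise, -1 for clockwise.\<close>

definition sg :: "int \<Rightarrow> int" where
  "sg z = (if even z then 1 else - 1)"

lemma sg_simps [simp]: "sg (z + 1) = - sg z" "sg z * sg z = 1" "sg z * (sg z * u) = u"
  by (auto simp: sg_def)

lemma sg_cong: "even (a - b) \<Longrightarrow> sg a = sg b"
  by (auto simp: sg_def)

lemma sg_cases: "sg z = 1 \<or> sg z = - 1"
  by (auto simp: sg_def)

lemma lo_mono: "t \<le> u \<Longrightarrow> lo l t \<le> lo l u"
  using int_mono_steps[of "lo l"] lo_step by blast

lemma hi_mono: "t \<le> u \<Longrightarrow> hi l t \<le> hi l u"
  using int_mono_steps[of "hi l"] hi_step by blast

lemma gl_bounds: "lo l (gl l x) \<le> x" "x < lo l (gl l x + 1)"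
  using lo_le[of l "gl l x" x] lo_le[of l "gl l x + 1" x] by auto

lemma gh_bounds: "hi l (gh l x) \<le> x" "x < hi l (gh l x + 1)"
  using hi_le[of l "gh l x" x] hi_le[of l "gh l x + 1" x] by auto

lemma gl_eq: "lo l t \<le> x \<Longrightarrow> x < lo l (t + 1) \<Longrightarrow> gl l x = t"
  using lo_le[of l t x] lo_le[of l "t + 1" x] by auto

lemma gh_eq: "hi l t \<le> x \<Longrightarrow> x < hi l (t + 1) \<Longrightarrow> gh l x = t"
  using hi_le[of l t x] hi_le[of l "t + 1" x] by auto

lemma lo_hi_step: "lo l (t + 1) - lo l t + (hi l (t + 1) - hi l t) = int m - 2"
  using lo_hi[of l t] lo_hi[of l "t + 1"] by (simp add: algebra_simps)

text \<open>Along line \<open>l\<close> the colour step from \<open>x\<close> to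
  \<open>x + 1\<close> is the sign of the tile \<open>(l, gl l x)\<close> above that edge. The
  remaining constant of each line is fixed along the rung with number 0; the other rungs are then
  handled by \<open>col_rung\<close>.\<close>

lemma colouring_exists:
  "\<exists>col. (\<forall>l x. col l (x + 1) = col l x + sg (l + gl l x)) \<and>
    (\<forall>l. col (l + 1) (hi l 0) = col l (lo l 0) - sg l)"
proof -
  have "\<forall>l. \<exists>B. \<forall>x. B (x + 1) = B x + sg (l + gl l x)"
    using int_primitive[of "\<lambda>x. sg (l + gl l x)" for l] by blast
  then have "\<exists>B. \<forall>l x. B l (x + 1) = B l x + sg (l + gl l x)" by (rule choice)
  then obtain B where B: "\<And>l x. B l (x + 1) = B l x + sg (l + gl l x)" by blast
  obtain c where c: "\<And>l. c (l + 1) = c l + (B l (lo l 0) - sg l - B (l + 1) (hi l 0))"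
    using int_primitive[of "\<lambda>l. B l (lo l 0) - sg l - B (l + 1) (hi l 0)"] by blast
  show ?thesis
    by (intro exI[of _ "\<lambda>l x. c l + B l x"]) (simp add: B c)
qed

definition col :: "int \<Rightarrow> int \<Rightarrow> int" where
  "col = (SOME col. (\<forall>l x. col l (x + 1) = col l x + sg (l + gl l x)) \<and>
    (\<forall>l. col (l + 1) (hi l 0) = col l (lo l 0) - sg l))"

lemma col_step: "col l (x + 1) = col l x + sg (l + gl l x)"
  and col_base: "col (l + 1) (hi l 0) = col l (lo l 0) - sg l"
  using someI_ex[OF colouring_exists, folded col_def] by blast+

lemma col_lo:
  assumes "lo l t + int k \<le> lo l (t + 1)"
  shows "col l (lo l t + int k) = col l (lo l t) + sg (l + t) * int k"
  using assms
proof (induction k)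
  case (Suc k)
  then have "gl l (lo l t + int k) = t" by (intro gl_eq) auto
  then show ?case
    using Suc col_step[of l "lo l t + int k"] by (simp add: algebra_simps)
qed simp

text \<open>The colours of line \<open>l + 1\<close> were fixed by the tiles above it. Since
  \<open>n\<close> is even, \<open>rungs\<close> shows that the numbers of the tiles above and below
  an edge have the same parity; lying in adjacent strips, the two tiles have opposite signs.\<close>

lemma col_hi:
  assumes "hi l t + int k \<le> hi l (t + 1)"
  shows "col (l + 1) (hi l t + int k) = col (l + 1) (hi l t) - sg (l + t) * int k"
  using assms
proof (induction k)
  case (Suc k)
  let ?x = "hi l t + int k"
  have "gh l ?x = t" using Suc by (intro gh_eq) auto
  then have "gl (l + 1) ?x = (int n - 2) * ?x - t"
    using rungs[of "l + 1" ?x] by simp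
  then have "sg (l + 1 + gl (l + 1) ?x) = sg (l + t + 1)"
    using n_even by (intro sg_cong) simp
  then have "sg (l + 1 + gl (l + 1) ?x) = - sg (l + t)" by simp
  then show ?case
    using Suc col_step[of "l + 1" ?x] by (simp add: algebra_simps)
qed simp

text \<open>\<open>D t\<close> is the defect on rung \<open>t\<close>. Two consecutive rungs with
  the bottom and top edges between them make up the \<open>m\<close> sides of a tile, so the defect
  changes by \<open>m\<close> or \<open>- m\<close>; it vanishes on rung 0.\<close>

lemma col_rung: "int m dvd col (l + 1) (hi l t) - col l (lo l t) + sg (l + t)"
proof -
  define D where "D t = col (l + 1) (hi l t) - col l (lo l t) + sg (l + t)" for t
  have D: "D (t + 1) = D t - sg (l + t) * int m" for t
  proof -
    define p q where "p = nat (lo l (t + 1) - lo l t)" and "q = nat (hi l (t + 1) - hi l t)"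
    have p: "lo l (t + 1) = lo l t + int p" and q: "hi l (t + 1) = hi l t + int q"
      using lo_step hi_step by (simp_all add: p_def q_def)
    have "int m = int p + int q + 2" using lo_hi_step[of l t] p q by simp
    moreover have "sg (l + (t + 1)) = - sg (l + t)" using sg_simps(1)[of "l + t"] by (simp only: add.assoc)
    moreover have "col l (lo l (t + 1)) = col l (lo l t) + sg (l + t) * int p" using col_lo[of l t p] p by simp
    moreover have "col (l + 1) (hi l (t + 1)) = col (l + 1) (hi l t) - sg (l + t) * int q" using col_hi[of l t q] q by simp
    ultimately show ?thesis unfolding D_def by (simp add: algebra_simps)
  qed
  have "int m dvd D t"
  proof (induction t rule: int_induct[where k = 0])
    case base
    then show ?case using col_base[of l] by (simp add: D_def)
  next
    case (step1 i)
    then show ?case using D[of i] by simp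
  next
    case (step2 i)
    then show ?case using D[of "i - 1"] by (metis diff_add_cancel dvd_diff dvd_triv_right dvd_add_left_iff)
  qed
  then show ?thesis by (simp add: D_def)
qed

text \<open>The vertices of a tile are numbered counterclockwise, starting at the lower left one.\<close>

fun vtx :: "int \<times> int \<Rightarrow> int \<Rightarrow> int \<times> int" where
  "vtx (l, t) P = (if P \<le> lo l (t + 1) - lo l t then (l, lo l t + P)
     else (l + 1, hi l (t + 1) - (P - (lo l (t + 1) - lo l t) - 1)))"

fun tsg :: "int \<times> int \<Rightarrow> int" where "tsg (l, t) = sg (l + t)"

fun tcol :: "int \<times> int \<Rightarrow> int" where "tcol (l, t) = col l (lo l t)"

fun vcol :: "int \<times> int \<Rightarrow> int" where "vcol (l, x) = col l x"

fun vset :: "int \<times> int \<Rightarrow> (int \<times> int) set" where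
  "vset (l, t) = Pair l ` {lo l t..lo l (t + 1)} \<union> Pair (l + 1) ` {hi l t..hi l (t + 1)}"

text \<open>Vertex number \<open>P\<close> has colour \<open>tcol y + tsg y * P\<close> modulo
  \<open>m\<close>, see \<open>vtx_col\<close>. The sign is its own inverse, so solving for
  \<open>P\<close> gives this formula for the vertex of colour \<open>k\<close>.\<close>

definition A :: "int \<times> int \<Rightarrow> nat \<Rightarrow> int \<times> int" where
  "A y k = vtx y ((tsg y * (int k - tcol y)) mod int m)"

lemma tsg_cases: "tsg y = 1 \<or> tsg y = - 1"
  using sg_cases by (cases y) simp

lemma vtx_in_vset: "0 \<le> P \<Longrightarrow> P < int m \<Longrightarrow> vtx y P \<in> vset y"
  using lo_hi_step[of "fst y" "snd y"] by (cases y) auto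

lemma vtx_inj: "0 \<le> P \<Longrightarrow> P < int m \<Longrightarrow> 0 \<le> Q \<Longrightarrow> Q < int m \<Longrightarrow> vtx y P = vtx y Q \<Longrightarrow> P = Q"
  by (cases y) (auto split: if_splits)

text \<open>Along the bottom the colours are given exactly by \<open>col_lo\<close>. The right rung
  is crossed by \<open>col_rung\<close>, only modulo \<open>m\<close>, and the top edges, run from
  right to left, continue with the same sign.\<close>

lemma vtx_col:
  assumes "0 \<le> P" "P < int m"
  shows "int m dvd vcol (vtx y P) - (tcol y + tsg y * P)"
proof -
  obtain l t where y: "y = (l, t)" by (cases y)
  define p where "p = nat (lo l (t + 1) - lo l t)"
  have p: "lo l (t + 1) = lo l t + int p" using lo_step by (simp add: p_def)
  show ?thesis
  proof (cases "P \<le> int p")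
    case True
    then show ?thesis using col_lo[of l t "nat P"] assms p by (simp add: y)
  next
    case False
    define Q where "Q = P - int p - 1"
    have Q: "0 \<le> Q" "Q \<le> hi l (t + 1) - hi l t"
      using False assms lo_hi_step[of l t] p by (simp_all add: Q_def)
    define H where "H = hi l (t + 1) - hi l t"
    have "col (l + 1) (hi l (t + 1)) = col (l + 1) (hi l t) - sg (l + t) * H"
      using col_hi[of l t "nat H"] hi_step[of l t] by (simp add: H_def)
    moreover have "col (l + 1) (hi l (t + 1) - Q) = col (l + 1) (hi l t) - sg (l + t) * (H - Q)"
      using col_hi[of l t "nat (H - Q)"] Q by (simp add: H_def algebra_simps)
    ultimately have "col (l + 1) (hi l (t + 1) - Q) = col (l + 1) (hi l (t + 1)) + sg (l + t) * Q"
      by (simp add: algebra_simps)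
    moreover have "int m dvd col (l + 1) (hi l (t + 1)) - col l (lo l (t + 1)) + sg (l + (t + 1))"
      by (rule col_rung)
    moreover have "sg (l + (t + 1)) = - sg (l + t)" using sg_simps(1)[of "l + t"] by (simp only: add.assoc)
    moreover have "col l (lo l (t + 1)) = col l (lo l t) + sg (l + t) * int p" using col_lo[of l t p] p by simp
    moreover have "P = Q + int p + 1" by (simp add: Q_def)
    ultimately show ?thesis
      using False p by (simp add: y algebra_simps)
  qed
qed

lemma m_pos: "int m > 0" using m3 by simp

lemma A_col: "int m dvd vcol (A y k) - int k"
proof -
  let ?P = "(tsg y * (int k - tcol y)) mod int m"
  have "int m dvd vcol (A y k) - (tcol y + tsg y * ?P)"
    unfolding A_def using m_pos by (intro vtx_col) simp_all
  moreover have "int m dvd (tcol y + tsg y * ?P) - int k"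
  proof -
    have "int m dvd ?P - tsg y * (int k - tcol y)" by (simp add: mod_eq_dvd_iff[symmetric])
    then have "int m dvd tsg y * (?P - tsg y * (int k - tcol y))" by (rule dvd_mult)
    moreover have "tsg y * (?P - tsg y * (int k - tcol y)) = (tcol y + tsg y * ?P) - int k"
      using tsg_cases[of y] by (auto simp: algebra_simps)
    ultimately show ?thesis by simp
  qed
  ultimately have "int m dvd (vcol (A y k) - (tcol y + tsg y * ?P)) + ((tcol y + tsg y * ?P) - int k)"
    by (rule dvd_add)
  then show ?thesis by simp
qed

text \<open>The colour of a vertex modulo \<open>m\<close> does not refer to the tile, and the
  numbers from 1 to \<open>m\<close> are distinct residues.\<close>

lemma A_colour:
  assumes "i \<in> {1..m}" "j \<in> {1..m}" "A x i = A y j"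
  shows "i = j"
proof -
  have "int m dvd (vcol (A y j) - int i) - (vcol (A y j) - int j)"
    using A_col[of x i] A_col[of y j] unfolding assms(3) by (rule dvd_diff)
  then have "int m dvd int j - int i" by simp
  moreover have "\<bar>int j - int i\<bar> < int m" using assms(1,2) by auto
  ultimately have "int j - int i = 0" using dvd_imp_le_int[of "int j - int i" "int m"] by auto
  then show ?thesis by simp
qed

lemma residue_exists: "\<exists>k\<in>{1..m}. int m dvd int k - z"
proof -
  let ?k = "nat ((z - 1) mod int m) + 1"
  have "0 \<le> (z - 1) mod int m" "(z - 1) mod int m < int m" using m_pos by simp_all
  then have "?k \<in> {1..m}" by (simp add: Suc_le_eq nat_less_iff)
  moreover have "int ?k - z = (z - 1) mod int m - (z - 1)" using m_pos by simp
  moreover have "int m dvd (z - 1) mod int m - (z - 1)" by (simp add: mod_eq_dvd_iff[symmetric])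
  ultimately show ?thesis by metis
qed

lemma A_in_vset: "A y k \<in> vset y"
  unfolding A_def using m_pos by (intro vtx_in_vset) simp_all

lemma nxt_cong: "k \<in> {1..m} \<Longrightarrow> int m dvd int (nxt m k) - (int k + 1)"
  by (cases "k = m") (auto simp: nxt_def)

text \<open>Passing to the next colour means moving one vertex counterclockwise or clockwise,
  according to the sign of the tile.\<close>

lemma A_nxt:
  assumes "k \<in> {1..m}" "A y k = vtx y P" "0 \<le> P" "P < int m"
  shows "A y (nxt m k) = vtx y ((P + tsg y) mod int m)"
proof -
  have P: "(tsg y * (int k - tcol y)) mod int m = P"
    using assms(2-4) m_pos unfolding A_def by (intro vtx_inj[of _ _ y]) simp_all
  have "int m dvd tsg y * (int (nxt m k) - (int k + 1))" using nxt_cong[OF assms(1)] by (rule dvd_mult)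
  then have "(tsg y * (int (nxt m k) - tcol y)) mod int m = (tsg y * (int k - tcol y) + tsg y) mod int m"
    by (simp add: mod_eq_dvd_iff algebra_simps)
  also have "\<dots> = (P + tsg y) mod int m" unfolding P[symmetric] by (simp add: mod_add_left_eq)
  finally show ?thesis by (simp add: A_def)
qed

lemma vtx_is_A:
  assumes "0 \<le> P" "P < int m"
  obtains k where "k \<in> {1..m}" "A y k = vtx y P"
proof -
  obtain k where k: "k \<in> {1..m}" "int m dvd int k - (tcol y + tsg y * P)" using residue_exists by blast
  have "int m dvd tsg y * (int k - (tcol y + tsg y * P))" using k(2) by (rule dvd_mult)
  moreover have "tsg y * (int k - (tcol y + tsg y * P)) = tsg y * (int k - tcol y) - P"
    using tsg_cases[of y] by auto
  ultimately have "(tsg y * (int k - tcol y)) mod int m = P mod int m"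
    by (simp add: mod_eq_dvd_iff)
  then have "A y k = vtx y P" using assms by (simp add: A_def)
  then show ?thesis using that k(1) by blast
qed

section \<open>Sides of tiles and degrees of vertices\<close>

definition is_side :: "int \<times> int \<Rightarrow> (int \<times> int) set \<Rightarrow> bool" where
  "is_side y e \<longleftrightarrow> (\<exists>k\<in>{1..m}. {A y k, A y (nxt m k)} = e)"

text \<open>As sides are unordered, the sign of the tile affects only the direction in which they
  are listed.\<close>

lemma is_side_vtx: "is_side y e \<longleftrightarrow> (\<exists>P. 0 \<le> P \<and> P < int m \<and> {vtx y P, vtx y ((P + 1) mod int m)} = e)"
proof
  assume "is_side y e"
  then obtain k where k: "k \<in> {1..m}" "{A y k, A y (nxt m k)} = e" unfolding is_side_def by blast
  define P where "P = (tsg y * (int k - tcol y)) mod int m"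
  have P: "0 \<le> P" "P < int m" "A y k = vtx y P" using m_pos by (simp_all add: P_def A_def)
  note n = A_nxt[OF k(1) P(3,1,2)]
  show "\<exists>P. 0 \<le> P \<and> P < int m \<and> {vtx y P, vtx y ((P + 1) mod int m)} = e"
  proof (cases "tsg y = 1")
    case True
    then show ?thesis using k P n by auto
  next
    case False
    then have s: "tsg y = - 1" using tsg_cases[of y] by simp
    have "((P + - 1) mod int m + 1) mod int m = P" using P by (simp add: mod_add_left_eq)
    then show ?thesis using k P n m_pos unfolding s
      by (intro exI[of _ "(P + - 1) mod int m"]) (simp add: insert_commute)
  qed
next
  assume "\<exists>P. 0 \<le> P \<and> P < int m \<and> {vtx y P, vtx y ((P + 1) mod int m)} = e"
  then obtain P where P: "0 \<le> P" "P < int m" "{vtx y P, vtx y ((P + 1) mod int m)} = e" by blast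
  show "is_side y e"
  proof (cases "tsg y = 1")
    case True
    obtain k where k: "k \<in> {1..m}" "A y k = vtx y P" using vtx_is_A[OF P(1,2)] by blast
    then show ?thesis using A_nxt[OF k P(1,2)] True P(3) k unfolding is_side_def by (intro bexI[of _ k]) simp_all
  next
    case False
    then have s: "tsg y = - 1" using tsg_cases[of y] by simp
    let ?Q = "(P + 1) mod int m"
    have Q: "0 \<le> ?Q" "?Q < int m" using m_pos by simp_all
    obtain k where k: "k \<in> {1..m}" "A y k = vtx y ?Q" using vtx_is_A[OF Q] by blast
    have "(?Q + - 1) mod int m = P" using P by (simp add: mod_diff_left_eq)
    then show ?thesis using A_nxt[OF k Q] s P(3) k unfolding is_side_def
      by (intro bexI[of _ k]) (simp_all add: insert_commute)
  qed
qed

text \<open>With \<open>p\<close> bottom edges, the sides starting at vertices 0 to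
  \<open>p - 1\<close> are the bottom ones, the side starting at \<open>p\<close> is the right rung,
  those up to \<open>m - 2\<close> form the top from right to left, and the last one closes up along
  the left rung.\<close>

lemma is_side_iff:
  "is_side (l, t) e \<longleftrightarrow>
    (\<exists>x. lo l t \<le> x \<and> x < lo l (t + 1) \<and> e = {(l, x), (l, x + 1)}) \<or>
    (\<exists>x. hi l t \<le> x \<and> x < hi l (t + 1) \<and> e = {(l + 1, x), (l + 1, x + 1)}) \<or>
    e = {(l, lo l t), (l + 1, hi l t)} \<or> e = {(l, lo l (t + 1)), (l + 1, hi l (t + 1))}"
    (is "_ \<longleftrightarrow> ?R")
proof
  define p where "p = lo l (t + 1) - lo l t"
  have p: "0 \<le> p" "p \<le> int m - 2" "hi l (t + 1) = hi l t + (int m - 2 - p)" "lo l (t + 1) = lo l t + p"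
    using lo_step[of l t] hi_step[of l t] lo_hi_step[of l t] by (simp_all add: p_def)
  {
    assume "is_side (l, t) e"
    then obtain P where P: "0 \<le> P" "P < int m" "e = {vtx (l, t) P, vtx (l, t) ((P + 1) mod int m)}"
      unfolding is_side_vtx by blast
    consider "P < p" | "P = p" | "p < P" "P < int m - 1" | "P = int m - 1" using P(2) by linarith
    then show ?R
    proof cases
      case 1
      then have "(P + 1) mod int m = P + 1" using P p by (intro mod_pos_pos_trivial) auto
      then have "e = {(l, lo l t + P), (l, lo l t + P + 1)}" using P(3) p 1 by (simp add: add.assoc)
      then show ?thesis using 1 P(1) p by (intro disjI1 exI[of _ "lo l t + P"]) auto
    next
      case 2
      then have "(P + 1) mod int m = P + 1" using P p by (intro mod_pos_pos_trivial) auto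
      then show ?thesis using P(3) p 2 by simp
    next
      case 3
      then have "(P + 1) mod int m = P + 1" using P p by (intro mod_pos_pos_trivial) auto
      moreover define x where "x = hi l t + (int m - 2 - P)"
      moreover have "vtx (l, t) P = (l + 1, x + 1)" "vtx (l, t) (P + 1) = (l + 1, x)"
        using p 3 by (simp_all add: x_def)
      ultimately have "e = {(l + 1, x + 1), (l + 1, x)}" using P(3) by (simp only:)
      then have "e = {(l + 1, x), (l + 1, x + 1)}" by (simp only: insert_commute)
      then show ?thesis using 3 p by (intro disjI2 disjI1 exI[of _ x]) (auto simp: x_def)
    next
      case 4
      then show ?thesis using P(3) p by (simp add: insert_commute)
    qed
  }
  assume ?R
  then consider x where "lo l t \<le> x" "x < lo l (t + 1)" "e = {(l, x), (l, x + 1)}"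
    | x where "hi l t \<le> x" "x < hi l (t + 1)" "e = {(l + 1, x), (l + 1, x + 1)}"
    | "e = {(l, lo l t), (l + 1, hi l t)}" | "e = {(l, lo l (t + 1)), (l + 1, hi l (t + 1))}" by blast
  then show "is_side (l, t) e"
  proof cases
    case 1
    define P where "P = x - lo l t"
    have "(P + 1) mod int m = P + 1" using 1 p by (intro mod_pos_pos_trivial) (auto simp: P_def)
    then show ?thesis unfolding is_side_vtx using 1 p by (intro exI[of _ P]) (auto simp: P_def)
  next
    case 2
    define P where "P = int m - 2 - (x - hi l t)"
    have "(P + 1) mod int m = P + 1" using 2 p by (intro mod_pos_pos_trivial) (auto simp: P_def)
    moreover have "0 \<le> P" "P < int m" "\<not> P \<le> p" using 2 p by (auto simp: P_def)
    moreover from this have "vtx (l, t) P = (l + 1, x + 1)" "vtx (l, t) (P + 1) = (l + 1, x)"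
      using p by (simp_all add: P_def)
    ultimately show ?thesis unfolding is_side_vtx using 2(3) by (intro exI[of _ P]) (simp only: insert_commute simp_thms)
  next
    case 3
    then show ?thesis unfolding is_side_vtx using p by (intro exI[of _ "int m - 1"]) (simp add: insert_commute)
  next
    case 4
    have "(p + 1) mod int m = p + 1" using p by (intro mod_pos_pos_trivial) auto
    then show ?thesis unfolding is_side_vtx using p 4 by (intro exI[of _ p]) simp
  qed
qed

lemma vset_inter_same_row:
  assumes "t < u"
  shows "vset (l, t) \<inter> vset (l, u) \<subseteq> {(l, lo l (t + 1)), (l + 1, hi l (t + 1))}"
  using lo_mono[of "t + 1" u l] hi_mono[of "t + 1" u l] assms by auto

text \<open>By \<open>narrow\<close> one of two tiles meeting on line \<open>l + 1\<close> has at
  most two vertices there.\<close>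

lemma vset_inter_next_row:
  "\<exists>a. vset (l, t) \<inter> vset (l + 1, u) \<subseteq> {(l + 1, a), (l + 1, a + 1)}"
proof -
  have sub: "vset (l, t) \<inter> vset (l + 1, u) \<subseteq>
    Pair (l + 1) ` ({hi l t..hi l (t + 1)} \<inter> {lo (l + 1) u..lo (l + 1) (u + 1)})"
    by auto
  from narrow[of "l + 1"] show ?thesis
  proof
    assume "\<forall>t. lo (l + 1) (t + 1) \<le> lo (l + 1) t + 1"
    then have "{lo (l + 1) u..lo (l + 1) (u + 1)} \<subseteq> {lo (l + 1) u, lo (l + 1) u + 1}"
      by (auto dest: spec[of _ u])
    then show ?thesis using sub by blast
  next
    assume "\<forall>t. hi (l + 1 - 1) (t + 1) \<le> hi (l + 1 - 1) t + 1"
    then have "{hi l t..hi l (t + 1)} \<subseteq> {hi l t, hi l t + 1}"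
      by (auto dest: spec[of _ t])
    then show ?thesis using sub by blast
  qed
qed

lemma vset_inter:
  assumes "x \<noteq> y"
  shows "\<exists>a b. vset x \<inter> vset y \<subseteq> {a, b}"
proof -
  obtain l t l' t' where xy: "x = (l, t)" "y = (l', t')" by (metis surj_pair)
  consider "l' = l" "t < t'" | "l' = l" "t' < t" | "l' = l + 1" | "l = l' + 1" | "l' > l + 1" | "l > l' + 1"
    using assms xy by fastforce
  then show ?thesis
  proof cases
    case 1 then show ?thesis using vset_inter_same_row xy by blast
  next
    case 2 then show ?thesis using vset_inter_same_row[of t' t l] xy by blast
  next
    case 3 then show ?thesis using vset_inter_next_row[of l t t'] xy by blast
  next
    case 4 then show ?thesis using vset_inter_next_row[of l' t' t] xy by blast
  next
    case 5 then have "vset x \<inter> vset y = {}" unfolding xy by auto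
    then show ?thesis by blast
  next
    case 6 then have "vset x \<inter> vset y = {}" unfolding xy by auto
    then show ?thesis by blast
  qed
qed

lemma A_common:
  assumes "x \<noteq> y"
  shows "card {k \<in> {1..m}. A x k = A y k} \<le> 2"
proof -
  let ?S = "{k \<in> {1..m}. A x k = A y k}"
  obtain a b where ab: "vset x \<inter> vset y \<subseteq> {a, b}" using vset_inter[OF assms] by blast
  have "inj_on (A x) ?S" by (intro inj_onI A_colour[of _ _ x x]) simp_all
  then have c: "card (A x ` ?S) = card ?S" by (rule card_image)
  have "A x ` ?S \<subseteq> {a, b}"
  proof
    fix v assume "v \<in> A x ` ?S"
    then obtain k where k: "k \<in> ?S" "v = A x k" by blast
    then have "v = A y k" by simp
    then have "v \<in> vset x \<inter> vset y" using A_in_vset[of x k] A_in_vset[of y k] k(2) by simp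
    then show "v \<in> {a, b}" using ab by blast
  qed
  then have "card (A x ` ?S) \<le> card {a, b}" by (intro card_mono) simp_all
  moreover have "card {a, b} \<le> 2" by (cases "a = b") simp_all
  ultimately show ?thesis using c by linarith
qed

text \<open>A rung starts at \<open>x\<close> exactly when its number is counted by
  \<open>gl l x\<close> but not by \<open>gl l (x - 1)\<close>, and similarly for the rungs arriving
  from below.\<close>

lemma neighbour_iff:
  "(\<exists>y. is_side y {(l, x), u}) \<longleftrightarrow> u \<in> {(l, x + 1), (l, x - 1)}
     \<union> (\<lambda>t. (l + 1, hi l t)) ` {gl l (x - 1) + 1..gl l x}
     \<union> (\<lambda>t. (l - 1, lo (l - 1) t)) ` {gh (l - 1) (x - 1) + 1..gh (l - 1) x}"
    (is "_ \<longleftrightarrow> u \<in> ?N")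
proof -
  have gl: "t \<in> {gl l (x - 1) + 1..gl l x} \<longleftrightarrow> lo l t = x" for t
    using lo_le[of l t x] lo_le[of l t "x - 1"] by auto
  have gh: "t \<in> {gh (l - 1) (x - 1) + 1..gh (l - 1) x} \<longleftrightarrow> hi (l - 1) t = x" for t
    using hi_le[of "l - 1" t x] hi_le[of "l - 1" t "x - 1"] by auto
  have r: "u = (l + 1, hi l t) \<and> lo l t = x \<or> u = (l - 1, lo (l - 1) t) \<and> hi (l - 1) t = x"
    if "{(l, x), u} = {(r, lo r t), (r + 1, hi r t)}" for r t
    using that by (auto simp: doubleton_eq_iff)
  have h: "u = (l, x + 1) \<or> u = (l, x - 1)" if "{(l, x), u} = {(r, z), (r, z + 1)}" for r z
    using that by (auto simp: doubleton_eq_iff)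
  show ?thesis
  proof
    assume "\<exists>y. is_side y {(l, x), u}"
    then obtain r t where "is_side (r, t) {(l, x), u}" by auto
    then show "u \<in> ?N"
      unfolding is_side_iff
    proof (elim disjE exE conjE)
      fix z assume "{(l, x), u} = {(r, z), (r, z + 1)}"
      from h[OF this] show ?thesis by auto
    next
      fix z assume "{(l, x), u} = {(r + 1, z), (r + 1, z + 1)}"
      from h[OF this] show ?thesis by auto
    next
      assume "{(l, x), u} = {(r, lo r t), (r + 1, hi r t)}"
      from r[OF this] show ?thesis using gl[of t] gh[of t] by blast
    next
      assume "{(l, x), u} = {(r, lo r (t + 1)), (r + 1, hi r (t + 1))}"
      from r[OF this] show ?thesis using gl[of "t + 1"] gh[of "t + 1"] by blast
    qed
  next
    assume "u \<in> ?N"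
    then consider "u = (l, x + 1)" | "u = (l, x - 1)" | t where "u = (l + 1, hi l t)" "lo l t = x"
      | t where "u = (l - 1, lo (l - 1) t)" "hi (l - 1) t = x"
      using gl gh by blast
    then show "\<exists>y. is_side y {(l, x), u}"
    proof cases
      case 1
      then have "is_side (l, gl l x) {(l, x), u}"
        unfolding is_side_iff using gl_bounds(1)[of l x] gl_bounds(2)[of x l] by (intro disjI1 exI[of _ x]) simp
      then show ?thesis by blast
    next
      case 2
      then have "{(l, x), u} = {(l, x - 1), (l, x - 1 + 1)}" by (simp add: insert_commute)
      then have "is_side (l, gl l (x - 1)) {(l, x), u}"
        unfolding is_side_iff using gl_bounds(1)[of l "x - 1"] gl_bounds(2)[of "x - 1" l] by (intro disjI1 exI[of _ "x - 1"]) simp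
      then show ?thesis by blast
    next
      case (3 t)
      then have "is_side (l, t) {(l, x), u}"
        unfolding is_side_iff by (intro disjI2 disjI1) simp
      then show ?thesis by blast
    next
      case (4 t)
      then have "{(l, x), u} = {(l - 1, lo (l - 1) t), (l - 1 + 1, hi (l - 1) t)}" by (simp add: insert_commute)
      then have "is_side (l - 1, t) {(l, x), u}"
        unfolding is_side_iff by (simp only: simp_thms)
      then show ?thesis by blast
    qed
  qed
qed

text \<open>Two neighbours lie on the line; the number of rungs is the increment of
  \<open>rungs\<close> from \<open>x - 1\<close> to \<open>x\<close>, namely \<open>n - 2\<close>.
  Rungs with a common end have distinct other ends because \<open>lo + hi\<close> is strictly
  increasing.\<close>

lemma neighbour_count: "card {u. \<exists>y. is_side y {(l, x), u}} = n"
proof -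
  have m2: "int m - 2 > 0" using m3 by simp
  let ?U = "(\<lambda>t. (l + 1, hi l t)) ` {gl l (x - 1) + 1..gl l x}"
  let ?D = "(\<lambda>t. (l - 1, lo (l - 1) t)) ` {gh (l - 1) (x - 1) + 1..gh (l - 1) x}"
  have eq: "{u. \<exists>y. is_side y {(l, x), u}} = ({(l, x + 1), (l, x - 1)} \<union> ?U) \<union> ?D"
    using neighbour_iff[of l x] by blast
  have lo_x: "lo l t = x" if "t \<in> {gl l (x - 1) + 1..gl l x}" for t
    using lo_le[of l t x] lo_le[of l t "x - 1"] that by auto
  have hi_x: "hi (l - 1) t = x" if "t \<in> {gh (l - 1) (x - 1) + 1..gh (l - 1) x}" for t
    using hi_le[of "l - 1" t x] hi_le[of "l - 1" t "x - 1"] that by auto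
  have "t = t'" if "t \<in> {gl l (x - 1) + 1..gl l x}" "t' \<in> {gl l (x - 1) + 1..gl l x}" "hi l t = hi l t'" for t t'
  proof -
    have "(int m - 2) * t = (int m - 2) * t'"
      using lo_hi[of l t] lo_hi[of l t'] lo_x[OF that(1)] lo_x[OF that(2)] that(3) by simp
    then show ?thesis using m2 by simp
  qed
  then have "card ?U = nat (gl l x - gl l (x - 1))"
    by (subst card_image) (auto intro!: inj_onI)
  moreover have "t = t'" if "t \<in> {gh (l - 1) (x - 1) + 1..gh (l - 1) x}"
    "t' \<in> {gh (l - 1) (x - 1) + 1..gh (l - 1) x}" "lo (l - 1) t = lo (l - 1) t'" for t t'
  proof -
    have "(int m - 2) * t = (int m - 2) * t'"
      using lo_hi[of "l - 1" t] lo_hi[of "l - 1" t'] hi_x[OF that(1)] hi_x[OF that(2)] that(3) by simp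
    then show ?thesis using m2 by simp
  qed
  then have "card ?D = nat (gh (l - 1) x - gh (l - 1) (x - 1))"
    by (subst card_image) (auto intro!: inj_onI)
  moreover have "gl l (x - 1) \<le> gl l x" "gh (l - 1) (x - 1) \<le> gh (l - 1) x"
    unfolding lo_le[symmetric] hi_le[symmetric]
    using gl_bounds(1)[of l "x - 1"] gh_bounds(1)[of "l - 1" "x - 1"] by linarith+
  moreover have "card (({(l, x + 1), (l, x - 1)} \<union> ?U) \<union> ?D) = 2 + card ?U + card ?D"
  proof -
    have "card (({(l, x + 1), (l, x - 1)} \<union> ?U) \<union> ?D) = card ({(l, x + 1), (l, x - 1)} \<union> ?U) + card ?D"
      by (rule card_Un_disjoint) auto
    also have "card ({(l, x + 1), (l, x - 1)} \<union> ?U) = card {(l, x + 1), (l, x - 1)} + card ?U"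
      by (rule card_Un_disjoint) auto
    finally show ?thesis by simp
  qed
  moreover have "gl l x - gl l (x - 1) + (gh (l - 1) x - gh (l - 1) (x - 1)) = int n - 2"
    using rungs[of l x] rungs[of l "x - 1"] by (simp add: algebra_simps)
  moreover have "n \<ge> 2" using n_even n_pos by presburger
  ultimately show ?thesis unfolding eq by linarith
qed

lemma A_neighbours: "card {u. \<exists>y. \<exists>j\<in>{1..m}. {A y j, A y (nxt m j)} = {A x i, u}} = n"
proof -
  obtain l z where "A x i = (l, z)" by (cases "A x i")
  then show ?thesis using neighbour_count[of l z] by (simp add: is_side_def)
qed

section \<open>Tiles as regions of the plane\<close>

fun pt :: "int \<times> int \<Rightarrow> real \<times> real" where
  "pt (r, x) = (of_int x, of_int r)"

text \<open>At half height rung \<open>t\<close> of every strip passes through the abscissa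
  \<open>(m - 2) * t / 2\<close>, by \<open>lo_hi\<close>. The centre is chosen midway between the
  two rungs there, so that it lies inside the tile even if a horizontal side degenerates to a
  vertex, and its distances to the sides in the sense of \<open>hgt\<close> are the same for all
  tiles.\<close>

fun ctr :: "int \<times> int \<Rightarrow> real \<times> real" where
  "ctr (l, t) = ((real m - 2) * (2 * of_int t + 1) / 4, of_int l + 1 / 2)"

definition phi :: "int \<times> int \<Rightarrow> (nat \<Rightarrow> real) \<Rightarrow> real \<times> real" where
  "phi y w = ctr y + (\<Sum>k\<in>{1..m}. w k *\<^sub>R (pt (A y k) - ctr y))"

text \<open>The abscissa at height \<open>Y\<close> of the line through rung
  \<open>t\<close>.\<close>

definition rho :: "int \<Rightarrow> int \<Rightarrow> real \<Rightarrow> real" where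
  "rho l t Y = (of_int l + 1 - Y) * of_int (lo l t) + (Y - of_int l) * of_int (hi l t)"

text \<open>The tile \<open>(l, t)\<close> is the region where the four affine functions \<open>hgt (l, t) q\<close> are nonnegative.\<close>

fun hgt :: "int \<times> int \<Rightarrow> nat \<Rightarrow> real \<times> real \<Rightarrow> real" where
  "hgt (l, t) q (X, Y) = (if q = 0 then Y - of_int l else if q = 1 then of_int l + 1 - Y
     else if q = 2 then X - rho l t Y else rho l (t + 1) Y - X)"

definition kap :: "nat \<Rightarrow> real" where
  "kap q = (if q = 0 \<or> q = 1 then 1 / 2 else (real m - 2) / 4)"

lemma kap_pos: "kap q > 0"
  using m3 by (simp add: kap_def)

lemma lo_hi_real: "of_int (lo l t) + of_int (hi l t) = (real m - 2) * of_int t"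
  using arg_cong[OF lo_hi[of l t], of real_of_int] by simp

lemma hgt_ctr: "hgt y q (ctr y) = kap q"
proof -
  obtain l t where y: "y = (l, t)" by (cases y)
  have r: "rho l u (of_int l + 1 / 2) = (real m - 2) * of_int u / 2" for u
    using lo_hi_real[of l u] by (simp add: rho_def field_simps)
  show ?thesis
    using r[of t] r[of "t + 1"] by (simp add: y kap_def algebra_simps) (simp add: field_simps)
qed

lemma hgt_affine:
  "hgt y q ((1 - a - b) *\<^sub>R p + a *\<^sub>R u + b *\<^sub>R v) = (1 - a - b) * hgt y q p + a * hgt y q u + b * hgt y q v"
  by (cases y; cases p; cases u; cases v) (simp add: rho_def algebra_simps)

lemma phi_index:
  assumes "i \<in> {1..m}" "\<forall>k. k \<notin> {i, nxt m i} \<longrightarrow> w k = 0"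
  shows "phi y w = (1 - w i - w (nxt m i)) *\<^sub>R ctr y + w i *\<^sub>R pt (A y i) + w (nxt m i) *\<^sub>R pt (A y (nxt m i))"
  unfolding phi_def sum_nxt[OF m3 assms, of "\<lambda>k. pt (A y k) - ctr y"]
  by (simp only: scaleR_diff_left scaleR_diff_right scaleR_one add_diff_eq diff_add_eq add.assoc diff_diff_eq)
    (simp add: add.commute scaleR_add_left)

lemma hgt_vset: "v \<in> vset y \<Longrightarrow> 0 \<le> hgt y q (pt v)"
  by (cases y) (auto simp: rho_def)

lemma hgt_side:
  assumes "k \<in> {1..m}"
  shows "\<exists>q. hgt y q (pt (A y k)) = 0 \<and> hgt y q (pt (A y (nxt m k))) = 0"
proof -
  obtain l t where y: "y = (l, t)" by (cases y)
  define a b where "a = A y k" and "b = A y (nxt m k)"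
  have "is_side (l, t) {a, b}" unfolding is_side_def a_def b_def y using assms by blast
  then consider x where "{a, b} = {(l, x), (l, x + 1)}" | x where "{a, b} = {(l + 1, x), (l + 1, x + 1)}"
    | "{a, b} = {(l, lo l t), (l + 1, hi l t)}" | "{a, b} = {(l, lo l (t + 1)), (l + 1, hi l (t + 1))}"
    unfolding is_side_iff by blast
  then have "\<exists>q. \<forall>v\<in>{a, b}. hgt y q (pt v) = 0"
  proof cases
    case 1
    show ?thesis unfolding 1 y by (intro exI[of _ 0]) simp
  next
    case 2
    show ?thesis unfolding 2 y by (intro exI[of _ 1]) simp
  next
    case 3
    show ?thesis unfolding 3 y by (intro exI[of _ 2]) (simp add: rho_def)
  next
    case 4
    show ?thesis unfolding 4 y by (intro exI[of _ 3]) (simp add: rho_def)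
  qed
  then show ?thesis by (auto simp: a_def b_def)
qed

text \<open>\<open>hgt\<close> is affine, equals \<open>kap q\<close> at the centre and is
  nonnegative at the vertices, and some \<open>hgt\<close> vanishes on the outer side of the
  triangle containing the point. Hence \<open>1 - sum w\<close> is the least of the quotients
  \<open>hgt / kap\<close>: the radial coordinate can be recovered from the point.\<close>

lemma hgt_phi:
  assumes "w \<in> fan m"
  shows "(1 - sum w {1..m}) * kap q \<le> hgt y q (phi y w)"
    and "\<exists>q. hgt y q (phi y w) = (1 - sum w {1..m}) * kap q"
proof -
  obtain i where i: "i \<in> {1..m}" "\<forall>k. k \<notin> {i, nxt m i} \<longrightarrow> w k = 0" "\<And>k. w k \<ge> 0"
    using fan_index[OF assms] by metis
  have e: "hgt y q (phi y w) = (1 - sum w {1..m}) * kap q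
      + w i * hgt y q (pt (A y i)) + w (nxt m i) * hgt y q (pt (A y (nxt m i)))" for q
    unfolding phi_index[OF i(1,2)] hgt_affine hgt_ctr using sum_nxt_weight[OF m3 i(1,2)]
    by (simp add: algebra_simps)
  show "(1 - sum w {1..m}) * kap q \<le> hgt y q (phi y w)"
    unfolding e using i(3) hgt_vset[OF A_in_vset] by simp
  show "\<exists>q. hgt y q (phi y w) = (1 - sum w {1..m}) * kap q"
  proof -
    obtain q where "hgt y q (pt (A y i)) = 0" "hgt y q (pt (A y (nxt m i))) = 0"
      using hgt_side[OF i(1)] by blast
    then show ?thesis using e[of q] by (intro exI[of _ q]) simp
  qed
qed

lemma phi_sum_eq:
  assumes "w \<in> fan m" "w' \<in> fan m" "phi y w = phi y w'"
  shows "sum w {1..m} = sum w' {1..m}"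
proof -
  have "sum w' {1..m} \<le> sum w {1..m}" if w: "w \<in> fan m" "w' \<in> fan m" "phi y w = phi y w'" for w w'
  proof -
    obtain q where "hgt y q (phi y w') = (1 - sum w' {1..m}) * kap q" using hgt_phi(2)[OF w(2)] by blast
    then have "(1 - sum w {1..m}) * kap q \<le> (1 - sum w' {1..m}) * kap q"
      using hgt_phi(1)[OF w(1), of q y] w(3) by simp
    then show ?thesis using kap_pos[of q] by (simp add: mult_le_cancel_right)
  qed
  from this[OF assms] this[OF assms(2,1) assms(3)[symmetric]] show ?thesis by linarith
qed

lemma rho_mono_weak:
  assumes "of_int l \<le> Y" "Y \<le> of_int l + 1" "t \<le> u"
  shows "rho l t Y \<le> rho l u Y"
  unfolding rho_def using assms lo_mono[OF assms(3), of l] hi_mono[OF assms(3), of l]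
  by (intro add_mono mult_left_mono) auto

text \<open>Rungs may share an end on a line but never both ends, since \<open>lo + hi\<close>
  increases strictly; strictly between the lines they are disjoint.\<close>

lemma rho_mono:
  assumes "of_int l < Y" "Y < of_int l + 1" "t < u"
  shows "rho l t Y < rho l u Y"
proof -
  have "lo l t \<le> lo l u" "hi l t \<le> hi l u" using assms lo_mono hi_mono by auto
  moreover have "lo l t < lo l u \<or> hi l t < hi l u"
  proof -
    have "(int m - 2) * t < (int m - 2) * u" using assms(3) m3 by (intro mult_strict_left_mono) auto
    then show ?thesis using lo_hi[of l t] lo_hi[of l u] by linarith
  qed
  ultimately consider "lo l t < lo l u" "hi l t \<le> hi l u" | "lo l t \<le> lo l u" "hi l t < hi l u" by blast
  then show ?thesis
  proof cases
    case 1
    then show ?thesis unfolding rho_def using assms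
      by (intro add_less_le_mono mult_strict_left_mono mult_left_mono) auto
  next
    case 2
    then show ?thesis unfolding rho_def using assms
      by (intro add_le_less_mono mult_strict_left_mono mult_left_mono) auto
  qed
qed

lemma interior_tile:
  assumes "\<And>q. hgt y q p > 0" "\<And>q. hgt z q p \<ge> 0"
  shows "y = z"
proof -
  obtain l t l' t' X Y where e: "y = (l, t)" "z = (l', t')" "p = (X, Y)" by (metis surj_pair)
  have y: "of_int l < Y" "Y < of_int l + 1" "rho l t Y < X" "X < rho l (t + 1) Y"
    using assms(1)[of 0] assms(1)[of 1] assms(1)[of 2] assms(1)[of 3] by (simp_all add: e)
  have z: "of_int l' \<le> Y" "Y \<le> of_int l' + 1" "rho l' t' Y \<le> X" "X \<le> rho l' (t' + 1) Y"
    using assms(2)[of 0] assms(2)[of 1] assms(2)[of 2] assms(2)[of 3] by (simp_all add: e)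
  have l: "l' = l" using y(1,2) z(1,2) by linarith
  have "t' < t + 1"
    using rho_mono_weak[of l Y "t + 1" t'] y z(3) l by (smt (verit))
  moreover have "t < t' + 1"
    using rho_mono_weak[of l Y "t' + 1" t] y z(4) l by (smt (verit))
  ultimately show ?thesis using e l by simp
qed

section \<open>Weights on the 1-skeleton; injectivity of the parametrization\<close>

text \<open>\<open>mu p v\<close> is the weight of the vertex \<open>v\<close> at a point \<open>p\<close> of the 1-skeleton, read off from \<open>p\<close> alone.\<close>

fun mu :: "real \<times> real \<Rightarrow> int \<times> int \<Rightarrow> real" where
  "mu (X, Y) (r, x) =
    (if Y \<in> \<int> then (if of_int r = Y then max 0 (1 - \<bar>X - of_int x\<bar>) else 0)
     else if r = \<lfloor>Y\<rfloor> \<and> (\<exists>t. x = lo \<lfloor>Y\<rfloor> t \<and> rho \<lfloor>Y\<rfloor> t Y = X) then of_int \<lfloor>Y\<rfloor> + 1 - Y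
     else if r = \<lfloor>Y\<rfloor> + 1 \<and> (\<exists>t. x = hi \<lfloor>Y\<rfloor> t \<and> rho \<lfloor>Y\<rfloor> t Y = X) then Y - of_int \<lfloor>Y\<rfloor>
     else 0)"

definition good_edge :: "int \<times> int \<Rightarrow> int \<times> int \<Rightarrow> bool" where
  "good_edge a b \<longleftrightarrow> a \<noteq> b \<and> (\<forall>u v. 0 \<le> u \<longrightarrow> u \<le> 1 \<longrightarrow>
     mu ((1 - u) *\<^sub>R pt a + u *\<^sub>R pt b) v = (if v = a then 1 - u else if v = b then u else 0))"

lemma good_edge_sym: "good_edge a b \<Longrightarrow> good_edge b a"
  unfolding good_edge_def
proof (intro conjI allI impI)
  fix u :: real and v
  assume g: "a \<noteq> b \<and> (\<forall>u v. 0 \<le> u \<longrightarrow> u \<le> 1 \<longrightarrow>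
     mu ((1 - u) *\<^sub>R pt a + u *\<^sub>R pt b) v = (if v = a then 1 - u else if v = b then u else 0))"
    and u: "0 \<le> u" "u \<le> 1"
  from g have "mu ((1 - (1 - u)) *\<^sub>R pt a + (1 - u) *\<^sub>R pt b) v =
      (if v = a then 1 - (1 - u) else if v = b then 1 - u else 0)"
    using u by (metis diff_ge_0_iff_ge diff_le_eq le_add_same_cancel1)
  then show "mu ((1 - u) *\<^sub>R pt b + u *\<^sub>R pt a) v = (if v = b then 1 - u else if v = a then u else 0)"
    using g by (simp add: add.commute)
qed blast

lemma good_edgeD:
  "good_edge a b \<Longrightarrow> 0 \<le> u \<Longrightarrow> u \<le> 1 \<Longrightarrow>
     mu ((1 - u) *\<^sub>R pt a + u *\<^sub>R pt b) v = (if v = a then 1 - u else if v = b then u else 0)"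
  unfolding good_edge_def by blast

lemma good_edge_horizontal: "good_edge (r, x) (r, x + 1)"
  unfolding good_edge_def
proof (intro conjI allI impI)
  fix u :: real and v :: "int \<times> int" assume u: "0 \<le> u" "u \<le> 1"
  obtain r' x' where v: "v = (r', x')" by (cases v)
  have p: "(1 - u) *\<^sub>R pt (r, x) + u *\<^sub>R pt (r, x + 1) = (of_int x + u, of_int r)"
    by (simp add: algebra_simps)
  consider "x' \<le> x - 1" | "x' = x" | "x' = x + 1" | "x' \<ge> x + 2" by linarith
  then have mx: "max 0 (1 - \<bar>of_int x + u - of_int x'\<bar>) = (if x' = x then 1 - u else if x' = x + 1 then u else 0)"
  proof cases
    case 1
    then have "real_of_int x' \<le> of_int x - 1" by linarith
    then show ?thesis using 1 u by simp
  next
    case 4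
    then have "real_of_int x' \<ge> of_int x + 2" by linarith
    then show ?thesis using 4 u by simp
  qed (use u in auto)
  have e: "mu (of_int x + u, of_int r) (r', x') =
      (if r' = r then max 0 (1 - \<bar>of_int x + u - of_int x'\<bar>) else 0)" by simp
  show "mu ((1 - u) *\<^sub>R pt (r, x) + u *\<^sub>R pt (r, x + 1)) v =
      (if v = (r, x) then 1 - u else if v = (r, x + 1) then u else 0)"
    unfolding p v e mx by auto
qed simp

lemma rho_inj:
  assumes "of_int l < Y" "Y < of_int l + 1" "rho l t Y = rho l u Y"
  shows "t = u"
  using rho_mono[OF assms(1,2), of t u] rho_mono[OF assms(1,2), of u t] assms(3) by (cases t u rule: linorder_cases) auto

lemma good_edge_rung: "good_edge (l, lo l t) (l + 1, hi l t)"
  unfolding good_edge_def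
proof (intro conjI allI impI)
  fix u :: real and v :: "int \<times> int" assume u: "0 \<le> u" "u \<le> 1"
  obtain r x where v: "v = (r, x)" by (cases v)
  let ?X = "(1 - u) * of_int (lo l t) + u * of_int (hi l t)"
  have p: "(1 - u) *\<^sub>R pt (l, lo l t) + u *\<^sub>R pt (l + 1, hi l t) = (?X, of_int l + u)"
    by (simp add: algebra_simps)
  \<comment> \<open>The end points lie on integer lines, where \<open>mu\<close> is a hat function;
    strictly between the lines \<open>rho_inj\<close> identifies the rung.\<close>
  consider "u = 0" | "u = 1" | "0 < u" "u < 1" using u by linarith
  then show "mu ((1 - u) *\<^sub>R pt (l, lo l t) + u *\<^sub>R pt (l + 1, hi l t)) v =
      (if v = (l, lo l t) then 1 - u else if v = (l + 1, hi l t) then u else 0)"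
  proof cases
    case 1
    have mx: "max 0 (1 - \<bar>of_int (lo l t) - of_int x\<bar>) = (if x = lo l t then 1 else 0 :: real)"
      by (auto simp: max_def)
    have p0: "(?X, of_int l + u) = (of_int (lo l t), of_int l)" using 1 by simp
    have e: "mu (of_int (lo l t), of_int l) (r, x) =
      (if r = l then max 0 (1 - \<bar>of_int (lo l t) - of_int x\<bar>) else 0)" by simp
    show ?thesis unfolding p p0 v e mx using 1 by auto
  next
    case 2
    have mx: "max 0 (1 - \<bar>of_int (hi l t) - of_int x\<bar>) = (if x = hi l t then 1 else 0 :: real)"
      by (auto simp: max_def)
    have p0: "(?X, of_int l + u) = (of_int (hi l t), of_int (l + 1))" using 2 by simp
    have e: "mu (of_int (hi l t), of_int (l + 1)) (r, x) =
      (if r = l + 1 then max 0 (1 - \<bar>of_int (hi l t) - of_int x\<bar>) else 0)"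
      by (simp only: mu.simps Ints_of_int of_int_eq_iff if_True)
    show ?thesis unfolding p p0 v e mx using 2 by auto
  next
    case 3
    have f: "\<lfloor>of_int l + u\<rfloor> = l" using 3 by (simp add: floor_eq_iff)
    have ni: "of_int l + u \<notin> \<int>"
    proof
      assume "of_int l + u \<in> \<int>"
      then have "of_int \<lfloor>of_int l + u\<rfloor> = of_int l + u" by simp
      then show False using 3 f by simp
    qed
    have "rho l s (of_int l + u) = ?X \<longleftrightarrow> s = t" for s
    proof -
      have "rho l t (of_int l + u) = ?X" by (simp add: rho_def algebra_simps)
      then show ?thesis using rho_inj[of l "of_int l + u" s t] 3 by auto
    qed
    then show ?thesis unfolding p v using 3 f ni by (auto simp: algebra_simps)
  qed
qed simp

lemma good_edge_side:
  assumes "is_side y {a, b}"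
  shows "good_edge a b"
proof -
  obtain l t where y: "y = (l, t)" by (cases y)
  have "\<exists>c d. {a, b} = {c, d} \<and> good_edge c d"
    using assms unfolding y is_side_iff
  proof (elim disjE exE conjE)
    fix x assume "{a, b} = {(l, x), (l, x + 1)}"
    then show ?thesis using good_edge_horizontal by metis
  next
    fix x assume "{a, b} = {(l + 1, x), (l + 1, x + 1)}"
    then show ?thesis using good_edge_horizontal by metis
  next
    assume "{a, b} = {(l, lo l t), (l + 1, hi l t)}"
    then show ?thesis using good_edge_rung by metis
  next
    assume "{a, b} = {(l, lo l (t + 1)), (l + 1, hi l (t + 1))}"
    then show ?thesis using good_edge_rung by metis
  qed
  then obtain c d where cd: "{a, b} = {c, d}" "good_edge c d" by blast
  from cd(1) have "a = c \<and> b = d \<or> a = d \<and> b = c" by (simp only: doubleton_eq_iff)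
  then show ?thesis using cd(2) good_edge_sym by blast
qed

lemma A_side: "k \<in> {1..m} \<Longrightarrow> good_edge (A y k) (A y (nxt m k))"
  by (rule good_edge_side[of y]) (auto simp: is_side_def)

text \<open>\<open>mu\<close> does not refer to a tile, so a point on the boundaries of two tiles
  has the same positively weighted vertices, with the same weights, in both.\<close>

lemma mu_phi:
  assumes "w \<in> fan m" "sum w {1..m} = 1"
  shows "k \<in> {1..m} \<Longrightarrow> mu (phi y w) (A y k) = w k"
    and "mu (phi y w) v > 0 \<Longrightarrow> \<exists>k\<in>{1..m}. v = A y k"
proof -
  obtain i where i: "i \<in> {1..m}" "\<forall>k. k \<notin> {i, nxt m i} \<longrightarrow> w k = 0" "\<And>k. w k \<ge> 0"
    using fan_index[OF assms(1)] by metis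
  note ni = nxt_props(1)[OF m3 i(1)]
  have s: "w i = 1 - w (nxt m i)" using sum_nxt_weight[OF m3 i(1,2)] assms(2) by simp
  have "phi y w = (1 - w (nxt m i)) *\<^sub>R pt (A y i) + w (nxt m i) *\<^sub>R pt (A y (nxt m i))"
    using phi_index[OF i(1,2), of y] s by simp
  then have mu: "mu (phi y w) v = (if v = A y i then w i else if v = A y (nxt m i) then w (nxt m i) else 0)" for v
    using good_edgeD[OF A_side[OF i(1), of y], of "w (nxt m i)" v] i(3)[of "nxt m i"] i(3)[of i] s by simp
  show "mu (phi y w) (A y k) = w k" if "k \<in> {1..m}"
  proof (cases "k \<in> {i, nxt m i}")
    case True
    then show ?thesis using A_side[OF i(1), of y] by (auto simp: mu good_edge_def)
  next
    case False
    then have "A y k \<noteq> A y i" "A y k \<noteq> A y (nxt m i)" using A_colour[OF that] i(1) ni by blast+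
    then show ?thesis using False i(2) by (simp add: mu)
  qed
  show "\<exists>k\<in>{1..m}. v = A y k" if "mu (phi y w) v > 0"
    using that i(1) ni unfolding mu by (auto split: if_splits)
qed

lemma phi_full:
  assumes "sum w {1..m} = 1"
  shows "phi y w = (\<Sum>k\<in>{1..m}. w k *\<^sub>R pt (A y k))"
proof -
  have "phi y w = ctr y + ((\<Sum>k\<in>{1..m}. w k *\<^sub>R pt (A y k)) - (\<Sum>k\<in>{1..m}. w k) *\<^sub>R ctr y)"
    unfolding phi_def scaleR_sum_left by (simp only: scaleR_diff_right sum_subtractf)
  then show ?thesis using assms by simp
qed

lemma phi_boundary:
  assumes w: "w \<in> fan m" "w' \<in> fan m" "sum w {1..m} = 1" "sum w' {1..m} = 1"
  shows "phi x w = phi y w' \<longleftrightarrow> w = w' \<and> (\<forall>k\<in>{1..m}. w k > 0 \<longrightarrow> A x k = A y k)"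
proof
  assume eq: "phi x w = phi y w'"
  have *: "A x k = A y k \<and> w' k = w k" if k: "k \<in> {1..m}" "w k > 0" and w: "w \<in> fan m" "w' \<in> fan m" "sum w {1..m} = 1" "sum w' {1..m} = 1"
    and eq: "phi x w = phi y w'" for x y w w' k
  proof -
    have m1: "mu (phi x w) (A x k) = w k" using mu_phi(1)[OF w(1,3) k(1)] .
    then have "mu (phi y w') (A x k) > 0" using k(2) eq by simp
    then obtain j where j: "j \<in> {1..m}" "A x k = A y j" using mu_phi(2)[OF w(2,4)] by blast
    then have "k = j" using A_colour[OF k(1) j(1)] by blast
    then show ?thesis using j mu_phi(1)[OF w(2,4) k(1), of y] m1 eq by simp
  qed
  have "w k = w' k" for k
  proof (cases "k \<in> {1..m}")
    case True
    have "w k \<ge> 0" "w' k \<ge> 0" using w by (auto simp: fan_def)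
    then show ?thesis using *[OF True _ w eq] *[OF True _ w(2,1,4,3) eq[symmetric]] by (metis order_le_less)
  next
    case False
    have z: "u k = 0" if u: "u \<in> fan m" for u
    proof -
      obtain i where "i \<in> {1..m}" "\<forall>k. k \<notin> {i, nxt m i} \<longrightarrow> u k = 0" using fan_index[OF u] by metis
      then show ?thesis using False nxt_props(1)[OF m3, of i] by auto
    qed
    show ?thesis using z[OF w(1)] z[OF w(2)] by simp
  qed
  then show "w = w' \<and> (\<forall>k\<in>{1..m}. w k > 0 \<longrightarrow> A x k = A y k)" using *[OF _ _ w eq] by blast
next
  assume R: "w = w' \<and> (\<forall>k\<in>{1..m}. w k > 0 \<longrightarrow> A x k = A y k)"
  have "w k *\<^sub>R pt (A x k) = w' k *\<^sub>R pt (A y k)" if "k \<in> {1..m}" for k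
  proof (cases "w k > 0")
    case False
    moreover have "w k \<ge> 0" using w(1) by (simp add: fan_def)
    ultimately show ?thesis using R by simp
  qed (use R that in simp)
  then show "phi x w = phi y w'" unfolding phi_full[OF w(3)] phi_full[OF w(4)] by (rule sum.cong[OF refl])
qed

lemma fan_scale:
  assumes "w \<in> fan m" "0 \<le> c" "c * sum w {1..m} \<le> 1"
  shows "(\<lambda>k. c * w k) \<in> fan m" "sum (\<lambda>k. c * w k) {1..m} = c * sum w {1..m}"
    "phi y (\<lambda>k. c * w k) = ctr y + c *\<^sub>R (phi y w - ctr y)"
proof -
  show s: "sum (\<lambda>k. c * w k) {1..m} = c * sum w {1..m}" by (simp add: sum_distrib_left)
  obtain i where i: "i \<in> {1..m}" "\<forall>k. k \<notin> {i, nxt m i} \<longrightarrow> w k = 0" "\<And>k. w k \<ge> 0"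
    using fan_index[OF assms(1)] by metis
  show "(\<lambda>k. c * w k) \<in> fan m"
    unfolding fan_def using s assms(2,3) i by auto
  show "phi y (\<lambda>k. c * w k) = ctr y + c *\<^sub>R (phi y w - ctr y)"
    by (simp add: phi_def scaleR_sum_right)
qed

text \<open>An inner point lies in one tile only. Within a tile the sums of the weights agree by
  \<open>phi_sum_eq\<close>, so dividing by the sum moves both weight vectors to the boundary, where
  \<open>phi_boundary\<close> applies.\<close>

lemma phi_interior:
  assumes w: "w \<in> fan m" "w' \<in> fan m" and lt: "sum w {1..m} < 1" and eq: "phi x w = phi y w'"
  shows "x = y \<and> w = w'"
proof -
  have "hgt x q (phi x w) > 0" for q
    using hgt_phi(1)[OF w(1), of q x] mult_pos_pos[of "1 - sum w {1..m}" "kap q"] kap_pos[of q] lt by linarith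
  moreover have "hgt y q (phi x w) \<ge> 0" for q
  proof -
    have "0 \<le> (1 - sum w' {1..m}) * kap q" using w(2) kap_pos[of q] by (auto simp: fan_def)
    then show ?thesis using hgt_phi(1)[OF w(2), of q y] eq by simp
  qed
  ultimately have xy: "x = y" by (rule interior_tile)
  then have s: "sum w {1..m} = sum w' {1..m}" using phi_sum_eq w eq by blast
  have z: "u = (\<lambda>_. 0)" if "u \<in> fan m" "sum u {1..m} = 0" for u
  proof -
    obtain i where i: "i \<in> {1..m}" "\<forall>k. k \<notin> {i, nxt m i} \<longrightarrow> u k = 0" "\<And>k. u k \<ge> 0"
      using fan_index[OF \<open>u \<in> fan m\<close>] by metis
    have "u i = 0" "u (nxt m i) = 0"
      using sum_nxt_weight[OF m3 i(1,2)] that(2) i(3)[of i] i(3)[of "nxt m i"] by linarith+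
    then show ?thesis using i(2) by (intro ext) (metis insertE singletonD)
  qed
  have "w = w'"
  proof (cases "sum w {1..m} = 0")
    case True
    then show ?thesis using z[OF w(1)] z[OF w(2)] s by simp
  next
    case False
    define c where "c = 1 / sum w {1..m}"
    have pos: "sum w {1..m} > 0" using False w(1) by (metis fan_index order_le_less sum_nonneg)
    then have c: "0 \<le> c" "c * sum w {1..m} = 1" "c \<noteq> 0" by (simp_all add: c_def)
    note f = fan_scale[OF w(1) c(1)] and f' = fan_scale[OF w(2) c(1)]
    have "phi y (\<lambda>k. c * w k) = phi y (\<lambda>k. c * w' k)"
      using f(3)[of y] f'(3)[of y] c s eq xy by simp
    then have "(\<lambda>k. c * w k) = (\<lambda>k. c * w' k)"
      using phi_boundary[of "\<lambda>k. c * w k" "\<lambda>k. c * w' k" y y] f f' c s by simp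
    then show ?thesis using c(3) by (metis (no_types, opaque_lifting) mult_left_cancel ext)
  qed
  then show ?thesis using xy by simp
qed

section \<open>Covering of the plane and local finiteness\<close>

lemma side_point:
  assumes "is_side y {a, b}" "0 \<le> u" "u \<le> 1"
  shows "\<exists>w\<in>fan m. sum w {1..m} = 1 \<and> phi y w = (1 - u) *\<^sub>R pt a + u *\<^sub>R pt b"
proof -
  obtain k where k: "k \<in> {1..m}" "{A y k, A y (nxt m k)} = {a, b}" using assms(1) unfolding is_side_def by blast
  note ne = nxt_props(2)[OF m3 k(1)]
  have *: "\<exists>w\<in>fan m. sum w {1..m} = 1 \<and> phi y w = (1 - u) *\<^sub>R pt (A y k) + u *\<^sub>R pt (A y (nxt m k))"
    if "0 \<le> u" "u \<le> 1" for u
  proof -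
    define w where "w j = (if j = k then 1 - u else if j = nxt m k then u else 0)" for j
    note f = fan_edge[OF m3 k(1) refl that, folded w_def]
    have "phi y w = (1 - u) *\<^sub>R pt (A y k) + u *\<^sub>R pt (A y (nxt m k))"
      using phi_index[OF k(1), of w y] ne by (simp add: w_def)
    then show ?thesis using f(1,2) by blast
  qed
  from k(2) consider "A y k = a" "A y (nxt m k) = b" | "A y k = b" "A y (nxt m k) = a"
    by (metis doubleton_eq_iff)
  then show ?thesis
  proof cases
    case 1
    then show ?thesis using *[OF assms(2,3)] by simp
  next
    case 2
    then show ?thesis using *[of "1 - u"] assms(2,3) by (simp add: add.commute)
  qed
qed

text \<open>The right end is a separate case: no edge of the row starts there, and it is the only
  point when \<open>a = b\<close>. In \<open>boundary_point\<close> it is taken as an end of the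
  right rung.\<close>

lemma row_point:
  assumes "real_of_int a \<le> X" "X \<le> of_int b"
  obtains "X = of_int b" | x where "a \<le> x" "x < b" "0 \<le> X - of_int x" "X - of_int x \<le> 1"
proof (cases "X = of_int b")
  case False
  then have "a \<le> \<lfloor>X\<rfloor>" "\<lfloor>X\<rfloor> < b" using assms by (simp_all add: le_floor_iff floor_less_iff)
  moreover have "0 \<le> X - of_int \<lfloor>X\<rfloor>" "X - of_int \<lfloor>X\<rfloor> \<le> 1" by linarith+
  ultimately show ?thesis using that(2) by blast
qed (use that(1) in blast)

lemma boundary_point:
  assumes nonneg: "\<And>q. hgt y q p \<ge> 0" and zero: "hgt y q p = 0"
  shows "\<exists>w\<in>fan m. sum w {1..m} = 1 \<and> phi y w = p"
proof -
  obtain l t X Y where e: "y = (l, t)" "p = (X, Y)" by (metis surj_pair)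
  have h: "of_int l \<le> Y" "Y \<le> of_int l + 1" "rho l t Y \<le> X" "X \<le> rho l (t + 1) Y"
    using nonneg[of 0] nonneg[of 1] nonneg[of 2] nonneg[of 3] by (simp_all add: e)
  have "\<exists>a b u. is_side y {a, b} \<and> 0 \<le> u \<and> u \<le> 1 \<and> p = (1 - u) *\<^sub>R pt a + u *\<^sub>R pt b"
  proof -
    have rung: ?thesis if "s = t \<or> s = t + 1" "X = rho l s Y" for s
      unfolding e is_side_iff using that h
      by (intro exI[of _ "(l, lo l s)"] exI[of _ "(l + 1, hi l s)"] exI[of _ "Y - of_int l"])
        (auto simp: rho_def algebra_simps)
    consider "Y = of_int l" | "Y = of_int l + 1" | "X = rho l t Y" | "X = rho l (t + 1) Y"
      using zero by (auto simp: e split: if_splits)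
    then show ?thesis
    proof cases
      case 1
      then have "of_int (lo l t) \<le> X" "X \<le> of_int (lo l (t + 1))" using h by (simp_all add: rho_def)
      then show ?thesis
      proof (cases rule: row_point)
        case 1
        then show ?thesis using rung[of "t + 1"] \<open>Y = of_int l\<close> by (simp add: rho_def)
      next
        case (2 x)
        then have "is_side y {(l, x), (l, x + 1)}" unfolding e is_side_iff by blast
        then show ?thesis using 2 \<open>Y = of_int l\<close> unfolding e(2)
          by (intro exI[of _ "(l, x)"] exI[of _ "(l, x + 1)"] exI[of _ "X - of_int x"]) (simp add: algebra_simps)
      qed
    next
      case 2
      then have "of_int (hi l t) \<le> X" "X \<le> of_int (hi l (t + 1))" using h by (simp_all add: rho_def)
      then show ?thesis
      proof (cases rule: row_point)
        case 1
        then show ?thesis using rung[of "t + 1"] \<open>Y = of_int l + 1\<close> by (simp add: rho_def)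
      next
        case (2 x)
        then have "is_side y {(l + 1, x), (l + 1, x + 1)}" unfolding e is_side_iff by blast
        then show ?thesis using 2 \<open>Y = of_int l + 1\<close> unfolding e(2)
          by (intro exI[of _ "(l + 1, x)"] exI[of _ "(l + 1, x + 1)"] exI[of _ "X - of_int x"]) (simp add: algebra_simps)
      qed
    next
      case 3
      then show ?thesis using rung by blast
    next
      case 4
      then show ?thesis using rung by blast
    qed
  qed
  then show ?thesis using side_point by metis
qed

text \<open>The tile is bounded on the left by the last rung not to the right of the point. The
  adjoints provide such a rung and an upper bound for them, since a rung lies on the same side of
  the point as its two ends if these agree.\<close>

lemma tile_at: "\<exists>y. \<forall>q. hgt y q p \<ge> 0"
proof -
  obtain X Y where p: "p = (X, Y)" by (cases p)
  define l where "l = \<lfloor>Y\<rfloor>"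
  have l: "of_int l \<le> Y" "Y < of_int l + 1" by (simp_all add: l_def)
  have low: "rho l t Y \<le> X" if "lo l t \<le> \<lfloor>X\<rfloor>" "hi l t \<le> \<lfloor>X\<rfloor>" for t
  proof -
    have b: "of_int (lo l t) \<le> X" "of_int (hi l t) \<le> X" using that by (simp_all add: le_floor_iff)
    have "rho l t Y \<le> (of_int l + 1 - Y) * X + (Y - of_int l) * X"
      unfolding rho_def using b l by (intro add_mono mult_left_mono) auto
    then show ?thesis by (simp add: algebra_simps)
  qed
  have high: "X < rho l t Y" if "\<lfloor>X\<rfloor> < lo l t" "\<lfloor>X\<rfloor> < hi l t" for t
  proof -
    have b: "X < of_int (lo l t)" "X < of_int (hi l t)" using that by (simp_all add: floor_less_iff)
    have "(of_int l + 1 - Y) * X + (Y - of_int l) * X < rho l t Y"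
      unfolding rho_def using b l by (intro add_less_le_mono mult_strict_left_mono mult_left_mono) auto
    then show ?thesis by (simp add: algebra_simps)
  qed
  have "rho l (min (gl l \<lfloor>X\<rfloor>) (gh l \<lfloor>X\<rfloor>)) Y \<le> X"
    by (rule low) (simp_all add: lo_le hi_le)
  moreover have "t \<le> max (gl l \<lfloor>X\<rfloor>) (gh l \<lfloor>X\<rfloor>)" if "rho l t Y \<le> X" for t
  proof (rule ccontr)
    assume "\<not> t \<le> max (gl l \<lfloor>X\<rfloor>) (gh l \<lfloor>X\<rfloor>)"
    then have "\<not> lo l t \<le> \<lfloor>X\<rfloor>" "\<not> hi l t \<le> \<lfloor>X\<rfloor>" unfolding lo_le hi_le by auto
    then show False using high[of t] that by simp
  qed
  ultimately obtain t where t: "rho l t Y \<le> X" "\<And>u. rho l u Y \<le> X \<Longrightarrow> u \<le> t"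
    using int_greatest[of "\<lambda>t. rho l t Y \<le> X"] by metis
  have "X \<le> rho l (t + 1) Y" using t(2)[of "t + 1"] by linarith
  then have "hgt (l, t) q p \<ge> 0" for q using t(1) l by (simp add: p)
  then show ?thesis by blast
qed

text \<open>\<open>s\<close> is the radial coordinate in the sense of \<open>hgt_phi\<close>, the
  largest value of \<open>1 - hgt / kap\<close>. Dividing by it projects the point from the centre
  to the boundary, where \<open>boundary_point\<close> supplies weights; these are then multiplied
  by \<open>s\<close>.\<close>

lemma phi_cover: "\<exists>y. \<exists>w\<in>fan m. phi y w = p"
proof -
  obtain y where y: "\<And>q. hgt y q p \<ge> 0" using tile_at by blast
  define f where "f q = 1 - hgt y q p / kap q" for q
  define s where "s = Max (f ` {0..3})"
  have s_max: "f q \<le> s" for q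
  proof -
    \<comment> \<open>\<open>hgt\<close> and \<open>kap\<close> do not change beyond
      \<open>q = 3\<close>.\<close>
    have "f q = f (min q 3)" by (cases y; cases p) (auto simp: f_def kap_def min_def)
    moreover have "f (min q 3) \<le> s" unfolding s_def by (intro Max_ge) auto
    ultimately show ?thesis by simp
  qed
  have "s \<in> f ` {0..3}" unfolding s_def by (intro Max_in) auto
  then obtain q0 where q0: "f q0 = s" by auto
  have h: "hgt y q p \<ge> (1 - s) * kap q" for q
  proof -
    have "(1 - s) * kap q \<le> (1 - f q) * kap q" using s_max[of q] kap_pos[of q] by (intro mult_right_mono) auto
    then show ?thesis using kap_pos[of q] by (simp add: f_def)
  qed
  have h0: "hgt y q0 p = (1 - s) * kap q0" using kap_pos[of q0] by (simp add: f_def flip: q0)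
  have s1: "s \<le> 1" using y[of q0] kap_pos[of q0] by (simp add: f_def flip: q0)
  show ?thesis
  proof (cases "s \<le> 0")
    case True
    \<comment> \<open>Each \<open>hgt\<close> is at least its value at the centre. The heights 0 and
      1, and at half height also 2 and 3, have a constant sum, so equality holds throughout and the
      point is the centre.\<close>
    have k: "hgt y q p \<ge> kap q" for q
    proof -
      have "1 * kap q \<le> (1 - s) * kap q" using True kap_pos[of q] by (intro mult_right_mono) auto
      then show ?thesis using h[of q] by simp
    qed
    obtain l t X Y where e: "y = (l, t)" "p = (X, Y)" by (metis surj_pair)
    have Y: "Y = of_int l + 1 / 2" using k[of 0] k[of 1] by (simp add: e kap_def)
    have r: "rho l u Y = (real m - 2) * of_int u / 2" for u
      using lo_hi_real[of l u] by (simp add: rho_def Y field_simps)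
    have "X = (real m - 2) * (2 * of_int t + 1) / 4"
      using k[of 2] k[of 3] r[of t] r[of "t + 1"] by (simp add: e kap_def field_simps)
    then have "p = ctr y" using Y by (simp add: e)
    then have "phi y (\<lambda>_. 0) = p" by (simp add: phi_def)
    moreover have "(\<lambda>_. 0) \<in> fan m" using m3 by (auto simp: fan_def)
    ultimately show ?thesis by blast
  next
    case False
    define b where "b = (1 - 1 / s - 0) *\<^sub>R ctr y + (1 / s) *\<^sub>R p + 0 *\<^sub>R p"
    have hb: "hgt y q b = (hgt y q p - (1 - s) * kap q) / s" for q
      unfolding b_def hgt_affine hgt_ctr using False by (simp add: field_simps)
    have "hgt y q b \<ge> 0" for q unfolding hb using h[of q] False by simp
    moreover have "hgt y q0 b = 0" unfolding hb h0 by simp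
    ultimately obtain w where w: "w \<in> fan m" "sum w {1..m} = 1" "phi y w = b"
      using boundary_point by blast
    have f: "(\<lambda>k. s * w k) \<in> fan m" "phi y (\<lambda>k. s * w k) = ctr y + s *\<^sub>R (b - ctr y)"
      using fan_scale(1)[OF w(1), of s] fan_scale(3)[OF w(1), of s y] w(2,3) s1 False by simp_all
    have "b - ctr y = (1 / s) *\<^sub>R (p - ctr y)" by (simp add: b_def algebra_simps)
    then have "phi y (\<lambda>k. s * w k) = p" using f(2) False by simp
    then show ?thesis using f(1) by blast
  qed
qed

lemma phi_in_tile: "w \<in> fan m \<Longrightarrow> hgt y q (phi y w) \<ge> 0"
proof -
  assume w: "w \<in> fan m"
  have "0 \<le> (1 - sum w {1..m}) * kap q" using w kap_pos[of q] by (auto simp: fan_def)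
  then show ?thesis using hgt_phi(1)[OF w, of q y] by linarith
qed

text \<open>A point of a rung is a convex combination of its ends, so comparing both ends with
  \<open>X\<close> bounds \<open>t\<close> uniformly in \<open>Y\<close>; this is what local
  finiteness requires.\<close>

lemma tile_row_bounds:
  assumes "\<And>q. hgt (l, t) q (X, Y) \<ge> 0"
  shows "t \<le> max (gl l \<lfloor>X\<rfloor>) (gh l \<lfloor>X\<rfloor>)" "min (gl l (\<lceil>X\<rceil> - 1)) (gh l (\<lceil>X\<rceil> - 1)) \<le> t"
proof -
  have h: "of_int l \<le> Y" "Y \<le> of_int l + 1" "rho l t Y \<le> X" "X \<le> rho l (t + 1) Y"
    using assms[of 0] assms[of 1] assms[of 2] assms[of 3] by simp_all
  have c: "(of_int l + 1 - Y) * X + (Y - of_int l) * X = X" by (simp add: algebra_simps)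
  have lt: "X < (of_int l + 1 - Y) * a + (Y - of_int l) * b" if "X < a" "X < b" for a b
  proof (cases "Y = of_int l + 1")
    case False
    then have "(of_int l + 1 - Y) * X + (Y - of_int l) * X < (of_int l + 1 - Y) * a + (Y - of_int l) * b"
      using that h by (intro add_less_le_mono mult_strict_left_mono mult_left_mono) auto
    then show ?thesis using c by simp
  qed (use that in simp)
  have gt: "(of_int l + 1 - Y) * a + (Y - of_int l) * b < X" if "a < X" "b < X" for a b
  proof (cases "Y = of_int l + 1")
    case False
    then have "(of_int l + 1 - Y) * a + (Y - of_int l) * b < (of_int l + 1 - Y) * X + (Y - of_int l) * X"
      using that h by (intro add_less_le_mono mult_strict_left_mono mult_left_mono) auto
    then show ?thesis using c by simp
  qed (use that in simp)
  show "t \<le> max (gl l \<lfloor>X\<rfloor>) (gh l \<lfloor>X\<rfloor>)"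
  proof (rule ccontr)
    assume "\<not> t \<le> max (gl l \<lfloor>X\<rfloor>) (gh l \<lfloor>X\<rfloor>)"
    then have "\<not> lo l t \<le> \<lfloor>X\<rfloor>" "\<not> hi l t \<le> \<lfloor>X\<rfloor>" unfolding lo_le hi_le by auto
    then have "X < of_int (lo l t)" "X < of_int (hi l t)" by (simp_all add: le_floor_iff)
    from lt[OF this] show False using h(3) by (simp add: rho_def)
  qed
  \<comment> \<open>The ceiling of \<open>X\<close> minus 1 is the largest integer strictly below
    \<open>X\<close>.\<close>
  show "min (gl l (\<lceil>X\<rceil> - 1)) (gh l (\<lceil>X\<rceil> - 1)) \<le> t"
  proof (rule ccontr)
    assume "\<not> min (gl l (\<lceil>X\<rceil> - 1)) (gh l (\<lceil>X\<rceil> - 1)) \<le> t"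
    then have "lo l (t + 1) \<le> \<lceil>X\<rceil> - 1" "hi l (t + 1) \<le> \<lceil>X\<rceil> - 1" unfolding lo_le hi_le by auto
    then have "of_int (lo l (t + 1)) < X" "of_int (hi l (t + 1)) < X" by linarith+
    from gt[OF this] show False using h(4) by (simp add: rho_def)
  qed
qed

lemma phi_locally_finite:
  "\<exists>U. open U \<and> p \<in> U \<and> finite {y. \<exists>w\<in>fan m. phi y w \<in> U}"
proof (intro exI conjI)
  obtain X0 Y0 where p: "p = (X0, Y0)" by (cases p)
  define L where "L = {\<lfloor>Y0\<rfloor> - 2..\<lceil>Y0\<rceil> + 1}"
  define a b where "a = \<lfloor>X0\<rfloor> - 2" and "b = \<lceil>X0\<rceil> + 1"
  have mono: "gl l x \<le> gl l x'" "gh l x \<le> gh l x'" if "x \<le> x'" for l x x'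
    unfolding lo_le[symmetric] hi_le[symmetric] using that gl_bounds(1)[of l x] gh_bounds(1)[of l x] by linarith+
  show "open (ball p 1)" "p \<in> ball p 1" by simp_all
  have "{y. \<exists>w\<in>fan m. phi y w \<in> ball p 1} \<subseteq>
      (SIGMA l:L. {min (gl l a) (gh l a)..max (gl l b) (gh l b)})"
  proof
    fix y assume "y \<in> {y. \<exists>w\<in>fan m. phi y w \<in> ball p 1}"
    then obtain w where w: "w \<in> fan m" "phi y w \<in> ball p 1" by blast
    obtain l t X Y where e: "y = (l, t)" "phi y w = (X, Y)" by (metis surj_pair)
    have h: "hgt (l, t) q (X, Y) \<ge> 0" for q using phi_in_tile[OF w(1), of y q] e by simp
    have "dist p (X, Y) < 1" using w(2) unfolding e(2) by simp
    then have "\<bar>X0 - X\<bar> < 1" "\<bar>Y0 - Y\<bar> < 1"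
      using dist_fst_le[of p "(X, Y)"] dist_snd_le[of p "(X, Y)"] by (simp_all add: p dist_real_def)
    moreover have "of_int l \<le> Y" "Y \<le> of_int l + 1" using h[of 0] h[of 1] by simp_all
    ultimately have "l \<in> L" and f: "\<lfloor>X\<rfloor> \<le> b" "a \<le> \<lceil>X\<rceil> - 1"
      unfolding L_def a_def b_def by (simp, linarith+)
    moreover have "t \<le> max (gl l b) (gh l b)" "min (gl l a) (gh l a) \<le> t"
      using tile_row_bounds[OF h] mono[OF f(1), of l] mono[OF f(2), of l] by linarith+
    ultimately show "y \<in> (SIGMA l:L. {min (gl l a) (gh l a)..max (gl l b) (gh l b)})"
      unfolding e by simp
  qed
  moreover have "finite (SIGMA l:L. {min (gl l a) (gh l a)..max (gl l b) (gh l b)})"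
    unfolding L_def by (intro finite_SigmaI) simp_all
  ultimately show "finite {y. \<exists>w\<in>fan m. phi y w \<in> ball p 1}" by (rule finite_subset)
qed

lemma continuous_phi: "continuous_on (polygon m) (\<lambda>p. phi y (weights m p))"
  unfolding phi_def by (intro continuous_intros continuous_weights m3)

sublocale folded_tiling m n A phi "euclidean :: (real \<times> real) topology"
proof (rule folded_tiling.intro)
  show "m \<ge> 3" "n > 0" by (fact m3 n_pos)+
  show "i \<in> {1..m} \<Longrightarrow> j \<in> {1..m} \<Longrightarrow> A x i = A y j \<Longrightarrow> i = j" for i j x y by (fact A_colour)
  show "x \<noteq> y \<Longrightarrow> card {k \<in> {1..m}. A x k = A y k} \<le> 2" for x y by (fact A_common)
  show "card {u. \<exists>y. \<exists>j\<in>{1..m}. {A y j, A y (nxt m j)} = {A x i, u}} = n" for x i by (fact A_neighbours)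
  show "continuous_map (top_of_set (polygon m)) euclidean (\<lambda>p. phi x (weights m p))" for x
    using continuous_phi by simp
  show "w \<in> fan m \<Longrightarrow> w' \<in> fan m \<Longrightarrow> sum w {1..m} < 1 \<Longrightarrow> phi x w = phi y w' \<Longrightarrow> x = y \<and> w = w'" for x y w w'
    by (fact phi_interior)
  show "w \<in> fan m \<Longrightarrow> w' \<in> fan m \<Longrightarrow> sum w {1..m} = 1 \<Longrightarrow> sum w' {1..m} = 1 \<Longrightarrow>
      phi x w = phi y w' \<longleftrightarrow> w = w' \<and> (\<forall>k\<in>{1..m}. w k > 0 \<longrightarrow> A x k = A y k)" for x y w w'
    by (fact phi_boundary)
  show "\<exists>x. \<exists>w\<in>fan m. phi x w = p" for p by (fact phi_cover)
  show "\<exists>U. openin euclidean U \<and> p \<in> U \<and> finite {x. \<exists>w\<in>fan m. phi x w \<in> U}" for p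
    using phi_locally_finite[of p] by simp
  show "Hausdorff_space (euclidean :: (real \<times> real) topology)" by (fact Hausdorff_space_euclidean)
qed

end

section \<open>The octahedron\<close>

type_synonym octant = "bool \<times> bool \<times> bool"

definition axis_sign :: "octant \<Rightarrow> nat \<Rightarrow> bool" where
  "axis_sign x k = (if k = 1 then fst x else if k = 2 then fst (snd x) else snd (snd x))"

text \<open>The vertices of the octahedron are coloured by their coordinate axis. Faces with a
  common edge differ in one sign, hence are mirror images with equal colours along that
  edge.\<close>

definition octa_vertex :: "octant \<Rightarrow> nat \<Rightarrow> nat \<times> bool" where
  "octa_vertex x k = (k, axis_sign x k)"

definition eps :: "octant \<Rightarrow> nat \<Rightarrow> real" where
  "eps x k = (if axis_sign x k then 1 else - 1)"

definition axis :: "3 \<Rightarrow> nat" where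
  "axis j = (if j = 1 then 1 else if j = 2 then 2 else 3)"

text \<open>\<open>octa_point\<close> parametrizes the boundary of the octahedron, the unit sphere of the 1-norm.\<close>

definition octa_point :: "octant \<Rightarrow> (nat \<Rightarrow> real) \<Rightarrow> real ^ 3" where
  "octa_point x w = (\<chi> j. eps x (axis j) * (w (axis j) + (1 - sum w {1..3}) / 3))"

definition octa_phi :: "octant \<Rightarrow> (nat \<Rightarrow> real) \<Rightarrow> real ^ 3" where
  "octa_phi x w = octa_point x w /\<^sub>R norm (octa_point x w)"

lemma one_to_three: "{1..3::nat} = {1, 2, 3}" "{Suc 0..3} = {Suc 0, 2, 3}"
  by auto

lemma axis_simps [simp]: "axis 1 = 1" "axis 2 = 2" "axis 3 = 3"
  by (simp_all add: axis_def)

lemma axis_sign_exists: "\<exists>x. \<forall>k\<in>{1..3}. axis_sign x k = f k"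
  by (rule exI[of _ "(f 1, f 2, f 3)"]) (simp add: one_to_three axis_sign_def)

lemma axis_sign_eqI:
  assumes "\<And>k. k \<in> {1..3} \<Longrightarrow> axis_sign x k = axis_sign y k"
  shows "x = y"
  using assms[of 1] assms[of 2] assms[of 3] by (simp add: axis_sign_def prod_eq_iff)

lemma eps_simps [simp]: "\<bar>eps x k\<bar> = 1" "eps x k \<noteq> 0" "eps x k * eps x k = 1"
  by (simp_all add: eps_def)

lemma octa_abs:
  assumes "w \<in> fan 3" "j \<in> UNIV"
  shows "\<bar>octa_point x w $ j\<bar> = w (axis j) + (1 - sum w {1..3}) / 3"
proof -
  have "0 \<le> w (axis j)" "sum w {1..3} \<le> 1" using assms(1) by (auto simp: fan_def)
  then show ?thesis by (simp add: octa_point_def abs_mult)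
qed

lemma sum3: "sum w {1..3::nat} = w 1 + w 2 + (w 3 :: real)"
  by (simp add: one_to_three)

lemma octa_l1: "w \<in> fan 3 \<Longrightarrow> (\<Sum>j\<in>UNIV. \<bar>octa_point x w $ j\<bar>) = 1"
  by (simp only: octa_abs[OF _ UNIV_I] sum_3 sum3 axis_simps) (simp add: field_simps)

lemma octa_point_nonzero: "w \<in> fan 3 \<Longrightarrow> octa_point x w \<noteq> 0"
  using octa_l1[of w x] by auto

text \<open>Radial projection is injective on the unit sphere of the 1-norm: points on one ray
  differ by the ratio of their 1-norms, which is 1.\<close>

lemma octa_phi_eq_iff:
  assumes "w \<in> fan 3" "w' \<in> fan 3"
  shows "octa_phi x w = octa_phi y w' \<longleftrightarrow> octa_point x w = octa_point y w'"
proof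
  assume eq: "octa_phi x w = octa_phi y w'"
  define c where "c = norm (octa_point x w) / norm (octa_point y w')"
  have nz: "norm (octa_point x w) > 0" "norm (octa_point y w') > 0"
    using octa_point_nonzero assms by simp_all
  then have c: "c > 0" by (simp add: c_def)
  have "octa_point x w = norm (octa_point x w) *\<^sub>R octa_phi x w"
    using nz by (simp add: octa_phi_def)
  also have "\<dots> = c *\<^sub>R octa_point y w'" unfolding eq using nz by (simp add: octa_phi_def c_def divide_inverse)
  finally have e: "octa_point x w = c *\<^sub>R octa_point y w'" .
  then have "(\<Sum>j\<in>UNIV. \<bar>octa_point x w $ j\<bar>) = c * (\<Sum>j\<in>UNIV. \<bar>octa_point y w' $ j\<bar>)"
    using c by (simp add: abs_mult sum_distrib_left)
  then have "c = 1" using octa_l1[OF assms(1), of x] octa_l1[OF assms(2), of y] by simp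
  then show "octa_point x w = octa_point y w'" using e by simp
qed (simp add: octa_phi_def)

text \<open>In a triangle any two corners are consecutive, so the support condition of
  \<open>fan\<close> means that some weight vanishes.\<close>

lemma fan3_zero:
  assumes "w \<in> fan 3"
  shows "w 1 = 0 \<or> w 2 = 0 \<or> w 3 = 0" "\<And>k. k \<notin> {1..3} \<Longrightarrow> w k = 0" "\<And>k. 0 \<le> w k" "sum w {1..3} \<le> 1"
proof -
  obtain i where i: "i \<in> {1..3}" "\<forall>k. k \<notin> {i, nxt 3 i} \<longrightarrow> w k = 0" "\<And>k. 0 \<le> w k" "sum w {1..3} \<le> 1"
    using fan_index[OF assms] by metis
  have n: "nxt 3 1 = 2" "nxt 3 2 = 3" "nxt 3 3 = 1" by (simp_all add: nxt_def)
  have c: "i = 1 \<or> i = 2 \<or> i = 3" using i(1) by (simp add: one_to_three)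
  then show "w 1 = 0 \<or> w 2 = 0 \<or> w 3 = 0" using i(2) n by force
  show "w k = 0" if "k \<notin> {1..3}" for k using c i(2) n that by force
  show "\<And>k. 0 \<le> w k" "sum w {1..3} \<le> 1" by (fact i(3,4))+
qed

lemma fan3I:
  assumes "\<And>k. 0 \<le> w k" "w 1 + w 2 + w 3 \<le> 1" "\<And>k. k \<notin> {1..3} \<Longrightarrow> w k = 0" "w 1 = 0 \<or> w 2 = 0 \<or> w 3 = 0"
  shows "w \<in> fan 3"
proof -
  have n: "nxt 3 1 = 2" "nxt 3 2 = 3" "nxt 3 3 = 1" by (simp_all add: nxt_def)
  have "\<exists>i\<in>{1..3}. \<forall>k. k \<notin> {i, nxt 3 i} \<longrightarrow> w k = 0"
    using assms(4)
  proof (elim disjE)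
    assume z: "w 1 = 0"
    have "w k = 0" if "k \<notin> {2, 3}" for k
      using assms(3)[of k] z that by (cases "k = 1") (auto simp: one_to_three)
    then show ?thesis using n by (intro bexI[of _ 2]) (simp_all only: simp_thms, simp_all)
  next
    assume z: "w 2 = 0"
    have "w k = 0" if "k \<notin> {3, 1}" for k
      using assms(3)[of k] z that by (cases "k = 2") (auto simp: one_to_three)
    then show ?thesis using n by (intro bexI[of _ 3]) (simp_all only: simp_thms, simp_all)
  next
    assume z: "w 3 = 0"
    have "w k = 0" if "k \<notin> {1, 2}" for k
      using assms(3)[of k] z that by (cases "k = 3") (auto simp: one_to_three)
    then show ?thesis using n by (intro bexI[of _ 1]) (simp_all only: simp_thms, simp_all)
  qed
  then show ?thesis unfolding fan_def sum3 using assms(1,2) by blast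
qed

text \<open>The absolute values of the coordinates are the weights plus a common summand. As one
  weight vanishes, their minimum is that summand, which gives the sum of the weights and then the
  weights. A sign is determined wherever the coordinate is nonzero.\<close>

lemma octa_point_eqD:
  assumes w: "w \<in> fan 3" "w' \<in> fan 3" and eq: "octa_point x w = octa_point y w'"
  shows "w = w'" and "k \<in> {1..3} \<Longrightarrow> w k > 0 \<or> sum w {1..3} < 1 \<Longrightarrow> axis_sign x k = axis_sign y k"
proof -
  have a: "w (axis j) + (1 - sum w {1..3}) / 3 = w' (axis j) + (1 - sum w' {1..3}) / 3" for j
    using octa_abs[OF w(1), of j x] octa_abs[OF w(2), of j y] eq by simp
  note a3 = a[of 1, unfolded axis_simps] a[of 2, unfolded axis_simps] a[of 3, unfolded axis_simps]
  note z = fan3_zero[OF w(1)] and z' = fan3_zero[OF w(2)]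
  have min_eq: "S = S'" if "a + (1 - S) / 3 = a' + (1 - S') / 3" "b + (1 - S) / 3 = b' + (1 - S') / 3"
    "c + (1 - S) / 3 = c' + (1 - S') / 3" "0 \<le> a" "0 \<le> b" "0 \<le> c" "0 \<le> a'" "0 \<le> b'" "0 \<le> c'"
    "a = 0 \<or> b = 0 \<or> c = 0" "a' = 0 \<or> b' = 0 \<or> c' = 0" for a b c a' b' c' S S' :: real
    using that by argo
  have s: "sum w {1..3} = sum w' {1..3}"
    by (rule min_eq[OF a3 z(3) z(3) z(3) z'(3) z'(3) z'(3) z(1) z'(1)])
  then have e: "w 1 = w' 1" "w 2 = w' 2" "w 3 = w' 3" using a3 by simp_all
  show ww: "w = w'"
  proof
    fix k show "w k = w' k"
      using e z(2)[of k] z'(2)[of k] by (cases "k \<in> {1..3}") (auto simp: one_to_three)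
  qed
  show "axis_sign x k = axis_sign y k" if k: "k \<in> {1..3}" and pos: "w k > 0 \<or> sum w {1..3} < 1"
  proof -
    have "k = 1 \<or> k = 2 \<or> k = 3" using k by (simp add: one_to_three)
    then obtain j where j: "k = axis j" using axis_simps by metis
    have "w k + (1 - sum w {1..3}) / 3 > 0" using pos z(3)[of k] z(4) by argo
    moreover have "eps x k * (w k + (1 - sum w {1..3}) / 3) = eps y k * (w k + (1 - sum w {1..3}) / 3)"
      using arg_cong[OF eq, of "\<lambda>v. v $ j"] unfolding j by (simp add: octa_point_def ww)
    ultimately have "eps x k = eps y k" by simp
    then show ?thesis by (simp add: eps_def split: if_splits)
  qed
qed

lemma octa_neighbours:
  assumes i: "i \<in> {1..3}"
  shows "{u. \<exists>y. \<exists>j\<in>{1..3}. {octa_vertex y j, octa_vertex y (nxt 3 j)} = {octa_vertex x i, u}}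
    = ({1..3} - {i}) \<times> UNIV" (is "?L = ?R")
proof
  show "?L \<subseteq> ?R"
  proof
    fix u assume "u \<in> ?L"
    then obtain y j where j: "j \<in> {1..3}" "{octa_vertex y j, octa_vertex y (nxt 3 j)} = {octa_vertex x i, u}" by blast
    have n: "nxt 3 j \<in> {1..3}" "nxt 3 j \<noteq> j" using nxt_props[of 3 j] j(1) by auto
    from j(2) have "octa_vertex y j = octa_vertex x i \<and> octa_vertex y (nxt 3 j) = u \<or>
      octa_vertex y j = u \<and> octa_vertex y (nxt 3 j) = octa_vertex x i" by (simp only: doubleton_eq_iff)
    then have "fst u \<in> {1..3} - {i}" using n j(1) by (auto simp: octa_vertex_def simp del: atLeastAtMost_iff)
    then show "u \<in> ?R" by (simp add: mem_Times_iff)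
  qed
  show "?R \<subseteq> ?L"
  proof
    fix u :: "nat \<times> bool" assume "u \<in> ?R"
    then have "fst u \<in> {1..3}" "fst u \<noteq> i" by (simp_all only: mem_Times_iff Diff_iff singleton_iff simp_thms)
    then obtain j b where u: "u = (j, b)" "j \<in> {1..3}" "j \<noteq> i" by (metis prod.collapse)
    obtain y where y: "\<forall>k\<in>{1..3}. axis_sign y k = (if k = i then axis_sign x i else b)"
      using axis_sign_exists[of "\<lambda>k. if k = i then axis_sign x i else b"] by blast
    have v: "octa_vertex y i = octa_vertex x i" "octa_vertex y j = u"
      using y i u by (simp_all add: octa_vertex_def)
    have n: "nxt 3 1 = 2" "nxt 3 2 = 3" "nxt 3 3 = 1" by (simp_all add: nxt_def)
    \<comment> \<open>Among three cyclic colours any two different ones are consecutive.\<close>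
    have "nxt 3 i = j \<or> nxt 3 j = i" using i u(2,3) n by (auto simp: one_to_three)
    then show "u \<in> ?L"
    proof
      assume "nxt 3 i = j"
      then have "{octa_vertex y i, octa_vertex y (nxt 3 i)} = {octa_vertex x i, u}" using v by simp
      then show ?thesis using i by blast
    next
      assume "nxt 3 j = i"
      then have "{octa_vertex y j, octa_vertex y (nxt 3 j)} = {octa_vertex x i, u}" using v by (simp add: insert_commute)
      then show ?thesis using u(2) by blast
    qed
  qed
qed

text \<open>After scaling to 1-norm 1, three times the smallest absolute coordinate \<open>c\<close>
  is the weight of the centre, and the surplus over \<open>c\<close> gives the weights of the
  corners.\<close>

lemma octa_cover:
  assumes "norm p = 1"
  shows "\<exists>x. \<exists>w\<in>fan 3. octa_phi x w = p"
proof -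
  define L where "L = (\<Sum>j\<in>UNIV. \<bar>p $ j\<bar>)"
  have "L > 0"
  proof -
    have "L \<ge> norm p" unfolding L_def by (rule norm_le_l1_cart)
    then show ?thesis using assms by simp
  qed
  define u where "u k = (if k = 1 then \<bar>p $ 1\<bar> / L else if k = 2 then \<bar>p $ 2\<bar> / L else \<bar>p $ 3\<bar> / L)" for k :: nat
  have u: "u 1 = \<bar>p $ 1\<bar> / L" "u 2 = \<bar>p $ 2\<bar> / L" "u 3 = \<bar>p $ 3\<bar> / L" by (simp_all add: u_def)
  have u0: "u k \<ge> 0" for k using \<open>L > 0\<close> by (simp add: u_def)
  have us: "u 1 + u 2 + u 3 = 1" using \<open>L > 0\<close> unfolding u L_def by (simp add: sum_3 flip: add_divide_distrib)
  define c where "c = min (u 1) (min (u 2) (u 3))"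
  define w where "w k = (if k \<in> {1..3} then u k - c else 0)" for k
  have w: "w 1 = u 1 - c" "w 2 = u 2 - c" "w 3 = u 3 - c" by (simp_all add: w_def)
  have c: "c \<le> u 1" "c \<le> u 2" "c \<le> u 3" "c \<ge> 0" "c = u 1 \<or> c = u 2 \<or> c = u 3"
    using u0 by (auto simp: c_def min_def)
  have fan: "w \<in> fan 3"
  proof (rule fan3I)
    show "0 \<le> w k" for k using c by (auto simp: w_def one_to_three)
    show "w 1 + w 2 + w 3 \<le> 1" using us c w by linarith
  qed (use c w in \<open>auto simp: w_def\<close>)
  have sw: "(1 - sum w {1..3}) / 3 = c" unfolding sum3 w using us by simp
  obtain x where x: "\<forall>k\<in>{1..3}. axis_sign x k = (if k = 1 then p $ 1 \<ge> 0 else if k = 2 then p $ 2 \<ge> 0 else p $ 3 \<ge> 0)"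
    using axis_sign_exists[of "\<lambda>k. if k = 1 then p $ 1 \<ge> 0 else if k = 2 then p $ 2 \<ge> 0 else p $ 3 \<ge> 0"] by blast
  have e: "eps x 1 * \<bar>p $ 1\<bar> = p $ 1" "eps x 2 * \<bar>p $ 2\<bar> = p $ 2" "eps x 3 * \<bar>p $ 3\<bar> = p $ 3"
    using x unfolding one_to_three by (simp_all add: eps_def)
  have "octa_point x w $ j = (p /\<^sub>R L) $ j" for j
  proof -
    have "octa_point x w $ j = eps x (axis j) * u (axis j)"
      using sw w exhaust_3[of j] by (auto simp: octa_point_def)
    also have "\<dots> = (p /\<^sub>R L) $ j"
      using e exhaust_3[of j] unfolding u_def by (auto simp: divide_inverse_commute mult.left_commute)
    finally show ?thesis .
  qed
  then have pt: "octa_point x w = p /\<^sub>R L" by (simp add: vec_eq_iff)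
  have "octa_phi x w = p" unfolding octa_phi_def pt using assms \<open>L > 0\<close> by simp
  then show ?thesis using fan by blast
qed

interpretation octahedron: folded_tiling 3 4 octa_vertex octa_phi "top_of_set (sphere 0 1 :: (real ^ 3) set)"
proof (rule folded_tiling.intro)
  show "(3::nat) \<ge> 3" "(4::nat) > 0" by simp_all
  show "octa_vertex x i = octa_vertex y j \<Longrightarrow> i = j" for x y i j by (simp add: octa_vertex_def)
  show "card {k \<in> {1..3}. octa_vertex x k = octa_vertex y k} \<le> 2" if ne: "x \<noteq> y" for x y
  proof -
    obtain k where k: "k \<in> {1..3}" "axis_sign x k \<noteq> axis_sign y k" using axis_sign_eqI[of x y] ne by blast
    have "card {k \<in> {1..3}. octa_vertex x k = octa_vertex y k} \<le> card ({1..3} - {k})"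
      using k by (intro card_mono) (auto simp: octa_vertex_def)
    also have "\<dots> = 2" using k(1) by simp
    finally show ?thesis .
  qed
  show "card {u. \<exists>y. \<exists>j\<in>{1..3}. {octa_vertex y j, octa_vertex y (nxt 3 j)} = {octa_vertex x i, u}} = 4"
    if i: "i \<in> {1..3}" for i x
    unfolding octa_neighbours[OF i] card_cartesian_product using i by simp
  show "continuous_map (top_of_set (polygon 3)) (top_of_set (sphere 0 1)) (\<lambda>p. octa_phi x (weights 3 p))" for x
  proof -
    have "continuous_on (polygon 3) (\<lambda>p. octa_point x (weights 3 p))"
      unfolding octa_point_def by (intro continuous_intros continuous_on_vec_lambda continuous_weights) simp_all
    moreover have "octa_point x (weights 3 p) \<noteq> 0" if "p \<in> polygon 3" for p
      using octa_point_nonzero weights_in_fan that by simp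
    ultimately have "continuous_on (polygon 3) (\<lambda>p. octa_phi x (weights 3 p))"
      unfolding octa_phi_def by (intro continuous_intros) auto
    moreover have "octa_phi x (weights 3 p) \<in> sphere 0 1" if "p \<in> polygon 3" for p
      using octa_point_nonzero[of "weights 3 p" x] weights_in_fan[of 3 p] that by (simp add: octa_phi_def)
    ultimately show ?thesis by auto
  qed
  show "x = y \<and> w = w'" if "w \<in> fan 3" "w' \<in> fan 3" "sum w {1..3} < 1" "octa_phi x w = octa_phi y w'" for x y w w'
    using octa_point_eqD[of w w' x y] octa_phi_eq_iff[of w w' x y] axis_sign_eqI[of x y] that by blast
  show "octa_phi x w = octa_phi y w' \<longleftrightarrow> w = w' \<and> (\<forall>k\<in>{1..3}. w k > 0 \<longrightarrow> octa_vertex x k = octa_vertex y k)"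
    if w: "w \<in> fan 3" "w' \<in> fan 3" "sum w {1..3} = 1" "sum w' {1..3} = 1" for x y w w'
    unfolding octa_phi_eq_iff[OF w(1,2)]
  proof
    assume "octa_point x w = octa_point y w'"
    then show "w = w' \<and> (\<forall>k\<in>{1..3}. w k > 0 \<longrightarrow> octa_vertex x k = octa_vertex y k)"
      using octa_point_eqD[OF w(1,2)] by (simp add: octa_vertex_def)
  next
    assume R: "w = w' \<and> (\<forall>k\<in>{1..3}. w k > 0 \<longrightarrow> octa_vertex x k = octa_vertex y k)"
    have "eps x k * w k = eps y k * w k" if "k \<in> {1..3}" for k
    proof (cases "w k > 0")
      case True
      then show ?thesis using R that by (simp add: octa_vertex_def eps_def)
    next
      case False
      then have "w k = 0" using fan3_zero(3)[OF w(1), of k] by simp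
      then show ?thesis by simp
    qed
    then show "octa_point x w = octa_point y w'"
      unfolding octa_point_def using R w(3) by (auto simp: vec_eq_iff axis_def)
  qed
  show "\<exists>x. \<exists>w\<in>fan 3. octa_phi x w = p" if "p \<in> topspace (top_of_set (sphere 0 1))" for p
    using octa_cover that by simp
  show "\<exists>U. openin (top_of_set (sphere 0 1)) U \<and> p \<in> U \<and> finite {x. \<exists>w\<in>fan 3. octa_phi x w \<in> U}"
    if "p \<in> topspace (top_of_set (sphere 0 1))" for p
    using that by (intro exI[of _ "sphere 0 1"]) auto
  show "Hausdorff_space (top_of_set (sphere 0 1 :: (real ^ 3) set))"
    by (simp add: Hausdorff_space_subtopology)
qed

section \<open>The spaces\<close>

lemma plane_homeomorphic:
  "(euclidean :: (real \<times> real) topology) homeomorphic_space top_of_set {x :: real ^ 3. x $ 3 = 0}"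
proof -
  define f :: "real \<times> real \<Rightarrow> real ^ 3" where
    "f p = (\<chi> j. if j = 1 then fst p else if j = 2 then snd p else 0)" for p
  define g :: "real ^ 3 \<Rightarrow> real \<times> real" where "g x = (x $ 1, x $ 2)" for x
  have "continuous_on UNIV f"
    unfolding f_def
  proof (rule continuous_on_vec_lambda)
    show "continuous_on UNIV (\<lambda>p :: real \<times> real. if j = 1 then fst p else if j = 2 then snd p else 0)" for j :: 3
      by (cases "j = 1"; cases "j = 2") (auto intro!: continuous_intros)
  qed
  moreover have "continuous_on {x. x $ 3 = 0} g"
    unfolding g_def by (intro continuous_intros)
  moreover have "f p $ 3 = 0" for p by (simp add: f_def)
  moreover have "g (f p) = p" for p by (simp add: f_def g_def)
  moreover have "f (g x) = x" if "x $ 3 = 0" for x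
    using that by (simp add: f_def g_def vec_eq_iff forall_3)
  ultimately have "homeomorphic_maps euclidean (top_of_set {x. x $ 3 = 0}) f g"
    by (auto simp: homeomorphic_maps_def continuous_map_in_subtopology)
  then show ?thesis by (auto simp: homeomorphic_space_def)
qed

lemma disc_homeomorphic_plane: "top_of_set poincare_disc homeomorphic_space top_of_set {x :: real ^ 3. x $ 3 = 0}"
proof -
  define f :: "real ^ 3 \<Rightarrow> real ^ 3" where "f x = x /\<^sub>R (1 - norm x)" for x
  define g :: "real ^ 3 \<Rightarrow> real ^ 3" where "g x = x /\<^sub>R (1 + norm x)" for x
  have "continuous_on poincare_disc f"
    unfolding f_def poincare_disc_def by (auto intro!: continuous_intros)
  moreover have "1 + norm x \<noteq> 0" for x :: "real ^ 3" by (metis add_nonneg_eq_0_iff norm_ge_zero zero_le_one zero_neq_one)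
  then have "continuous_on {x. x $ 3 = 0} g"
    unfolding g_def by (auto intro!: continuous_intros)
  moreover have "f x $ 3 = 0" if "x \<in> poincare_disc" for x using that by (simp add: f_def poincare_disc_def)
  moreover have "g x \<in> poincare_disc" if "x $ 3 = 0" for x
  proof -
    have "norm (g x) = norm x / (1 + norm x)" by (simp add: g_def divide_inverse_commute)
    also have "\<dots> < 1" by (simp add: divide_less_eq) (smt (verit) norm_ge_zero)
    finally show ?thesis using that by (simp add: poincare_disc_def g_def)
  qed
  moreover have "g (f x) = x" if "x \<in> poincare_disc" for x
  proof -
    have lt: "1 - norm x > 0" using that by (simp add: poincare_disc_def)
    then have n: "norm (f x) = norm x / (1 - norm x)" by (simp add: f_def divide_inverse_commute)
    have "1 + norm (f x) = 1 / (1 - norm x)" unfolding n using lt by (simp add: field_simps)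
    then show ?thesis using lt by (simp add: g_def f_def)
  qed
  moreover have "f (g x) = x" if "x $ 3 = 0" for x
  proof -
    have pos: "1 + norm x > 0" by (smt (verit) norm_ge_zero)
    then have n: "norm (g x) = norm x / (1 + norm x)" by (simp add: g_def divide_inverse_commute)
    have "1 - norm (g x) = 1 / (1 + norm x)" unfolding n using pos by (simp add: field_simps)
    then show ?thesis using pos by (simp add: g_def f_def)
  qed
  ultimately have "homeomorphic_maps (top_of_set poincare_disc) (top_of_set {x. x $ 3 = 0}) f g"
    by (auto simp: homeomorphic_maps_def continuous_map_in_subtopology)
  then show ?thesis by (auto simp: homeomorphic_space_def)
qed

text \<open>The hyperbolic cosine of the distance is \<open>c\<close>. This function is continuous,
  so hyperbolic balls are open in the Euclidean topology; conversely the lower bound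
  \<open>c1\<close> puts small hyperbolic balls inside Euclidean ones.\<close>

lemma hyperbolic_plane_eq: "hyperbolic_plane = top_of_set poincare_disc"
proof -
  interpret H: Metric_space poincare_disc hyperbolic_dist by (rule Metric_space_hyperbolic)
  define c where "c x y = 1 + 2 * (norm (x - y))\<^sup>2 / ((1 - (norm x)\<^sup>2) * (1 - (norm y)\<^sup>2))"
    for x y :: "real ^ 3"
  have lt: "0 < 1 - (norm x)\<^sup>2" "1 - (norm x)\<^sup>2 \<le> 1" if "x \<in> poincare_disc" for x
    using that by (simp_all add: poincare_disc_def abs_square_less_1)
  have c1: "c x y \<ge> 1 + 2 * (norm (x - y))\<^sup>2" if x: "x \<in> poincare_disc" and y: "y \<in> poincare_disc" for x y
  proof -
    let ?P = "(1 - (norm x)\<^sup>2) * (1 - (norm y)\<^sup>2)"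
    have P: "0 < ?P" "?P \<le> 1" using lt[OF x] lt[OF y] by (simp_all add: mult_le_one)
    have "2 * (norm (x - y))\<^sup>2 * 1 \<le> 2 * (norm (x - y))\<^sup>2 * (1 / ?P)"
      using P by (intro mult_left_mono) simp_all
    then show ?thesis by (simp add: c_def)
  qed
  have d: "hyperbolic_dist x y = arcosh (c x y)" if "x \<in> poincare_disc" "y \<in> poincare_disc" for x y
    using that by (simp add: hyperbolic_dist_def c_def)
  have ge1: "c x y \<ge> 1" if "x \<in> poincare_disc" "y \<in> poincare_disc" for x y
    using c1[OF that] by (smt (verit) zero_le_power2)
  have le: "cosh (hyperbolic_dist x y) = c x y" if "x \<in> poincare_disc" "y \<in> poincare_disc" for x y
    using ge1[OF that] by (simp add: d[OF that])
  have cont: "continuous_on poincare_disc (c x)" if "x \<in> poincare_disc" for x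
  proof -
    have "1 - (norm x)\<^sup>2 \<noteq> 0" "\<And>y. y \<in> poincare_disc \<Longrightarrow> 1 - (norm y)\<^sup>2 \<noteq> 0"
      using lt that by force+
    then show ?thesis unfolding c_def by (intro continuous_intros) auto
  qed
  have ball_open: "openin (top_of_set poincare_disc) (H.mball x r)" if x: "x \<in> poincare_disc" for x r
  proof -
    have "H.mball x r = {y \<in> poincare_disc. c x y \<in> {..< cosh r}} \<or> r \<le> 0"
    proof (cases "r > 0")
      case True
      have "hyperbolic_dist x y < r \<longleftrightarrow> c x y < cosh r" if y: "y \<in> poincare_disc" for y
        using cosh_real_nonneg_less_iff[OF H.nonneg[of x y], of r] True le[OF x y] by simp
      then have "H.mball x r = {y \<in> poincare_disc. c x y \<in> {..< cosh r}}"
        using x by (auto simp: H.mball_def)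
      then show ?thesis by simp
    qed simp
    then show ?thesis
    proof
      assume "H.mball x r = {y \<in> poincare_disc. c x y \<in> {..< cosh r}}"
      also have "\<dots> = poincare_disc \<inter> c x -` {..< cosh r}" by auto
      finally show ?thesis using continuous_openin_preimage_gen[OF cont[OF x], of "{..< cosh r}"] by simp
    next
      assume "r \<le> 0"
      then have "H.mball x r = {}" by (rule H.mball_eq_empty[THEN iffD2, OF disjI2])
      then show ?thesis by simp
    qed
  qed
  have ball_small: "\<exists>r>0. H.mball x r \<subseteq> ball x e" if x: "x \<in> poincare_disc" and e: "e > 0" for x e
  proof (intro exI conjI subsetI)
    have "1 + 2 * e\<^sup>2 > 1" using e by simp
    then show "arcosh (1 + 2 * e\<^sup>2) > 0" by simp
    fix y assume "y \<in> H.mball x (arcosh (1 + 2 * e\<^sup>2))"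
    then have y: "y \<in> poincare_disc" "hyperbolic_dist x y < arcosh (1 + 2 * e\<^sup>2)" by auto
    have "c x y < cosh (arcosh (1 + 2 * e\<^sup>2))"
      using cosh_real_nonneg_less_iff[OF H.nonneg[of x y], of "arcosh (1 + 2 * e\<^sup>2)"] y(2) le[OF x y(1)]
        \<open>arcosh (1 + 2 * e\<^sup>2) > 0\<close> by simp
    also have "\<dots> = 1 + 2 * e\<^sup>2" by simp
    finally have "(norm (x - y))\<^sup>2 < e\<^sup>2" using c1[OF x y(1)] by simp
    then show "y \<in> ball x e" using e by (simp add: dist_norm power_less_imp_less_base)
  qed
  show ?thesis
    unfolding hyperbolic_plane_def topology_eq
  proof (intro allI iffI)
    fix U assume "openin H.mtopology U"
    then have U: "U \<subseteq> poincare_disc" "\<And>x. x \<in> U \<Longrightarrow> \<exists>r>0. H.mball x r \<subseteq> U"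
      by (auto simp: H.openin_mtopology)
    show "openin (top_of_set poincare_disc) U"
    proof (subst openin_subopen, intro ballI)
      fix x assume x: "x \<in> U"
      then obtain r where r: "r > 0" "H.mball x r \<subseteq> U" using U(2) by blast
      have "x \<in> poincare_disc" using x U(1) by blast
      then show "\<exists>T. openin (top_of_set poincare_disc) T \<and> x \<in> T \<and> T \<subseteq> U"
        using r ball_open[of x r] by (intro exI[of _ "H.mball x r"]) simp
    qed
  next
    fix U assume "openin (top_of_set poincare_disc) U"
    then have U: "U \<subseteq> poincare_disc" "\<And>x. x \<in> U \<Longrightarrow> \<exists>e>0. ball x e \<inter> poincare_disc \<subseteq> U"
      by (auto simp: openin_contains_ball)
    show "openin H.mtopology U"
      unfolding H.openin_mtopology
    proof (intro conjI allI impI U(1))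
      fix x assume x: "x \<in> U"
      then obtain e where e: "e > 0" "ball x e \<inter> poincare_disc \<subseteq> U" using U(2) by blast
      obtain r where r: "r > 0" "H.mball x r \<subseteq> ball x e" using ball_small[of x e] x U(1) e(1) by blast
      have "H.mball x r \<subseteq> U" using r(2) e(2) H.mball_subset_mspace[of x r] by blast
      then show "\<exists>r>0. H.mball x r \<subseteq> U" using r(1) by blast
    qed
  qed
qed

text \<open>Of the five spherical symbols only {3,4} has an even second entry, and the disc is
  homeomorphic to the plane.\<close>

lemma tiling_space_plane:
  assumes "even n" "n \<ge> 4" "(m, n) \<noteq> (3, 4)"
  shows "(euclidean :: (real \<times> real) topology) homeomorphic_space tiling_space m n"
proof -
  have "tiling_space m n = top_of_set {x. x $ 3 = 0} \<or> tiling_space m n = hyperbolic_plane"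
    using assms by (auto simp: tiling_space_def)
  then show ?thesis
    using plane_homeomorphic disc_homeomorphic_plane hyperbolic_plane_eq
    by (metis homeomorphic_space_sym homeomorphic_space_trans)
qed

lemma directed_tiling_homeomorphic:
  assumes T: "directed_tiling m n C s t d v X T" and XY: "X homeomorphic_space Y"
  shows "directed_tiling m n C s t d v Y T"
proof -
  have "realization C T (cell m) (cell_map m C s t d v) homeomorphic_space X"
    using T by (simp only: directed_tiling_def)
  from homeomorphic_space_trans[OF this XY] T show ?thesis
    unfolding directed_tiling_def by (elim conjE) (intro conjI; assumption)
qed

theorem proposition4p5:
  fixes m n :: nat and C :: "(nat, 'm) category"
    and s t :: 'm and d v :: "nat \<Rightarrow> 'm"
  assumes "m \<ge> 3" and "mgon_category m C s t d v" and "even n" and "n \<ge> 4"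
  shows "\<exists>T :: (nat, 'm, nat) presheaf.
    directed_tiling m n C s t d v (tiling_space m n) T \<and> reflective m d T"
proof (cases "(m, n) = (3, 4)")
  case True
  then interpret folded_presheaf 3 4 octa_vertex octa_phi "top_of_set (sphere 0 1 :: (real ^ 3) set)" C s t d v
    using assms(2) by (intro folded_presheaf.intro octahedron.folded_tiling_axioms folded_presheaf_axioms.intro) simp
  have "tiling_space m n = top_of_set (sphere 0 1)" using True by (simp add: tiling_space_def)
  then show ?thesis using True directed_tiling_presh reflective_presh by auto
next
  case False
  obtain lo hi gl gh where "strip_system m n lo hi gl gh" using strip_system_exists assms(1,3,4) False by blast
  then interpret S: strip_system m n lo hi gl gh .
  interpret folded_presheaf m n S.A S.phi "euclidean :: (real \<times> real) topology" C s t d v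
    by (intro folded_presheaf.intro S.folded_tiling_axioms folded_presheaf_axioms.intro assms(2))
  show ?thesis
    using directed_tiling_homeomorphic[OF directed_tiling_presh tiling_space_plane[OF assms(3,4) False]] reflective_presh
    by blast
qed

end
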